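(* Let $N \ge 3$ and $\alpha \in (0,N)$. Then for every $\varphi \in \dot H^1(\mathbb{R}^N)$, \[ \mathcal{C}_{N,\alpha,1}\left(\int_{\mathbb{R}^N} |\nabla\varphi|^2 - \int_{\mathbb{R}^N} \frac{\bigl|\nabla\bigl(|x|^{\frac{N-2}{2}}\varphi(x)\bigr)\bigr|^2}{|x|^{N-2}}\,dx\right) \] \[ = \int_{\mathbb{R}^N}\int_{\mathbb{R}^N} \frac{\varphi(x)}{|x|^{\frac{\alpha+2}{2}}}\, I_\alpha(x-y)\, \frac{\varphi(y)}{|y|^{\frac{\alpha+2}{2}}}\,dx\,dy + \frac12 \int_{\mathbb{R}^N}\int_{\mathbb{R}^N} \frac{I_\alpha(x-y)}{|x|^{\frac{N+\alpha}{2}}|y|^{\frac{N+\alpha}{2}}}\,\Bigl|\varphi(x)|x|^{\frac{N-2}{2}}-\varphi(y)|y|^{\frac{N-2}{2}}\Bigr|^2\,dx\,dy, \] where \[ \mathcal{C}_{N,\alpha,1}=\frac{1}{2^{\alpha-2}}\left(\frac{\Gamma\bigl(\frac{N-\alpha}{4}\bigr)}{(N-2)\,\Gamma\bigl(\frac{N+\alpha}{4}\bigr)}\right)^2 . \]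
   Context: All functions are real-valued. For $\alpha\in(0,N)$ the Riesz potential is the function $I_\alpha:\mathbb{R}^N\setminus\{0\}\to\mathbb{R}$, \[ I_\alpha(x)=\frac{\mathcal{A}_\alpha}{|x|^{N-\alpha}},\qquad \mathcal{A}_\alpha=\frac{\Gamma\bigl(\frac{N-\alpha}{2}\bigr)}{2^\alpha\pi^{N/2}\Gamma\bigl(\frac\alpha2\bigr)}, \] where $\Gamma$ is Euler's Gamma function. The homogeneous Sobolev space $\dot H^1(\mathbb{R}^N)$ is the completion of $C^\infty_c(\mathbb{R}^N)$ with respect to the norm defined by $\|\varphi\|_{\dot H^1}^2=\int_{\mathbb{R}^N}|\nabla\varphi|^2\,dx$. *)

theory Defs
  imports "HOL-Analysis.Analysis"
begin

text \<open>\<open>Ck k f\<close>: \<open>f\<close> is of class \<open>C\<^sup>k\<close> on the whole space. The differentiability clause excludes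
  the unspecified values that \<open>frechet_derivative\<close> takes at points of non-differentiability.\<close>

primrec Ck :: "nat \<Rightarrow> ('a::euclidean_space \<Rightarrow> real) \<Rightarrow> bool" where
  "Ck 0 f \<longleftrightarrow> continuous_on UNIV f"
| "Ck (Suc k) f \<longleftrightarrow>
     (\<forall>x. f differentiable (at x)) \<and> (\<forall>b\<in>Basis. Ck k (\<lambda>x. frechet_derivative f (at x) b))"

definition test_fun :: "('a::euclidean_space \<Rightarrow> real) \<Rightarrow> bool" where
  "test_fun f \<longleftrightarrow> (\<forall>k. Ck k f) \<and> compact (closure {x. f x \<noteq> 0})"

definition grad :: "('a::euclidean_space \<Rightarrow> real) \<Rightarrow> 'a \<Rightarrow> 'a" where
  "grad f x = (\<Sum>b\<in>Basis. frechet_derivative f (at x) b *\<^sub>R b)"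

definition loc_integrable :: "('a::euclidean_space \<Rightarrow> 'b::{banach, second_countable_topology}) \<Rightarrow> bool" where
  "loc_integrable u \<longleftrightarrow> (\<forall>K. compact K \<longrightarrow> set_integrable lborel K u)"

definition has_weak_grad :: "('a::euclidean_space \<Rightarrow> real) \<Rightarrow> ('a \<Rightarrow> 'a) \<Rightarrow> bool" where
  "has_weak_grad u g \<longleftrightarrow> loc_integrable u \<and> loc_integrable g \<and>
     (\<forall>\<psi>. test_fun \<psi> \<longrightarrow>
        (LINT x|lborel. u x *\<^sub>R grad \<psi> x) = - (LINT x|lborel. \<psi> x *\<^sub>R g x))"

text \<open>A weak gradient is unique up to a Lebesgue null set; \<open>weak_grad u\<close> is one of its versions,
  and is meaningful only if \<open>u\<close> has a weak gradient.\<close>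

definition weak_grad :: "('a::euclidean_space \<Rightarrow> real) \<Rightarrow> 'a \<Rightarrow> 'a" where
  "weak_grad u = (SOME g. has_weak_grad u g)"

definition hdot1_norm :: "('a::euclidean_space \<Rightarrow> real) \<Rightarrow> real" where
  "hdot1_norm f = sqrt (LINT x|lborel. (norm (grad f x))\<^sup>2)"

text \<open>The completion of the test functions under \<open>hdot1_norm\<close>, realised as a space of functions:
  by the Sobolev inequality, in dimension at least 3 a Cauchy sequence of test functions converges
  in \<open>L\<^sup>1\<close> on every compact set, and two Cauchy sequences are equivalent if and only if their limits
  agree almost everywhere. An element of the completion is thus a function up to null sets, and the
  members of \<open>hdot1\<close> are its Borel measurable representatives.\<close>

definition hdot1 :: "('a::euclidean_space \<Rightarrow> real) set" where
  "hdot1 = {\<phi>. \<phi> \<in> borel_measurable borel \<and>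
     (\<exists>f :: nat \<Rightarrow> 'a \<Rightarrow> real. (\<forall>n. test_fun (f n)) \<and>
        (\<forall>e>0. \<exists>M. \<forall>m\<ge>M. \<forall>n\<ge>M. hdot1_norm (\<lambda>x. f m x - f n x) < e) \<and>
        (\<forall>K. compact K \<longrightarrow>
           (\<lambda>n. \<integral>\<^sup>+x\<in>K. ennreal \<bar>f n x - \<phi> x\<bar> \<partial>lborel) \<longlonglongrightarrow> 0))}"

definition riesz_const :: "real \<Rightarrow> real \<Rightarrow> real" where
  "riesz_const N \<alpha> = Gamma ((N - \<alpha>) / 2) / (2 powr \<alpha> * pi powr (N / 2) * Gamma (\<alpha> / 2))"

definition riesz :: "real \<Rightarrow> 'a::euclidean_space \<Rightarrow> real" where
  "riesz \<alpha> x = riesz_const (real DIM('a)) \<alpha> / norm x powr (real DIM('a) - \<alpha>)"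

definition const_C :: "real \<Rightarrow> real \<Rightarrow> real" where
  "const_C N \<alpha> = 1 / 2 powr (\<alpha> - 2) *
     (Gamma ((N - \<alpha>) / 4) / ((N - 2) * Gamma ((N + \<alpha>) / 4)))\<^sup>2"

end

theory Submission
  imports Defs "HOL-Probability.Distributions" "HOL-Computational_Algebra.Polynomial"
begin

text \<open>Both sides are multiples of the Hardy integral \<open>\<integral> \<phi>\<^sup>2 / |x|\<^sup>2\<close>. On the left, expand
  \<open>|\<nabla>(|x|\<^sup>\<gamma> \<phi>)|\<^sup>2 / |x|\<^bsup>2\<gamma>\<^esup>\<close> with \<open>\<gamma> = (N - 2) / 2\<close> and integrate by parts against \<open>x / |x|\<^sup>2\<close>: the
  difference is \<open>\<gamma>\<^sup>2 \<integral> \<phi>\<^sup>2 / |x|\<^sup>2\<close>. On the right, expanding the square cancels the first double integral and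
  leaves \<open>\<integral> \<phi>(x)\<^sup>2 |x|\<^bsup>N - 2 - (N + \<alpha>) / 2\<^esup> (I\<^sub>\<alpha> * |y|\<^bsup>- (N + \<alpha>) / 2\<^esup>)(x) dx\<close>; the convolution is an explicit
  multiple of \<open>|x|\<^bsup>- (N - \<alpha>) / 2\<^esup>\<close>, computed by writing both powers as Gamma-weighted superpositions
  of Gaussians. Everything is shown for test functions first and passed to the limit in \<open>L\<^sup>2\<close>, with Hardy's
  inequality controlling \<open>\<phi> / |x|\<close>.\<close>

subsection \<open>Composition of Riesz potentials\<close>

text \<open>Approximation by test functions serves the gradient side; the double integrals are
  treated for \<phi> itself, since the kernel is nonnegative and Tonelli's theorem asks only for
  \<phi> / |x| in L^2. Two obstacles shape the rest. \<open>weak_grad\<close> is a mere choice of a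
  representative, so it can be computed only after weak gradients are known to be unique almost
  everywhere; that requires enough smooth compactly supported functions, which are built explicitly.
  And the weight |x|^\<gamma> and the field x / |x|^2 may fail to be C^1 at the origin, so they are
  regularised through |x|^2 + \<epsilon>, while a product of \<phi> with a singular gradient w' is
  always read as (\<phi> / |x|) (|x| w'), whose factors are controlled separately. The constant: the
  convolution pairs the exponents a = N - \<alpha> and b = (N + \<alpha>) / 2, for which (a + b - N)
  / 2 and (N - b) / 2 both equal (N - \<alpha>) / 4. This is the origin of the square in
  \<open>const_C\<close>; its factor 1 / (N - 2)^2 absorbs the Hardy constant \<gamma>^2.\<close>

lemma nn_integral_exp_neg_square:
  fixes c m :: real
  assumes c: "0 < c"
  shows "(\<integral>\<^sup>+x. ennreal (exp (- (c * (x - m)\<^sup>2))) \<partial>lborel) = ennreal (sqrt (pi / c))"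
proof -
  \<comment> \<open>The standard deviation with 2 s^2 = 1 / c: the integrand is then a multiple of a
    normal density, whose total mass is 1.\<close>
  define s where "s = 1 / sqrt (2 * c)"
  have s: "0 < s" "2 * s\<^sup>2 = 1 / c"
    using c by (auto simp: s_def power_divide)
  interpret prob_space "density lborel (normal_density m s)"
    by (rule prob_space_normal_density) fact
  have "1 = emeasure (density lborel (normal_density m s)) (space (density lborel (normal_density m s)))"
    by (rule emeasure_space_1[symmetric])
  also have "\<dots> = (\<integral>\<^sup>+x. ennreal (normal_density m s x) \<partial>lborel)"
    by (subst emeasure_density) (auto intro!: nn_integral_cong)
  finally have 1: "(\<integral>\<^sup>+x. ennreal (normal_density m s x) \<partial>lborel) = 1" ..
  have "ennreal (exp (- (c * (x - m)\<^sup>2))) = ennreal (sqrt (pi / c)) * ennreal (normal_density m s x)" for x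
  proof -
    have "2 * pi * s\<^sup>2 = pi / c"
      using s(2) by (simp add: field_simps)
    moreover have "(x - m)\<^sup>2 / (2 * s\<^sup>2) = c * (x - m)\<^sup>2"
      unfolding s(2) by simp
    ultimately show ?thesis
      using c by (simp add: normal_density_def ennreal_mult'[symmetric])
  qed
  then show ?thesis
    by (simp add: nn_integral_cmult 1)
qed

lemma nn_integral_gaussian:
  fixes m :: "'a::euclidean_space"
  assumes c: "0 < c"
  shows "(\<integral>\<^sup>+x. ennreal (exp (- (c * (norm (x - m))\<^sup>2))) \<partial>lborel) = ennreal ((pi / c) powr (DIM('a) / 2))"
proof -
  have "(norm z)\<^sup>2 = (\<Sum>b\<in>Basis. (z \<bullet> b)\<^sup>2)" for z :: 'a
    unfolding power2_norm_eq_inner euclidean_inner[of z z] by (simp add: power2_eq_square)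
  then have "ennreal (exp (- (c * (norm (x - m))\<^sup>2))) = (\<Prod>b\<in>Basis. ennreal (exp (- (c * (x \<bullet> b - m \<bullet> b)\<^sup>2))))" for x
    by (simp add: prod_ennreal exp_sum sum_distrib_left sum_negf[symmetric] inner_diff_left)
  then have "(\<integral>\<^sup>+x. ennreal (exp (- (c * (norm (x - m))\<^sup>2))) \<partial>lborel) =
    (\<integral>\<^sup>+x. (\<Prod>b\<in>Basis. ennreal (exp (- (c * (x \<bullet> b - m \<bullet> b)\<^sup>2)))) \<partial>lborel)" by simp
  also have "\<dots> = (\<Prod>b\<in>(Basis::'a set). \<integral>\<^sup>+x. ennreal (exp (- (c * (x - m \<bullet> b)\<^sup>2))) \<partial>lborel)"
    by (rule nn_integral_lborel_prod) auto
  also have "\<dots> = ennreal (sqrt (pi / c) ^ DIM('a))"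
    using c by (simp add: nn_integral_exp_neg_square prod_ennreal ennreal_power)
  also have "sqrt (pi / c) ^ DIM('a) = (pi / c) powr (DIM('a) / 2)"
    using c by (simp add: powr_half_sqrt[symmetric] powr_powr powr_realpow[symmetric])
  finally show ?thesis .
qed

text \<open>Euler's integral after the substitution t -> c t. Read from right to left it writes the
  power c^(-a) as a superposition of exponentials in c, which is how every negative power below is
  opened up.\<close>

lemma nn_integral_Gamma_scaled:
  fixes a c :: real
  assumes a: "0 < a" and c: "0 < c"
  shows "(\<integral>\<^sup>+t. ennreal (indicator {0<..} t * (t powr (a - 1) * exp (- (c * t)))) \<partial>lborel)
    = ennreal (Gamma a * c powr (- a))"
proof -
  have "ennreal (Gamma a) = (\<integral>\<^sup>+t. ennreal (indicator {0..} t * t powr (a - 1) / exp t) \<partial>lborel)"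
    by (rule Gamma_conv_nn_integral_real[OF a])
  also have "\<dots> = \<bar>c\<bar> * (\<integral>\<^sup>+t. ennreal (indicator {0..} (0 + c * t) * (0 + c * t) powr (a - 1) / exp (0 + c * t)) \<partial>lborel)"
    using c by (intro nn_integral_real_affine) auto
  also have "\<dots> = (\<integral>\<^sup>+t. ennreal (c powr a) * ennreal (indicator {0<..} t * (t powr (a - 1) * exp (- (c * t)))) \<partial>lborel)"
    using c
    by (subst nn_integral_cmult[symmetric]; (intro nn_integral_cong)?)
       (auto simp: ennreal_mult'[symmetric] powr_mult indicator_def zero_le_mult_iff exp_minus field_simps powr_diff
             intro!: arg_cong[where f=ennreal])
  also have "\<dots> = ennreal (c powr a) * (\<integral>\<^sup>+t. ennreal (indicator {0<..} t * (t powr (a - 1) * exp (- (c * t)))) \<partial>lborel)"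
    by (rule nn_integral_cmult) auto
  finally have "ennreal (c powr (- a)) * ennreal (Gamma a) =
     (ennreal (c powr (- a)) * ennreal (c powr a)) * (\<integral>\<^sup>+t. ennreal (indicator {0<..} t * (t powr (a - 1) * exp (- (c * t)))) \<partial>lborel)"
    by (simp add: mult.assoc)
  moreover have "ennreal (c powr (- a)) * ennreal (c powr a) = 1"
    using c by (simp add: ennreal_mult'[symmetric] powr_add[symmetric])
  ultimately show ?thesis
    using a by (simp add: ennreal_mult' mult.commute)
qed

text \<open>Gamma (p + q) (1 + t)^(-(p + q)) is a Gamma integral with rate 1 + t. Exchanging the
  order of integration leaves a Gamma integral in t with rate u, and then one in u with rate
  1.\<close>

lemma nn_integral_Beta_halfline:
  fixes p q :: real
  assumes p: "0 < p" and q: "0 < q"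
  shows "(\<integral>\<^sup>+t. ennreal (indicator {0<..} t * (t powr (p - 1) * (1 + t) powr (- (p + q)))) \<partial>lborel)
    = ennreal (Gamma p * Gamma q / Gamma (p + q))" (is "?I = _")
proof -
  have G: "0 < Gamma (p + q)" "0 < Gamma p" "0 < Gamma q"
    using p q by (auto intro: Gamma_real_pos)
  let ?F = "\<lambda>t u. ennreal (indicator {0<..} t * t powr (p - 1) * (indicator {0<..} u * (u powr (p + q - 1) * exp (- ((1 + t) * u)))))"
  have "ennreal (Gamma (p + q)) * ?I =
    (\<integral>\<^sup>+t. ennreal (Gamma (p + q)) * ennreal (indicator {0<..} t * (t powr (p - 1) * (1 + t) powr (- (p + q)))) \<partial>lborel)"
    by (rule nn_integral_cmult[symmetric]) auto
  also have "\<dots> = (\<integral>\<^sup>+t. (\<integral>\<^sup>+u. ?F t u \<partial>lborel) \<partial>lborel)"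
  proof (rule nn_integral_cong)
    fix t :: real
    show "ennreal (Gamma (p + q)) * ennreal (indicator {0<..} t * (t powr (p - 1) * (1 + t) powr (- (p + q)))) = (\<integral>\<^sup>+u. ?F t u \<partial>lborel)"
    proof (cases "t > 0")
      case True
      have "(\<integral>\<^sup>+u. ?F t u \<partial>lborel) = (\<integral>\<^sup>+u. ennreal (t powr (p - 1)) * ennreal (indicator {0<..} u * (u powr (p + q - 1) * exp (- ((1 + t) * u)))) \<partial>lborel)"
        using True by (intro nn_integral_cong) (simp add: ennreal_mult'[symmetric])
      also have "\<dots> = ennreal (t powr (p - 1)) * ennreal (Gamma (p + q) * (1 + t) powr (- (p + q)))"
        using True p q by (subst nn_integral_cmult) (auto simp: nn_integral_Gamma_scaled)
      finally show ?thesis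
        using True G by (simp add: ennreal_mult'[symmetric] mult_ac)
    qed simp
  qed
  also have "\<dots> = (\<integral>\<^sup>+u. (\<integral>\<^sup>+t. ?F t u \<partial>lborel) \<partial>lborel)"
    by (rule lborel_pair.Fubini') simp
  also have "\<dots> = (\<integral>\<^sup>+u. ennreal (Gamma p) * ennreal (indicator {0<..} u * (u powr (q - 1) * exp (- (1 * u)))) \<partial>lborel)"
  proof (rule nn_integral_cong)
    fix u :: real
    show "(\<integral>\<^sup>+t. ?F t u \<partial>lborel) = ennreal (Gamma p) * ennreal (indicator {0<..} u * (u powr (q - 1) * exp (- (1 * u))))"
    proof (cases "u > 0")
      case True
      have "(\<integral>\<^sup>+t. ?F t u \<partial>lborel) = (\<integral>\<^sup>+t. ennreal (u powr (p + q - 1) * exp (- u)) * ennreal (indicator {0<..} t * (t powr (p - 1) * exp (- (u * t)))) \<partial>lborel)"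
        using True by (intro nn_integral_cong) (simp add: ennreal_mult'[symmetric] exp_add[symmetric] algebra_simps)
      also have "\<dots> = ennreal (u powr (p + q - 1) * exp (- u)) * ennreal (Gamma p * u powr (- p))"
        using True p by (subst nn_integral_cmult) (auto simp: nn_integral_Gamma_scaled)
      also have "\<dots> = ennreal (Gamma p * ((u powr (p + q - 1) * u powr (- p)) * exp (- u)))"
        using G by (simp add: ennreal_mult'[symmetric] mult_ac)
      also have "u powr (p + q - 1) * u powr (- p) = u powr (q - 1)"
        by (simp add: powr_add[symmetric] algebra_simps)
      finally show ?thesis
        using True G by (simp add: ennreal_mult'[symmetric])
    qed simp
  qed
  also have "\<dots> = ennreal (Gamma p) * ennreal (Gamma q)"
    by (subst nn_integral_cmult; (subst nn_integral_Gamma_scaled)?) (use q in auto)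
  finally have "ennreal (1 / Gamma (p + q)) * (ennreal (Gamma (p + q)) * ?I) = ennreal (1 / Gamma (p + q)) * (ennreal (Gamma p) * ennreal (Gamma q))"
    by simp
  moreover have "ennreal (1 / Gamma (p + q)) * (ennreal (Gamma (p + q)) * ?I) = ?I"
    using G by (simp add: mult.assoc[symmetric] ennreal_mult'[symmetric])
  ultimately show ?thesis
    using G by (simp add: ennreal_mult'[symmetric] ac_simps)
qed

lemma nn_integral_norm_powr_eq:
  fixes z :: "'a::euclidean_space" and a :: real
  assumes "0 < a" "z \<noteq> 0"
  shows "ennreal (Gamma (a / 2)) * ennreal (norm z powr (- a)) =
    (\<integral>\<^sup>+t. ennreal (indicator {0<..} t * (t powr (a / 2 - 1) * exp (- (t * (norm z)\<^sup>2)))) \<partial>lborel)"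
proof -
  have "((norm z)\<^sup>2) powr (- (a / 2)) = norm z powr (- a)"
    using powr_powr[of "norm z" 2 "- (a / 2)"] assms by simp
  then show ?thesis
    using nn_integral_Gamma_scaled[of "a / 2" "(norm z)\<^sup>2"] assms Gamma_real_pos[of "a / 2"]
    by (simp add: ennreal_mult'[symmetric] mult.commute)
qed

text \<open>Completing the square in y: the two exponents combine into one Gaussian centred at the
  weighted mean \<open>m\<close> of x and 0, and the remainder s t / (s + t) |x|^2 does not depend
  on y.\<close>

lemma nn_integral_gaussian_conv:
  fixes x :: "'a::euclidean_space"
  assumes s: "0 < s" and t: "0 < t"
  shows "(\<integral>\<^sup>+y. ennreal (exp (- (s * (norm (x - y))\<^sup>2)) * exp (- (t * (norm y)\<^sup>2))) \<partial>lborel)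
    = ennreal (exp (- (s * t / (s + t) * (norm x)\<^sup>2)) * (pi / (s + t)) powr (DIM('a) / 2))"
proof -
  define c where "c = s / (s + t)"
  define m where "m = c *\<^sub>R x"
  have st: "s + t \<noteq> 0" using assms by simp
  have sq: "s * (norm (x - y))\<^sup>2 + t * (norm y)\<^sup>2 = (s + t) * (norm (y - m))\<^sup>2 + s * t / (s + t) * (norm x)\<^sup>2" for y
  proof -
    have "(s + t) * (norm (y - m))\<^sup>2 = (s + t) * (y \<bullet> y) - 2 * ((s + t) * c) * (x \<bullet> y) + ((s + t) * c) * c * (x \<bullet> x)"
      by (simp only: power2_norm_eq_inner m_def inner_diff_left inner_diff_right inner_scaleR_left inner_scaleR_right inner_commute[of y x])
         (simp add: algebra_simps)
    also have "(s + t) * c = s" using st by (simp add: c_def)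
    finally have "(s + t) * (norm (y - m))\<^sup>2 = (s + t) * (y \<bullet> y) - 2 * s * (x \<bullet> y) + s * c * (x \<bullet> x)" .
    moreover have "s * c + s * t / (s + t) = s"
      using st unfolding c_def by (simp add: add_divide_distrib[symmetric] distrib_left[symmetric])
    then have "s * c * (x \<bullet> x) + s * t / (s + t) * (x \<bullet> x) = s * (x \<bullet> x)"
      by (metis distrib_right)
    moreover have "s * (norm (x - y))\<^sup>2 = s * (x \<bullet> x) - 2 * s * (x \<bullet> y) + s * (y \<bullet> y)"
      by (simp add: power2_norm_eq_inner inner_diff inner_commute[of y x] algebra_simps)
    ultimately show ?thesis
      unfolding power2_norm_eq_inner[of x] power2_norm_eq_inner[of y] distrib_right by linarith
  qed
  have "(\<integral>\<^sup>+y. ennreal (exp (- (s * (norm (x - y))\<^sup>2)) * exp (- (t * (norm y)\<^sup>2))) \<partial>lborel) =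
    (\<integral>\<^sup>+y. ennreal (exp (- (s * t / (s + t) * (norm x)\<^sup>2))) * ennreal (exp (- ((s + t) * (norm (y - m))\<^sup>2))) \<partial>lborel)"
  proof (rule nn_integral_cong)
    fix y
    have "exp (- (s * (norm (x - y))\<^sup>2)) * exp (- (t * (norm y)\<^sup>2)) = exp (- (s * (norm (x - y))\<^sup>2 + t * (norm y)\<^sup>2))"
      by (simp add: exp_add[symmetric])
    also have "\<dots> = exp (- (s * t / (s + t) * (norm x)\<^sup>2)) * exp (- ((s + t) * (norm (y - m))\<^sup>2))"
      unfolding sq by (simp add: exp_add[symmetric])
    finally show "ennreal (exp (- (s * (norm (x - y))\<^sup>2)) * exp (- (t * (norm y)\<^sup>2))) =
      ennreal (exp (- (s * t / (s + t) * (norm x)\<^sup>2))) * ennreal (exp (- ((s + t) * (norm (y - m))\<^sup>2)))"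
      by (simp add: ennreal_mult')
  qed
  also have "\<dots> = ennreal (exp (- (s * t / (s + t) * (norm x)\<^sup>2))) * ennreal ((pi / (s + t)) powr (DIM('a) / 2))"
    using assms by (subst nn_integral_cmult) (auto simp: nn_integral_gaussian)
  finally show ?thesis
    by (simp add: ennreal_mult')
qed

text \<open>The substitution \<open>t = s * u\<close> separates the two Gaussian parameters: the \<open>s\<close>-integral is a Gamma
  integral and the remaining \<open>u\<close>-integral a Beta integral.\<close>

lemma nn_integral_gaussian_parameters:
  fixes a b N r :: real
  assumes a: "0 < a" "a < N" and b: "0 < b" "b < N" and ab: "N < a + b" and r: "0 < r"
  shows "(\<integral>\<^sup>+s. (\<integral>\<^sup>+t. ennreal (indicator {0<..} s * s powr (a / 2 - 1) * (indicator {0<..} t * t powr (b / 2 - 1))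
          * (exp (- (s * t / (s + t) * r\<^sup>2)) * (pi / (s + t)) powr (N / 2))) \<partial>lborel) \<partial>lborel)
    = ennreal (pi powr (N / 2) * Gamma ((a + b - N) / 2) * r powr (N - a - b) *
        (Gamma ((N - a) / 2) * Gamma ((N - b) / 2) / Gamma ((2 * N - a - b) / 2)))"
    (is "?L = _")
proof -
  \<comment> \<open>After t = s u the powers of s, including the Jacobian s, combine to exponent
    \<open>?c - 1\<close>, and s t / (s + t) becomes s u / (1 + u), which gives the rate
    \<open>?k u\<close>.\<close>
  let ?c = "(a + b - N) / 2"
  let ?k = "\<lambda>u. r\<^sup>2 * (u / (1 + u))"
  let ?F = "\<lambda>s t. ennreal (indicator {0<..} s * s powr (a / 2 - 1) * (indicator {0<..} t * t powr (b / 2 - 1))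
          * (exp (- (s * t / (s + t) * r\<^sup>2)) * (pi / (s + t)) powr (N / 2)))"
  let ?G = "\<lambda>s u. ennreal (pi powr (N / 2) * (indicator {0<..} u * (u powr (b / 2 - 1) * (1 + u) powr (- (N / 2))))
          * (indicator {0<..} s * (s powr (?c - 1) * exp (- (?k u * s)))))"
  have "?L = (\<integral>\<^sup>+s. (\<integral>\<^sup>+u. ?G s u \<partial>lborel) \<partial>lborel)"
  proof (rule nn_integral_cong)
    fix s :: real
    show "(\<integral>\<^sup>+t. ?F s t \<partial>lborel) = (\<integral>\<^sup>+u. ?G s u \<partial>lborel)"
    proof (cases "s > 0")
      case True
      have "(\<integral>\<^sup>+t. ?F s t \<partial>lborel) = ennreal \<bar>s\<bar> * (\<integral>\<^sup>+u. ?F s (0 + s * u) \<partial>lborel)"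
        using True by (intro nn_integral_real_affine) auto
      also have "\<dots> = (\<integral>\<^sup>+u. ennreal \<bar>s\<bar> * ?F s (0 + s * u) \<partial>lborel)"
        by (rule nn_integral_cmult[symmetric]) auto
      also have "\<dots> = (\<integral>\<^sup>+u. ?G s u \<partial>lborel)"
      proof (rule nn_integral_cong)
        fix u :: real
        show "ennreal \<bar>s\<bar> * ?F s (0 + s * u) = ?G s u"
        proof (cases "u > 0")
          case u: True
          have "s + s * u = s * (1 + u)" by (simp add: algebra_simps)
          then have 1: "(pi / (s + s * u)) powr (N / 2) = pi powr (N / 2) * (s powr (- (N / 2)) * (1 + u) powr (- (N / 2)))"
            by (simp only: powr_divide powr_mult) (simp only: powr_minus divide_inverse inverse_mult_distrib)
          have 2: "s * (s * u) / (s + s * u) * r\<^sup>2 = ?k u * s"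
            using True u \<open>s + s * u = s * (1 + u)\<close> by simp
          have 3: "(s * u) powr (b / 2 - 1) = s powr (b / 2 - 1) * u powr (b / 2 - 1)"
            using True u by (simp add: powr_mult)
          have "s * (s powr (a / 2 - 1) * s powr (b / 2 - 1) * s powr (- (N / 2))) = s powr 1 * (s powr (a / 2 - 1) * s powr (b / 2 - 1) * s powr (- (N / 2)))"
            using True by simp
          also have "\<dots> = s powr (?c - 1)"
            unfolding powr_add[symmetric] by (rule arg_cong[where f="(powr) s"]) (simp add: field_simps)
          finally have 4: "s * (s powr (a / 2 - 1) * s powr (b / 2 - 1) * s powr (- (N / 2))) = s powr (?c - 1)" .
          have "s * (s powr (a / 2 - 1) * (s * u) powr (b / 2 - 1) * (exp (- (s * (s * u) / (s + s * u) * r\<^sup>2)) * (pi / (s + s * u)) powr (N / 2)))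
            = pi powr (N / 2) * (u powr (b / 2 - 1) * (1 + u) powr (- (N / 2))) * ((s * (s powr (a / 2 - 1) * s powr (b / 2 - 1) * s powr (- (N / 2)))) * exp (- (?k u * s)))"
            unfolding 1 2 3 by (simp only: mult_ac)
          then show ?thesis
            unfolding 4 using True u by (simp add: ennreal_mult'[symmetric])
        next
          case False
          then have "\<not> 0 < s * u"
            using True by (simp add: zero_less_mult_iff)
          then show ?thesis
            using False by simp
        qed
      qed
      finally show ?thesis .
    qed simp
  qed
  also have "\<dots> = (\<integral>\<^sup>+u. (\<integral>\<^sup>+s. ?G s u \<partial>lborel) \<partial>lborel)"
    by (rule lborel_pair.Fubini') simp
  also have "\<dots> = (\<integral>\<^sup>+u. ennreal (pi powr (N / 2) * Gamma ?c * r powr (N - a - b)) *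
      ennreal (indicator {0<..} u * (u powr ((N - a) / 2 - 1) * (1 + u) powr (- ((N - a) / 2 + (N - b) / 2)))) \<partial>lborel)"
  proof (rule nn_integral_cong)
    fix u :: real
    show "(\<integral>\<^sup>+s. ?G s u \<partial>lborel) = ennreal (pi powr (N / 2) * Gamma ?c * r powr (N - a - b)) *
      ennreal (indicator {0<..} u * (u powr ((N - a) / 2 - 1) * (1 + u) powr (- ((N - a) / 2 + (N - b) / 2))))"
    proof (cases "u > 0")
      case u: True
      let ?w = "pi powr (N / 2) * (u powr (b / 2 - 1) * (1 + u) powr (- (N / 2)))"
      have k: "0 < ?k u" using u r by simp
      have "(\<integral>\<^sup>+s. ?G s u \<partial>lborel) = (\<integral>\<^sup>+s. ennreal ?w * ennreal (indicator {0<..} s * (s powr (?c - 1) * exp (- (?k u * s)))) \<partial>lborel)"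
        using u by (intro nn_integral_cong) (simp add: ennreal_mult'[symmetric])
      also have "\<dots> = ennreal ?w * ennreal (Gamma ?c * ?k u powr (- ?c))"
        by (subst nn_integral_cmult) (use ab in \<open>simp_all only: nn_integral_Gamma_scaled[OF _ k] half_gt_zero diff_gt_0_iff_gt, measurable\<close>)
      also have "\<dots> = ennreal (?w * (Gamma ?c * ?k u powr (- ?c)))"
        by (simp add: ennreal_mult'[symmetric])
      also have "?k u powr (- ?c) = r powr (N - a - b) * (u powr (- ?c) * (1 + u) powr ?c)"
      proof -
        have "2 * (- ?c) = N - a - b" by (simp add: field_simps)
        then have 1: "(r\<^sup>2) powr (- ?c) = r powr (N - a - b)"
          using powr_powr[of r 2 "- ?c"] r by (simp only: powr_numeral)
        have "?k u powr (- ?c) = (r\<^sup>2) powr (- ?c) * (u powr (- ?c) / (1 + u) powr (- ?c))"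
          by (simp only: powr_mult powr_divide)
        also have "u powr (- ?c) / (1 + u) powr (- ?c) = u powr (- ?c) * (1 + u) powr ?c"
          by (simp only: powr_minus divide_inverse inverse_inverse_eq)
        finally show ?thesis
          unfolding 1 .
      qed
      also have "?w * (Gamma ?c * (r powr (N - a - b) * (u powr (- ?c) * (1 + u) powr ?c))) =
        pi powr (N / 2) * Gamma ?c * r powr (N - a - b) * ((u powr (b / 2 - 1) * u powr (- ?c)) * ((1 + u) powr (- (N / 2)) * (1 + u) powr ?c))"
        by (simp only: mult_ac)
      also have "u powr (b / 2 - 1) * u powr (- ?c) = u powr ((N - a) / 2 - 1)"
        unfolding powr_add[symmetric] by (rule arg_cong[where f="(powr) u"]) (simp add: field_simps)
      also have "(1 + u) powr (- (N / 2)) * (1 + u) powr ?c = (1 + u) powr (- ((N - a) / 2 + (N - b) / 2))"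
        unfolding powr_add[symmetric] by (rule arg_cong[where f="(powr) (1 + u)"]) (simp add: field_simps)
      also have "ennreal (pi powr (N / 2) * Gamma ?c * r powr (N - a - b) * (u powr ((N - a) / 2 - 1) * (1 + u) powr (- ((N - a) / 2 + (N - b) / 2))))
        = ennreal (pi powr (N / 2) * Gamma ?c * r powr (N - a - b)) * ennreal (u powr ((N - a) / 2 - 1) * (1 + u) powr (- ((N - a) / 2 + (N - b) / 2)))"
        by (rule ennreal_mult'') simp
      finally show ?thesis
        using u by simp
    qed simp
  qed
  \<comment> \<open>The half-line Beta integral with p = (N - a) / 2 and q = (N - b) / 2, both
    positive because a and b are below N.\<close>
  also have "\<dots> = ennreal (pi powr (N / 2) * Gamma ?c * r powr (N - a - b)) *
      ennreal (Gamma ((N - a) / 2) * Gamma ((N - b) / 2) / Gamma ((N - a) / 2 + (N - b) / 2))"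
    by (subst nn_integral_cmult; (subst nn_integral_Beta_halfline)?) (use a b in auto)
  also have "(N - a) / 2 + (N - b) / 2 = (2 * N - a - b) / 2"
    by (simp add: field_simps)
  also have "ennreal (pi powr (N / 2) * Gamma ?c * r powr (N - a - b)) *
      ennreal (Gamma ((N - a) / 2) * Gamma ((N - b) / 2) / Gamma ((2 * N - a - b) / 2)) =
      ennreal (pi powr (N / 2) * Gamma ?c * r powr (N - a - b) *
      (Gamma ((N - a) / 2) * Gamma ((N - b) / 2) / Gamma ((2 * N - a - b) / 2)))"
    using ab by (intro ennreal_mult'[symmetric] mult_nonneg_nonneg) (auto intro!: Gamma_real_nonneg)
  finally show ?thesis .
qed

text \<open>The bounds a < N and b < N give integrability at y = x and y = 0, and N < a + b gives it
  at infinity. With both powers opened into Gaussians, the y-integral is carried out first and only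
  the two parameters remain.\<close>

lemma nn_integral_riesz_composition:
  fixes x :: "'a::euclidean_space" and a b :: real
  defines "N \<equiv> real DIM('a)"
  assumes a: "0 < a" "a < N" and b: "0 < b" "b < N" and ab: "N < a + b" and x: "x \<noteq> 0"
  shows "(\<integral>\<^sup>+y. ennreal (norm (x - y) powr (- a) * norm y powr (- b)) \<partial>lborel)
    = ennreal (pi powr (N / 2) * Gamma ((a + b - N) / 2) * Gamma ((N - a) / 2) * Gamma ((N - b) / 2) /
        (Gamma (a / 2) * Gamma (b / 2) * Gamma ((2 * N - a - b) / 2)) * norm x powr (N - a - b))"
    (is "?I = _")
proof -
  have G: "0 < Gamma (a / 2)" "0 < Gamma (b / 2)"
    using a b by (auto intro: Gamma_real_pos)
  let ?P = "\<lambda>s. indicator {0<..} s * s powr (a / 2 - 1)"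
  let ?Q = "\<lambda>t. indicator {0<..} t * t powr (b / 2 - 1)"
  let ?A = "\<lambda>s y. exp (- (s * (norm (x - y))\<^sup>2))"
  let ?B = "\<lambda>t y. exp (- (t * (norm (y::'a))\<^sup>2))"
  let ?F = "\<lambda>s t y. ennreal (?P s * ?Q t * (?A s y * ?B t y))"
  have "ennreal (Gamma (a / 2) * Gamma (b / 2)) * ?I =
    (\<integral>\<^sup>+y. ennreal (Gamma (a / 2) * Gamma (b / 2)) * ennreal (norm (x - y) powr (- a) * norm y powr (- b)) \<partial>lborel)"
    by (rule nn_integral_cmult[symmetric]) auto
  also have "\<dots> = (\<integral>\<^sup>+y. (\<integral>\<^sup>+s. (\<integral>\<^sup>+t. ?F s t y \<partial>lborel) \<partial>lborel) \<partial>lborel)"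
  \<comment> \<open>The two singular points have to be excluded: there \<open>0 powr r = 0\<close>,
    whereas the Gamma integral with rate 0 is infinite.\<close>
  proof (rule nn_integral_cong_AE)
    have "AE y in lborel. y \<noteq> x" "AE y in lborel. y \<noteq> (0::'a)"
      by (rule AE_lborel_singleton)+
    then show "AE y in lborel. ennreal (Gamma (a / 2) * Gamma (b / 2)) * ennreal (norm (x - y) powr (- a) * norm y powr (- b))
       = (\<integral>\<^sup>+s. (\<integral>\<^sup>+t. ?F s t y \<partial>lborel) \<partial>lborel)"
    proof eventually_elim
      case (elim y)
      have "(\<integral>\<^sup>+s. (\<integral>\<^sup>+t. ?F s t y \<partial>lborel) \<partial>lborel) = (\<integral>\<^sup>+s. (\<integral>\<^sup>+t. ennreal (?P s * ?A s y) * ennreal (?Q t * ?B t y) \<partial>lborel) \<partial>lborel)"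
        by (intro nn_integral_cong) (simp add: ennreal_mult'[symmetric] mult_ac)
      also have "\<dots> = (\<integral>\<^sup>+s. ennreal (?P s * ?A s y) \<partial>lborel) * (\<integral>\<^sup>+t. ennreal (?Q t * ?B t y) \<partial>lborel)"
        by (simp add: nn_integral_cmult nn_integral_multc)
      also have "\<dots> = (ennreal (Gamma (a / 2)) * ennreal (norm (x - y) powr (- a))) * (ennreal (Gamma (b / 2)) * ennreal (norm y powr (- b)))"
        using nn_integral_norm_powr_eq[of a "x - y"] nn_integral_norm_powr_eq[of b y] a b elim by (simp add: mult.assoc)
      finally show ?case
        using G by (simp add: ennreal_mult'[symmetric] mult_ac)
    qed
  qed
  also have "\<dots> = (\<integral>\<^sup>+s. (\<integral>\<^sup>+y. (\<integral>\<^sup>+t. ?F s t y \<partial>lborel) \<partial>lborel) \<partial>lborel)"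
    by (rule lborel_pair.Fubini') simp
  also have "\<dots> = (\<integral>\<^sup>+s. (\<integral>\<^sup>+t. (\<integral>\<^sup>+y. ?F s t y \<partial>lborel) \<partial>lborel) \<partial>lborel)"
    by (intro nn_integral_cong lborel_pair.Fubini') simp
  also have "\<dots> = (\<integral>\<^sup>+s. (\<integral>\<^sup>+t. ennreal (?P s * ?Q t * (exp (- (s * t / (s + t) * (norm x)\<^sup>2)) * (pi / (s + t)) powr (N / 2))) \<partial>lborel) \<partial>lborel)"
  proof (intro nn_integral_cong)
    fix s t :: real
    show "(\<integral>\<^sup>+y. ?F s t y \<partial>lborel) = ennreal (?P s * ?Q t * (exp (- (s * t / (s + t) * (norm x)\<^sup>2)) * (pi / (s + t)) powr (N / 2)))"
    proof (cases "s > 0 \<and> t > 0")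
      case True
      have "(\<integral>\<^sup>+y. ?F s t y \<partial>lborel) = (\<integral>\<^sup>+y. ennreal (?P s * ?Q t) * ennreal (?A s y * ?B t y) \<partial>lborel)"
        using True by (intro nn_integral_cong) (simp add: ennreal_mult'[symmetric])
      also have "\<dots> = ennreal (?P s * ?Q t) * (\<integral>\<^sup>+y. ennreal (?A s y * ?B t y) \<partial>lborel)"
        by (rule nn_integral_cmult) auto
      also have "(\<integral>\<^sup>+y. ennreal (?A s y * ?B t y) \<partial>lborel) = ennreal (exp (- (s * t / (s + t) * (norm x)\<^sup>2)) * (pi / (s + t)) powr (N / 2))"
        using True unfolding N_def by (intro nn_integral_gaussian_conv) auto
      finally show ?thesis
        using True by (simp add: ennreal_mult'[symmetric])
    qed auto
  qed
  also have "\<dots> = ennreal (pi powr (N / 2) * Gamma ((a + b - N) / 2) * norm x powr (N - a - b) *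
        (Gamma ((N - a) / 2) * Gamma ((N - b) / 2) / Gamma ((2 * N - a - b) / 2)))"
    using assms by (intro nn_integral_gaussian_parameters) auto
  finally have "ennreal (1 / (Gamma (a / 2) * Gamma (b / 2))) * (ennreal (Gamma (a / 2) * Gamma (b / 2)) * ?I) =
    ennreal (1 / (Gamma (a / 2) * Gamma (b / 2))) * ennreal (pi powr (N / 2) * Gamma ((a + b - N) / 2) * norm x powr (N - a - b) *
        (Gamma ((N - a) / 2) * Gamma ((N - b) / 2) / Gamma ((2 * N - a - b) / 2)))"
    by simp
  moreover have "ennreal (1 / (Gamma (a / 2) * Gamma (b / 2))) * (ennreal (Gamma (a / 2) * Gamma (b / 2)) * ?I) = ?I"
    using G by (simp add: mult.assoc[symmetric] ennreal_mult'[symmetric])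
  ultimately show ?thesis
    using G by (simp add: ennreal_mult'[symmetric] mult_ac)
qed

text \<open>Read off from the composition formula instead of polar coordinates: on the ball the
  extra factor |x - y|^(-a), with x a unit vector, is bounded below, and the composition integral is
  finite.\<close>

lemma nn_integral_norm_powr_ball_finite:
  fixes b R :: real
  assumes b: "b < real DIM('a)"
  shows "(\<integral>\<^sup>+y. ennreal (indicator (ball 0 R) (y::'a::euclidean_space) * norm y powr (- b)) \<partial>lborel) < \<infinity>"
proof (cases "b \<le> 0")
  case True
  have "(\<integral>\<^sup>+y. ennreal (indicator (ball 0 R) (y::'a) * norm y powr (- b)) \<partial>lborel)
    \<le> (\<integral>\<^sup>+y. ennreal (\<bar>R\<bar> powr (- b)) * indicator (ball 0 R) (y::'a) \<partial>lborel)"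
    using True by (intro nn_integral_mono) (auto simp: indicator_def intro!: powr_mono2)
  also have "\<dots> = ennreal (\<bar>R\<bar> powr (- b)) * emeasure lborel (ball (0::'a) R)"
    by (rule nn_integral_cmult_indicator) auto
  also have "\<dots> < \<infinity>"
    using emeasure_lborel_ball_finite[of "0::'a" R] by (simp add: ennreal_mult_less_top)
  finally show ?thesis .
next
  case False
  define N where "N = real DIM('a)"
  \<comment> \<open>Chosen so that a < N and a + b = N + b / 2 > N, as the composition formula
    demands.\<close>
  define a where "a = N - b / 2"
  obtain x :: 'a where x: "x \<in> Basis" by (meson nonempty_Basis ex_in_conv)
  have ab: "0 < a" "a < N" "0 < b" "b < N" "N < a + b"
    using False b by (auto simp: a_def N_def)
  define K where "K = 1 + \<bar>R\<bar>"
  have "(\<integral>\<^sup>+y. ennreal (indicator (ball 0 R) (y::'a) * norm y powr (- b)) \<partial>lborel)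
    \<le> (\<integral>\<^sup>+y. ennreal (K powr a) * ennreal (norm (x - y) powr (- a) * norm y powr (- b)) \<partial>lborel)"
  proof (intro nn_integral_mono_AE)
    have "AE y in lborel. y \<noteq> x" by (rule AE_lborel_singleton)
    then show "AE y in lborel. ennreal (indicator (ball 0 R) y * norm y powr (- b)) \<le> ennreal (K powr a) * ennreal (norm (x - y) powr (- a) * norm y powr (- b))"
    proof eventually_elim
      case (elim y)
      show ?case
      proof (cases "y \<in> ball 0 R")
        case True
        have n: "0 < norm (x - y)" using elim by simp
        have "norm (x - y) \<le> K"
          using norm_triangle_ineq4[of x y] x True by (simp add: K_def)
        then have "norm (x - y) powr a \<le> K powr a"
          using ab by (intro powr_mono2) auto
        then have "norm (x - y) powr a * norm (x - y) powr (- a) \<le> K powr a * norm (x - y) powr (- a)"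
          by (rule mult_right_mono) simp
        moreover have "norm (x - y) powr a * norm (x - y) powr (- a) = 1"
          using n by (simp add: powr_add[symmetric])
        ultimately have "1 * norm y powr (- b) \<le> (K powr a * norm (x - y) powr (- a)) * norm y powr (- b)"
          by (intro mult_right_mono) auto
        then show ?thesis
          using True by (simp add: ennreal_mult'[symmetric] mult.assoc)
      qed simp
    qed
  qed
  also have "\<dots> = ennreal (K powr a) * (\<integral>\<^sup>+y. ennreal (norm (x - y) powr (- a) * norm y powr (- b)) \<partial>lborel)"
    by (rule nn_integral_cmult) auto
  also have "\<dots> < \<infinity>"
    using ab x nonzero_Basis[of x] by (subst nn_integral_riesz_composition) (auto simp: N_def ennreal_mult'[symmetric] ennreal_mult_less_top)
  finally show ?thesis .
qed

subsection \<open>Completeness and convergence in \<open>L\<^sup>2\<close>\<close>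

text \<open>Choosing \<open>\<integral> |f (r (Suc k)) - f (r k)|\<^sup>2 \<le> 8 ^ - k\<close>, the bound \<open>a \<le> 1 / 2 ^ k + 2 ^ k * a\<^sup>2\<close>
  makes the increments summable almost everywhere, without any finiteness assumption on the measure.\<close>

lemma L2_complete:
  fixes f :: "nat \<Rightarrow> 'a \<Rightarrow> 'b::euclidean_space"
  assumes meas[measurable]: "\<And>n. f n \<in> borel_measurable M"
    and cauchy: "\<And>e::real. 0 < e \<Longrightarrow> \<exists>K. \<forall>m\<ge>K. \<forall>n\<ge>K. (\<integral>\<^sup>+x. ennreal ((norm (f m x - f n x))\<^sup>2) \<partial>M) < ennreal e"
  shows "\<exists>g r. g \<in> borel_measurable M \<and> strict_mono (r :: nat \<Rightarrow> nat) \<and> (AE x in M. (\<lambda>k. f (r k) x) \<longlonglongrightarrow> g x) \<and>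
     (\<lambda>n. \<integral>\<^sup>+x. ennreal ((norm (f n x - g x))\<^sup>2) \<partial>M) \<longlonglongrightarrow> 0"
proof -
  have "\<exists>K. \<forall>k. \<forall>m\<ge>K k. \<forall>n\<ge>K k. (\<integral>\<^sup>+x. ennreal ((norm (f m x - f n x))\<^sup>2) \<partial>M) < ennreal (1 / 8 ^ k)"
    by (intro choice allI cauchy) simp
  then obtain K where K: "\<And>k m n. m \<ge> K k \<Longrightarrow> n \<ge> K k \<Longrightarrow> (\<integral>\<^sup>+x. ennreal ((norm (f m x - f n x))\<^sup>2) \<partial>M) < ennreal (1 / 8 ^ k)"
    by blast
  \<comment> \<open>Summing the thresholds and adding 1 each time makes \<open>r\<close> strictly
    increasing and at least \<open>K k\<close> at every k.\<close>
  define r where "r k = (\<Sum>j\<le>k. K j + 1)" for k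
  have "r k < r (Suc k)" for k by (simp add: r_def)
  then have r: "strict_mono r" by (rule strict_monoI_Suc)
  have rK: "K k \<le> r k" for k
  proof -
    have "K k + 1 \<le> r k" unfolding r_def by (rule member_le_sum) auto
    then show ?thesis by simp
  qed
  \<comment> \<open>With weight 2^k the squared increments integrate to at most 2^k 8^(-k) = 4^(-k),
    which is still summable.\<close>
  define a where "a k x = norm (f (r (Suc k)) x - f (r k) x)" for k x
  have [measurable]: "a k \<in> borel_measurable M" for k unfolding a_def by measurable
  have "(\<integral>\<^sup>+x. (\<Sum>k. ennreal (2 ^ k * (a k x)\<^sup>2)) \<partial>M) = (\<Sum>k. \<integral>\<^sup>+x. ennreal (2 ^ k * (a k x)\<^sup>2) \<partial>M)"
    by (rule nn_integral_suminf) measurable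
  also have "\<dots> \<le> (\<Sum>k. ennreal ((1 / 4) ^ k))"
  proof (rule suminf_le)
    fix k
    have "(\<integral>\<^sup>+x. ennreal (2 ^ k * (a k x)\<^sup>2) \<partial>M) = ennreal (2 ^ k) * (\<integral>\<^sup>+x. ennreal ((a k x)\<^sup>2) \<partial>M)"
      by (subst nn_integral_cmult[symmetric]) (auto simp: ennreal_mult')
    also have "\<dots> \<le> ennreal (2 ^ k) * ennreal (1 / 8 ^ k)"
      unfolding a_def using rK[of k] strict_mono_leD[OF r, of k "Suc k"]
      by (intro mult_left_mono less_imp_le[OF K]) auto
    also have "\<dots> = ennreal ((1 / 4) ^ k)"
      by (simp add: ennreal_mult'[symmetric] power_divide flip: power_mult_distrib)
         (simp add: field_simps flip: power_mult_distrib)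
    finally show "(\<integral>\<^sup>+x. ennreal (2 ^ k * (a k x)\<^sup>2) \<partial>M) \<le> ennreal ((1 / 4) ^ k)" .
  qed auto
  also have "\<dots> = ennreal (\<Sum>k. (1 / 4) ^ k)"
    by (rule suminf_ennreal2) auto
  also have "\<dots> < \<infinity>" by simp
  finally have "AE x in M. (\<Sum>k. ennreal (2 ^ k * (a k x)\<^sup>2)) \<noteq> \<infinity>"
    by (intro nn_integral_PInf_AE) auto
  then have conv: "AE x in M. convergent (\<lambda>k. f (r k) x)"
  proof eventually_elim
    case (elim x)
    have s1: "summable (\<lambda>k. 2 ^ k * (a k x)\<^sup>2)"
      using elim by (intro summable_suminf_not_top) auto
    have "summable (\<lambda>k. (1 / 2) ^ k + 2 ^ k * (a k x)\<^sup>2)"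
      by (intro summable_add s1 summable_geometric) simp
    then have "summable (\<lambda>k. f (r (Suc k)) x - f (r k) x)"
    proof (rule summable_comparison_test')
      fix k :: nat
      have "norm (f (r (Suc k)) x - f (r k) x) = a k x" by (simp add: a_def)
      also have "a k x \<le> (1 / 2) ^ k + 2 ^ k * (a k x)\<^sup>2"
      proof -
        define p :: real where "p = 2 ^ k"
        have p: "0 < p" "(1 / 2) ^ k = 1 / p" by (auto simp: p_def power_divide)
        have "a k x * p \<le> 1 + (a k x * p)\<^sup>2"
          using zero_le_power2[of "a k x * p - 1"] zero_le_power2[of "a k x * p + 1"] by (simp add: power2_sum power2_diff)
        then show ?thesis unfolding p_def[symmetric] using p by (simp add: field_simps power2_eq_square)
      qed
      finally show "norm (f (r (Suc k)) x - f (r k) x) \<le> (1 / 2) ^ k + 2 ^ k * (a k x)\<^sup>2" .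
    qed
    then have "convergent (\<lambda>n. \<Sum>k<n. f (r (Suc k)) x - f (r k) x)"
      by (simp add: summable_iff_convergent)
    then have "convergent (\<lambda>n. (\<Sum>k<n. f (r (Suc k)) x - f (r k) x) + f (r 0) x)"
      by (intro convergent_add convergent_const)
    then show ?case
      unfolding sum_lessThan_telescope[of "\<lambda>k. f (r k) x"] by simp
  qed
  define g where "g x = lim (\<lambda>k. f (r k) x)" for x
  have g[measurable]: "g \<in> borel_measurable M"
    unfolding g_def by measurable
  have lim: "AE x in M. (\<lambda>k. f (r k) x) \<longlonglongrightarrow> g x"
    using conv by eventually_elim (simp add: g_def convergent_LIMSEQ_iff)
  have "(\<lambda>n. \<integral>\<^sup>+x. ennreal ((norm (f n x - g x))\<^sup>2) \<partial>M) \<longlonglongrightarrow> 0"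
  proof (rule order_tendstoI)
    fix c :: ennreal assume "0 < c"
    then obtain d where d: "0 < d" "d < c" using dense by blast
    then obtain e where e: "d = ennreal e" "0 < e"
      by (cases d) auto
    \<comment> \<open>Fatou's lemma: for fixed n the distance from \<open>f n\<close> to the limit
      is at most the lower limit of its distances to \<open>f (r k)\<close>, and these stay below
      \<open>e\<close> as soon as n and k reach \<open>K'\<close>.\<close>
    obtain K' where K': "\<And>m n. m \<ge> K' \<Longrightarrow> n \<ge> K' \<Longrightarrow> (\<integral>\<^sup>+x. ennreal ((norm (f m x - f n x))\<^sup>2) \<partial>M) < ennreal e"
      using cauchy[OF e(2)] by blast
    show "\<forall>\<^sub>F n in sequentially. (\<integral>\<^sup>+x. ennreal ((norm (f n x - g x))\<^sup>2) \<partial>M) < c"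
      using eventually_ge_at_top[of K']
    proof eventually_elim
      case (elim n)
      have "(\<integral>\<^sup>+x. ennreal ((norm (f n x - g x))\<^sup>2) \<partial>M) = (\<integral>\<^sup>+x. liminf (\<lambda>k. ennreal ((norm (f n x - f (r k) x))\<^sup>2)) \<partial>M)"
      proof (rule nn_integral_cong_AE)
        show "AE x in M. ennreal ((norm (f n x - g x))\<^sup>2) = liminf (\<lambda>k. ennreal ((norm (f n x - f (r k) x))\<^sup>2))"
          using lim
        proof eventually_elim
          case (elim x)
          have "(\<lambda>k. ennreal ((norm (f n x - f (r k) x))\<^sup>2)) \<longlonglongrightarrow> ennreal ((norm (f n x - g x))\<^sup>2)"
            by (intro tendsto_intros elim)
          then show ?case
            by (intro lim_imp_Liminf[symmetric]) simp_all
        qed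
      qed
      also have "\<dots> \<le> liminf (\<lambda>k. \<integral>\<^sup>+x. ennreal ((norm (f n x - f (r k) x))\<^sup>2) \<partial>M)"
        by (rule nn_integral_liminf) measurable
      also have "\<dots> \<le> limsup (\<lambda>k. \<integral>\<^sup>+x. ennreal ((norm (f n x - f (r k) x))\<^sup>2) \<partial>M)"
        by (rule Liminf_le_Limsup) simp
      also have "\<dots> \<le> ennreal e"
      proof (rule Limsup_bounded)
        show "\<forall>\<^sub>F k in sequentially. (\<integral>\<^sup>+x. ennreal ((norm (f n x - f (r k) x))\<^sup>2) \<partial>M) \<le> ennreal e"
          using eventually_ge_at_top[of K']
        proof eventually_elim
          case (elim k)
          then have "K' \<le> r k" using seq_suble[OF r, of k] by simp
          then show ?case using \<open>K' \<le> n\<close> by (intro order.strict_implies_order[OF K'])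
        qed
      qed
      finally show ?case using d e by simp
    qed
  qed simp
  then show ?thesis using g r lim by blast
qed

section \<open>Square-integrable functions and their pairings\<close>

text \<open>Measurability is a separate clause because it does not follow from integrability of the
  squared norm. Vector values let one notion serve functions and gradients alike.\<close>

definition sq_integrable :: "'a measure \<Rightarrow> ('a \<Rightarrow> 'b::euclidean_space) \<Rightarrow> bool" where
  "sq_integrable M f \<longleftrightarrow> f \<in> borel_measurable M \<and> integrable M (\<lambda>x. (norm (f x))\<^sup>2)"

lemma sq_integrable_meas: "sq_integrable M f \<Longrightarrow> f \<in> borel_measurable M"
  by (simp add: sq_integrable_def)

lemma sq_integrableD: "sq_integrable M f \<Longrightarrow> integrable M (\<lambda>x. (norm (f x))\<^sup>2)"
  by (simp add: sq_integrable_def)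

lemma sq_integrable_bound:
  assumes "sq_integrable M f" "g \<in> borel_measurable M" "\<And>x. norm (g x) \<le> C * norm (f x)"
  shows "sq_integrable M g"
  unfolding sq_integrable_def
proof (intro conjI assms(2))
  show "integrable M (\<lambda>x. (norm (g x))\<^sup>2)"
  proof (rule Bochner_Integration.integrable_bound)
    show "integrable M (\<lambda>x. C\<^sup>2 * (norm (f x))\<^sup>2)"
      by (intro integrable_mult_right sq_integrableD assms)
    show "AE x in M. norm ((norm (g x))\<^sup>2) \<le> norm (C\<^sup>2 * (norm (f x))\<^sup>2)"
      using assms(3) by (auto simp flip: power_mult_distrib intro!: power_mono always_eventually)
  qed (use assms(2) in measurable)
qed

lemma sq_integrable_add:
  assumes f: "sq_integrable M f" and g: "sq_integrable M g"
  shows "sq_integrable M (\<lambda>x. f x + g x)"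
  unfolding sq_integrable_def
proof
  have [measurable]: "f \<in> borel_measurable M" "g \<in> borel_measurable M"
    using f g by (auto simp: sq_integrable_def)
  show "(\<lambda>x. f x + g x) \<in> borel_measurable M" by measurable
  show "integrable M (\<lambda>x. (norm (f x + g x))\<^sup>2)"
  proof (rule Bochner_Integration.integrable_bound)
    show "integrable M (\<lambda>x. 2 * (norm (f x))\<^sup>2 + 2 * (norm (g x))\<^sup>2)"
      by (intro Bochner_Integration.integrable_add integrable_mult_right sq_integrableD f g)
    have "(norm (u + v))\<^sup>2 \<le> 2 * (norm u)\<^sup>2 + 2 * (norm v)\<^sup>2" for u v :: 'b
    proof -
      have "(norm (u + v))\<^sup>2 \<le> (norm u + norm v)\<^sup>2" by (intro power_mono norm_triangle_ineq) auto
      also have "\<dots> \<le> 2 * (norm u)\<^sup>2 + 2 * (norm v)\<^sup>2"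
        using zero_le_power2[of "norm u - norm v"] by (simp add: power2_sum power2_diff)
      finally show ?thesis .
    qed
    then show "AE x in M. norm ((norm (f x + g x))\<^sup>2) \<le> norm (2 * (norm (f x))\<^sup>2 + 2 * (norm (g x))\<^sup>2)"
      by simp
  qed measurable
qed

lemma sq_integrable_diff:
  assumes f: "sq_integrable M f" and g: "sq_integrable M g"
  shows "sq_integrable M (\<lambda>x. f x - g x)"
proof -
  have "sq_integrable M (\<lambda>x. - g x)"
    using g by (auto simp: sq_integrable_def)
  from sq_integrable_add[OF f this] show ?thesis by simp
qed

lemma sq_integrable_inner:
  assumes f: "sq_integrable M f" and g: "sq_integrable M g"
  shows "integrable M (\<lambda>x. f x \<bullet> g x)"
proof (rule Bochner_Integration.integrable_bound)
  have [measurable]: "f \<in> borel_measurable M" "g \<in> borel_measurable M"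
    using f g by (auto simp: sq_integrable_def)
  show "(\<lambda>x. f x \<bullet> g x) \<in> borel_measurable M" by measurable
  show "integrable M (\<lambda>x. (norm (f x))\<^sup>2 + (norm (g x))\<^sup>2)"
    by (intro Bochner_Integration.integrable_add sq_integrableD f g)
  have "\<bar>u \<bullet> v\<bar> \<le> (norm u)\<^sup>2 + (norm v)\<^sup>2" for u v :: 'b
    using Cauchy_Schwarz_ineq2[of u v] zero_le_power2[of "norm u - norm v"] mult_nonneg_nonneg[OF norm_ge_zero[of u] norm_ge_zero[of v]]
    by (simp add: power2_diff)
  then show "AE x in M. norm (f x \<bullet> g x) \<le> norm ((norm (f x))\<^sup>2 + (norm (g x))\<^sup>2)"
    by simp
qed

text \<open>The integral of |f - t g|^2 is a quadratic in t that is never negative; its discriminant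
  gives the inequality.\<close>

lemma L2_Cauchy_Schwarz:
  assumes f: "sq_integrable M f" and g: "sq_integrable M g"
  shows "(\<integral>x. f x \<bullet> g x \<partial>M)\<^sup>2 \<le> (\<integral>x. (norm (f x))\<^sup>2 \<partial>M) * (\<integral>x. (norm (g x))\<^sup>2 \<partial>M)"
proof -
  define a b c where "a = (\<integral>x. (norm (f x))\<^sup>2 \<partial>M)" and "b = (\<integral>x. f x \<bullet> g x \<partial>M)" and "c = (\<integral>x. (norm (g x))\<^sup>2 \<partial>M)"
  note int = sq_integrableD[OF f] sq_integrableD[OF g] sq_integrable_inner[OF f g]
  have quad: "0 \<le> a - 2 * t * b + t\<^sup>2 * c" for t
  proof -
    have "0 \<le> (\<integral>x. (norm (f x - t *\<^sub>R g x))\<^sup>2 \<partial>M)" by simp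
    also have "(\<lambda>x. (norm (f x - t *\<^sub>R g x))\<^sup>2) = (\<lambda>x. (norm (f x))\<^sup>2 - 2 * t * (f x \<bullet> g x) + t\<^sup>2 * (norm (g x))\<^sup>2)"
      unfolding power2_norm_eq_inner by (simp add: inner_diff inner_commute power2_eq_square algebra_simps)
    also have "(\<integral>x. (norm (f x))\<^sup>2 - 2 * t * (f x \<bullet> g x) + t\<^sup>2 * (norm (g x))\<^sup>2 \<partial>M) = a - 2 * t * b + t\<^sup>2 * c"
      using int by (simp add: a_def b_def c_def)
    finally show ?thesis .
  qed
  have nn: "0 \<le> a" "0 \<le> c" by (auto simp: a_def c_def)
  have "b\<^sup>2 \<le> a * c"
  proof (cases "c = 0")
    case True
    have "b = 0"
    proof (rule ccontr)
      assume "b \<noteq> 0"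
      \<comment> \<open>For c = 0 the quadratic is affine in t, and at this t it takes the value
        -1.\<close>
      then show False using quad[of "(a + 1) / (2 * b)"] nn True by simp
    qed
    then show ?thesis using nn by simp
  next
    case False
    then show ?thesis using quad[of "b / c"] nn
      by (simp add: power2_eq_square field_simps)
  qed
  then show ?thesis by (simp add: a_def b_def c_def)
qed

text \<open>The difference of the pairings splits into three pairings, each with at least one factor
  tending to 0 in L^2, and Cauchy-Schwarz makes each of them small.\<close>

lemma L2_inner_tendsto:
  assumes f: "\<And>n. sq_integrable M (f n)" "sq_integrable M f'" and g: "\<And>n. sq_integrable M (g n)" "sq_integrable M g'"
    and lf: "(\<lambda>n. \<integral>x. (norm (f n x - f' x))\<^sup>2 \<partial>M) \<longlonglongrightarrow> 0"
    and lg: "(\<lambda>n. \<integral>x. (norm (g n x - g' x))\<^sup>2 \<partial>M) \<longlonglongrightarrow> 0"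
  shows "(\<lambda>n. \<integral>x. f n x \<bullet> g n x \<partial>M) \<longlonglongrightarrow> (\<integral>x. f' x \<bullet> g' x \<partial>M)"
proof -
  have small: "(\<lambda>n. \<integral>x. u n x \<bullet> v n x \<partial>M) \<longlonglongrightarrow> 0"
    if u: "\<And>n. sq_integrable M (u n)" and v: "\<And>n. sq_integrable M (v n)"
      and l: "(\<lambda>n. (\<integral>x. (norm (u n x))\<^sup>2 \<partial>M) * (\<integral>x. (norm (v n x))\<^sup>2 \<partial>M)) \<longlonglongrightarrow> 0" for u v
  proof -
    have "(\<lambda>n. (\<integral>x. u n x \<bullet> v n x \<partial>M)\<^sup>2) \<longlonglongrightarrow> 0"
      by (rule tendsto_sandwich[OF _ _ tendsto_const l]) (auto intro!: always_eventually L2_Cauchy_Schwarz u v)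
    then show ?thesis by simp
  qed
  note df = sq_integrable_diff[OF f(1) f(2)] and dg = sq_integrable_diff[OF g(1) g(2)]
  have "(\<lambda>n. (\<integral>x. (f n x - f' x) \<bullet> (g n x - g' x) \<partial>M) + (\<integral>x. (f n x - f' x) \<bullet> g' x \<partial>M) + (\<integral>x. f' x \<bullet> (g n x - g' x) \<partial>M)
      + (\<integral>x. f' x \<bullet> g' x \<partial>M)) \<longlonglongrightarrow> 0 + 0 + 0 + (\<integral>x. f' x \<bullet> g' x \<partial>M)"
    using tendsto_mult[OF lf lg] tendsto_mult_left_zero[OF lf] tendsto_mult_right_zero[OF lg]
    by (intro tendsto_add small df dg f g tendsto_const) auto
  also have "(\<lambda>n. (\<integral>x. (f n x - f' x) \<bullet> (g n x - g' x) \<partial>M) + (\<integral>x. (f n x - f' x) \<bullet> g' x \<partial>M) + (\<integral>x. f' x \<bullet> (g n x - g' x) \<partial>M)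
      + (\<integral>x. f' x \<bullet> g' x \<partial>M)) = (\<lambda>n. \<integral>x. f n x \<bullet> g n x \<partial>M)"
  proof
    fix n
    note i = sq_integrable_inner[OF df dg, of n n] sq_integrable_inner[OF df[of n] g(2)] sq_integrable_inner[OF f(2) dg[of n]] sq_integrable_inner[OF f(2) g(2)]
    have "(\<integral>x. f n x \<bullet> g n x \<partial>M) = (\<integral>x. (f n x - f' x) \<bullet> (g n x - g' x) + (f n x - f' x) \<bullet> g' x + f' x \<bullet> (g n x - g' x) + f' x \<bullet> g' x \<partial>M)"
      by (simp add: inner_diff algebra_simps)
    also have "\<dots> = (\<integral>x. (f n x - f' x) \<bullet> (g n x - g' x) \<partial>M) + (\<integral>x. (f n x - f' x) \<bullet> g' x \<partial>M) + (\<integral>x. f' x \<bullet> (g n x - g' x) \<partial>M)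
      + (\<integral>x. f' x \<bullet> g' x \<partial>M)"
      using i by (simp del: inner_diff_left inner_diff_right)
    finally show "\<dots> = (\<integral>x. f n x \<bullet> g n x \<partial>M)" ..
  qed
  finally show ?thesis by simp
qed

text \<open>Passes from the extended integrals of the completeness lemma to Bochner integrals: a
  single member of the sequence at finite distance from the limit makes the limit square
  integrable.\<close>

lemma L2_tendsto_sq_integrable:
  fixes f :: "nat \<Rightarrow> 'a \<Rightarrow> 'b::euclidean_space"
  assumes f: "\<And>n. sq_integrable M (f n)" and g: "g \<in> borel_measurable M"
    and lim: "(\<lambda>n. \<integral>\<^sup>+x. ennreal ((norm (f n x - g x))\<^sup>2) \<partial>M) \<longlonglongrightarrow> 0"
  shows "sq_integrable M g" "(\<lambda>n. \<integral>x. (norm (f n x - g x))\<^sup>2 \<partial>M) \<longlonglongrightarrow> 0"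
proof -
  have [measurable]: "f n \<in> borel_measurable M" "g \<in> borel_measurable M" for n
    using f g by (auto simp: sq_integrable_def)
  have "\<forall>\<^sub>F n in sequentially. (\<integral>\<^sup>+x. ennreal ((norm (f n x - g x))\<^sup>2) \<partial>M) < 1"
    using lim by (rule order_tendstoD) simp
  then obtain n where n: "(\<integral>\<^sup>+x. ennreal ((norm (f n x - g x))\<^sup>2) \<partial>M) < 1"
    by (auto simp: eventually_sequentially)
  have "integrable M (\<lambda>x. (norm (f n x - g x))\<^sup>2)"
    by (rule integrableI_bounded) (use less_trans[OF n, of \<infinity>] in auto)
  then have "sq_integrable M (\<lambda>x. f n x - g x)"
    by (simp add: sq_integrable_def)
  from sq_integrable_diff[OF f[of n] this] show g': "sq_integrable M g" by simp
  have "(\<integral>\<^sup>+x. ennreal ((norm (f n x - g x))\<^sup>2) \<partial>M) = ennreal (\<integral>x. (norm (f n x - g x))\<^sup>2 \<partial>M)" for n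
    by (intro nn_integral_eq_integral sq_integrableD sq_integrable_diff f g') auto
  with lim have "(\<lambda>n. ennreal (\<integral>x. (norm (f n x - g x))\<^sup>2 \<partial>M)) \<longlonglongrightarrow> ennreal 0" by simp
  then show "(\<lambda>n. \<integral>x. (norm (f n x - g x))\<^sup>2 \<partial>M) \<longlonglongrightarrow> 0"
    by (subst (asm) tendsto_ennreal_iff) (auto intro!: always_eventually)
qed

lemma sq_integrable_bounded_support:
  fixes v :: "'a::euclidean_space \<Rightarrow> 'b::euclidean_space"
  assumes [measurable]: "v \<in> borel_measurable borel"
    and bd: "\<And>x. norm x \<le> R \<Longrightarrow> norm (v x) \<le> C" and supp: "\<And>x. R < norm x \<Longrightarrow> v x = 0"
  shows "sq_integrable lborel v"
  unfolding sq_integrable_def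
proof
  show "integrable lborel (\<lambda>x. (norm (v x))\<^sup>2)"
  proof (rule Bochner_Integration.integrable_bound)
    show "integrable lborel (\<lambda>x. C\<^sup>2 * indicator (cball 0 R) (x::'a))"
      using emeasure_lborel_cball_finite[of "0::'a" R] by (intro integrable_mult_right integrable_real_indicator) auto
    show "AE x in lborel. norm ((norm (v x))\<^sup>2) \<le> norm (C\<^sup>2 * indicator (cball 0 R) x)"
      using bd supp by (intro always_eventually allI) (auto simp: indicator_def power2_le_iff_abs_le intro: power_mono)
  qed measurable
qed simp

lemma sq_integrable_scaleR:
  fixes u :: "'a \<Rightarrow> real" and v :: "'a \<Rightarrow> 'b::euclidean_space"
  assumes u: "sq_integrable M u" and v: "sq_integrable M v"
  shows "integrable M (\<lambda>x. u x *\<^sub>R v x)"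
proof (rule Bochner_Integration.integrable_bound)
  have [measurable]: "u \<in> borel_measurable M" "v \<in> borel_measurable M"
    using u v by (auto simp: sq_integrable_def)
  show "(\<lambda>x. u x *\<^sub>R v x) \<in> borel_measurable M" by measurable
  show "integrable M (\<lambda>x. (norm (u x))\<^sup>2 + (norm (v x))\<^sup>2)"
    by (intro Bochner_Integration.integrable_add sq_integrableD u v)
  have "\<bar>s\<bar> * t \<le> s\<^sup>2 + t\<^sup>2" if "0 \<le> t" for s t :: real
    using zero_le_power2[of "\<bar>s\<bar> - t"] mult_nonneg_nonneg[OF abs_ge_zero[of s] that] by (simp add: power2_diff)
  then show "AE x in M. norm (u x *\<^sub>R v x) \<le> norm ((norm (u x))\<^sup>2 + (norm (v x))\<^sup>2)"
    by simp
qed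

text \<open>The integrals that define a weak gradient are vector valued; coordinate by coordinate
  they reduce to the scalar pairing.\<close>

lemma L2_scaleR_tendsto:
  fixes v :: "nat \<Rightarrow> 'a \<Rightarrow> 'b::euclidean_space" and u :: "nat \<Rightarrow> 'a \<Rightarrow> real"
  assumes u: "\<And>n. sq_integrable M (u n)" "sq_integrable M u'" and v: "\<And>n. sq_integrable M (v n)" "sq_integrable M v'"
    and lu: "(\<lambda>n. \<integral>x. (norm (u n x - u' x))\<^sup>2 \<partial>M) \<longlonglongrightarrow> 0"
    and lv: "(\<lambda>n. \<integral>x. (norm (v n x - v' x))\<^sup>2 \<partial>M) \<longlonglongrightarrow> 0"
  shows "(\<lambda>n. \<integral>x. u n x *\<^sub>R v n x \<partial>M) \<longlonglongrightarrow> (\<integral>x. u' x *\<^sub>R v' x \<partial>M)"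
proof (rule tendsto_componentwise_iff[THEN iffD2], rule ballI)
  fix b :: 'b assume b: "b \<in> Basis"
  have ineq: "norm (w \<bullet> b) \<le> 1 * norm w" for w using b Basis_le_norm[of b w] by simp
  have comp: "sq_integrable M (\<lambda>x. w x \<bullet> b)" if "sq_integrable M w" for w
    using that ineq sq_integrable_meas[OF that] by (intro sq_integrable_bound[OF that, where C=1]) auto
  have "(\<lambda>n. \<integral>x. (norm (v n x \<bullet> b - v' x \<bullet> b))\<^sup>2 \<partial>M) \<longlonglongrightarrow> 0"
  proof (rule tendsto_sandwich[OF _ _ tendsto_const lv])
    show "\<forall>\<^sub>F n in sequentially. (\<integral>x. (norm (v n x \<bullet> b - v' x \<bullet> b))\<^sup>2 \<partial>M) \<le> (\<integral>x. (norm (v n x - v' x))\<^sup>2 \<partial>M)"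
    proof (intro always_eventually allI integral_mono)
      fix n x
      show "integrable M (\<lambda>x. (norm (v n x \<bullet> b - v' x \<bullet> b))\<^sup>2)"
        by (intro sq_integrableD sq_integrable_diff comp v)
      show "integrable M (\<lambda>x. (norm (v n x - v' x))\<^sup>2)"
        by (intro sq_integrableD sq_integrable_diff v)
      show "(norm (v n x \<bullet> b - v' x \<bullet> b))\<^sup>2 \<le> (norm (v n x - v' x))\<^sup>2"
        using ineq[of "v n x - v' x"] by (intro power_mono) (auto simp: inner_diff_left)
    qed
  qed simp
  then have "(\<lambda>n. \<integral>x. u n x \<bullet> (v n x \<bullet> b) \<partial>M) \<longlonglongrightarrow> (\<integral>x. u' x \<bullet> (v' x \<bullet> b) \<partial>M)"
    by (intro L2_inner_tendsto comp u v lu)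
  then show "(\<lambda>n. (\<integral>x. u n x *\<^sub>R v n x \<partial>M) \<bullet> b) \<longlonglongrightarrow> (\<integral>x. u' x *\<^sub>R v' x \<partial>M) \<bullet> b"
    using integral_inner_left[OF sq_integrable_scaleR[OF u(1) v(1)]] integral_inner_left[OF sq_integrable_scaleR[OF u(2) v(2)]]
    by simp
qed

subsection \<open>Integration by parts and Hardy's inequality\<close>

lemma GDERIV_grad:
  assumes "u differentiable (at x)"
  shows "GDERIV u x :> grad u x"
proof -
  let ?D = "frechet_derivative u (at x)"
  have D: "(u has_derivative ?D) (at x)"
    using assms by (simp add: frechet_derivative_works)
  interpret linear ?D
    by (rule has_derivative_linear[OF D])
  have "?D h = h \<bullet> grad u x" for h
  proof -
    have "?D h = ?D (\<Sum>b\<in>Basis. (h \<bullet> b) *\<^sub>R b)" by (simp add: euclidean_representation)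
    also have "\<dots> = (\<Sum>b\<in>Basis. (h \<bullet> b) * ?D b)"
      by (simp only: sum scaleR real_scaleR_def)
    also have "\<dots> = h \<bullet> grad u x"
      by (simp add: grad_def inner_sum_right mult.commute)
    finally show ?thesis .
  qed
  then have "?D = (\<lambda>h. h \<bullet> grad u x)" ..
  with D show ?thesis by (simp add: gderiv_def)
qed

lemma grad_unique:
  assumes "GDERIV u x :> g"
  shows "grad u x = g"
proof -
  have "u differentiable (at x)"
    using assms by (auto simp: gderiv_def differentiable_def)
  then have "(\<lambda>h. h \<bullet> grad u x) = (\<lambda>h. h \<bullet> g)"
    using has_derivative_unique GDERIV_grad assms unfolding gderiv_def by blast
  then have "(grad u x - g) \<bullet> grad u x = (grad u x - g) \<bullet> g" by metis
  then have "(grad u x - g) \<bullet> (grad u x - g) = 0"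
    by (simp add: inner_diff_right)
  then show ?thesis by simp
qed

section \<open>Compactly supported C^1 functions\<close>

text \<open>The working class for integration by parts. The gradient is carried along as an
  argument, so that products with regularised weights are handled by the product rule without
  unfolding \<open>frechet_derivative\<close>.\<close>

definition C1c :: "('a::euclidean_space \<Rightarrow> real) \<Rightarrow> ('a \<Rightarrow> 'a) \<Rightarrow> bool" where
  "C1c u g \<longleftrightarrow> (\<forall>x. GDERIV u x :> g x) \<and> continuous_on UNIV g \<and> (\<exists>R. \<forall>x. R \<le> norm x \<longrightarrow> u x = 0 \<and> g x = 0)"

lemma C1cD:
  assumes "C1c u g"
  shows "GDERIV u x :> g x" "continuous_on UNIV u" "continuous_on UNIV g"
  using assms unfolding C1c_def gderiv_def
  by (auto intro!: has_derivative_continuous_on intro: has_derivative_at_withinI)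

lemma C1c_measurable:
  assumes "C1c u g"
  shows "u \<in> borel_measurable borel" "g \<in> borel_measurable borel"
  using C1cD[OF assms] by (auto intro: borel_measurable_continuous_onI)

lemma C1c_bounded:
  assumes "C1c u g"
  obtains B R where "0 < R" "0 \<le> B" "\<And>x. \<bar>u x\<bar> \<le> B" "\<And>x. norm (g x) \<le> B" "\<And>x. R \<le> norm x \<Longrightarrow> u x = 0" "\<And>x. R \<le> norm x \<Longrightarrow> g x = 0"
proof -
  obtain R where R: "\<And>x. R \<le> norm x \<Longrightarrow> u x = 0 \<and> g x = 0"
    using assms unfolding C1c_def by blast
  have bd: "\<exists>B. \<forall>x. norm (f x) \<le> B" if "continuous_on UNIV f" "\<And>x. R \<le> norm x \<Longrightarrow> f x = 0" for f :: "'a \<Rightarrow> 'c::real_normed_vector"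
  proof -
    have "compact (f ` cball 0 R)"
      using that by (intro compact_continuous_image) (auto intro: continuous_on_subset)
    then obtain B where B: "\<And>y. y \<in> f ` cball 0 R \<Longrightarrow> norm y \<le> B"
      using compact_imp_bounded bounded_iff by metis
    have "norm (f x) \<le> max B 0" for x
      using B[of "f x"] that(2)[of x] by (cases "norm x \<le> R") (auto intro: max.coboundedI1)
    then show ?thesis by blast
  qed
  obtain B1 where B1: "\<And>x. norm (u x) \<le> B1"
    using bd[of u] R C1cD[OF assms] by blast
  obtain B2 where B2: "\<And>x. norm (g x) \<le> B2"
    using bd[of g] R C1cD[OF assms] by blast
  show thesis
    by (rule that[of "max R 1" "max 0 (max B1 B2)"]) (use B1 B2 R in \<open>auto simp: le_max_iff_disj\<close>)
qed

lemma test_fun_C1c: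
  assumes "test_fun f"
  shows "C1c f (grad f)"
proof -
  have "Ck (Suc 0) f" using assms unfolding test_fun_def by blast
  then have d: "\<And>x. f differentiable (at x)" and c: "\<And>b. b \<in> Basis \<Longrightarrow> continuous_on UNIV (\<lambda>x. frechet_derivative f (at x) b)"
    by auto
  have "bounded {x. f x \<noteq> 0}"
    using assms closure_subset bounded_subset compact_imp_bounded unfolding test_fun_def by metis
  then obtain R where "\<And>x. x \<in> {x. f x \<noteq> 0} \<Longrightarrow> norm x \<le> R"
    unfolding bounded_iff by blast
  then have R: "f x = 0" if "R < norm x" for x
    using that by (metis linorder_not_le mem_Collect_eq)
  have "grad f x = 0" if "R < norm x" for x
  proof (rule grad_unique)
    have "((\<lambda>x. 0) has_derivative (\<lambda>h. 0)) (at x)" by simp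
    then have "(f has_derivative (\<lambda>h. 0)) (at x)"
      by (rule has_derivative_transform_within_open[where s="- cball 0 R"]) (use R that in auto)
    then show "GDERIV f x :> 0" by (simp add: gderiv_def)
  qed
  \<comment> \<open>Vanishing is known for \<open>R < norm x\<close> only, while \<open>C1c\<close>
    asks for it from the radius on; hence the shift by 1.\<close>
  with R have "\<forall>x. R + 1 \<le> norm x \<longrightarrow> f x = 0 \<and> grad f x = 0" by auto
  moreover have "continuous_on UNIV (grad f)"
    unfolding grad_def[abs_def] by (intro continuous_intros c)
  ultimately show ?thesis
    unfolding C1c_def using GDERIV_grad[OF d] by blast
qed

lemma C1c_diff:
  assumes "C1c u u'" "C1c v v'"
  shows "C1c (\<lambda>x. u x - v x) (\<lambda>x. u' x - v' x)"
proof -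
  obtain R where R: "\<And>x. R \<le> norm x \<Longrightarrow> u x = 0 \<and> u' x = 0" using assms(1) unfolding C1c_def by blast
  obtain S where S: "\<And>x. S \<le> norm x \<Longrightarrow> v x = 0 \<and> v' x = 0" using assms(2) unfolding C1c_def by blast
  have "\<forall>x. max R S \<le> norm x \<longrightarrow> u x - v x = 0 \<and> u' x - v' x = 0" using R S by simp
  then show ?thesis
    using assms unfolding C1c_def by (blast intro: GDERIV_diff continuous_on_diff)
qed

lemma C1c_mult:
  assumes w: "\<And>x. GDERIV w x :> w' x" "continuous_on UNIV w'" and u: "C1c u u'"
  shows "C1c (\<lambda>x. w x * u x) (\<lambda>x. w x *\<^sub>R u' x + u x *\<^sub>R w' x)"
proof -
  obtain R where R: "\<And>x. R \<le> norm x \<Longrightarrow> u x = 0 \<and> u' x = 0" using u unfolding C1c_def by blast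
  have "continuous_on UNIV w"
    using w(1) unfolding gderiv_def by (auto intro!: has_derivative_continuous_on intro: has_derivative_at_withinI)
  with w u C1cD[OF u] have "continuous_on UNIV (\<lambda>x. w x *\<^sub>R u' x + u x *\<^sub>R w' x)"
    by (intro continuous_intros)
  moreover have "\<forall>x. R \<le> norm x \<longrightarrow> w x * u x = 0 \<and> w x *\<^sub>R u' x + u x *\<^sub>R w' x = 0" using R by simp
  ultimately show ?thesis
    using w u unfolding C1c_def by (blast intro: GDERIV_mult)
qed

lemma integrable_compact_support:
  fixes f :: "'a::euclidean_space \<Rightarrow> 'b::euclidean_space"
  assumes "continuous_on UNIV f" "\<And>x. R \<le> norm x \<Longrightarrow> f x = 0"
  shows "integrable lborel f"
proof -
  have "integrable lborel (\<lambda>x. indicator (cball 0 R) x *\<^sub>R f x)"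
    by (intro borel_integrable_compact continuous_on_subset[OF assms(1)]) auto
  moreover have "(\<lambda>x. indicator (cball 0 R) x *\<^sub>R f x) = f"
    using assms(2) by (auto simp: indicator_def fun_eq_iff)
  ultimately show ?thesis by simp
qed

lemma C1c_integrable:
  assumes "C1c u g"
  shows "integrable lborel u" "integrable lborel g"
proof -
  obtain R where R: "\<And>x. R \<le> norm x \<Longrightarrow> u x = 0 \<and> g x = 0"
    using assms unfolding C1c_def by blast
  show "integrable lborel u" "integrable lborel g"
    using R by (auto intro: integrable_compact_support[where R=R] C1cD[OF assms])
qed

text \<open>By translation invariance of Lebesgue measure every difference quotient of u has
  integral 0; dominated convergence carries this over to the directional derivative.\<close>

lemma C1c_integral_grad:
  fixes u :: "'a::euclidean_space \<Rightarrow> real"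
  assumes "C1c u g"
  shows "(\<integral>x. g x \<partial>lborel) = 0"
proof (rule euclidean_eqI)
  fix b :: 'a assume b: "b \<in> Basis"
  obtain B R where R: "0 < R" and B: "0 \<le> B" "\<And>x. norm (g x) \<le> B" and supp: "\<And>x. R \<le> norm x \<Longrightarrow> u x = 0"
    using C1c_bounded[OF assms] by metis
  note intu = C1c_integrable(1)[OF assms] and intg = C1c_integrable(2)[OF assms]
  note [measurable] = C1c_measurable[OF assms]
  define q where "q n x = (u (inverse (real (Suc n)) *\<^sub>R b + x) - u x) / inverse (real (Suc n))" for n x
  have [measurable]: "q n \<in> borel_measurable borel" for n
    unfolding q_def by measurable
  have transl: "integrable lborel (\<lambda>x. u (c + x))" "(\<integral>x. u (c + x) \<partial>lborel) = (\<integral>x. u x \<partial>lborel)" for c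
  proof -
    have "integrable (distr lborel borel ((+) c)) u"
      unfolding lborel_distr_plus by (rule intu)
    then show "integrable lborel (\<lambda>x. u (c + x))"
      by (subst (asm) integrable_distr_eq) auto
    have "(\<integral>x. u x \<partial>distr lborel borel ((+) c)) = (\<integral>x. u (c + x) \<partial>lborel)"
      by (rule integral_distr) auto
    then show "(\<integral>x. u (c + x) \<partial>lborel) = (\<integral>x. u x \<partial>lborel)"
      unfolding lborel_distr_plus by simp
  qed
  have D: "((\<lambda>s. u (x + s *\<^sub>R b)) has_real_derivative (g (x + s *\<^sub>R b) \<bullet> b)) (at s)" for x s
  proof -
    have "(u has_derivative (\<lambda>h. h \<bullet> g (x + s *\<^sub>R b))) (at (x + s *\<^sub>R b))"
      using C1cD(1)[OF assms] by (simp add: gderiv_def)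
    moreover have "((\<lambda>s. x + s *\<^sub>R b) has_derivative (\<lambda>h. h *\<^sub>R b)) (at s)"
      by (auto intro!: derivative_eq_intros)
    ultimately have "((\<lambda>s. u (x + s *\<^sub>R b)) has_derivative (\<lambda>h. (h *\<^sub>R b) \<bullet> g (x + s *\<^sub>R b))) (at s)"
      by (rule has_derivative_compose[rotated])
    then show ?thesis
      by (simp add: has_field_derivative_def mult_commute_abs inner_commute)
  qed
  \<comment> \<open>The mean value theorem bounds the quotient by the supremum of the gradient, and
    since the step is at most 1 the support grows to radius R + 1 at most.\<close>
  have bound: "\<bar>q n x\<bar> \<le> B * indicator (cball 0 (R + 1)) x" for n x
  proof (cases "norm x \<le> R + 1")
    case True
    define h where "h = inverse (real (Suc n))"
    have h: "0 < h" by (simp add: h_def)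
    obtain z where z: "u (x + h *\<^sub>R b) - u (x + 0 *\<^sub>R b) = (h - 0) * (g (x + z *\<^sub>R b) \<bullet> b)"
      using MVT2[of 0 h "\<lambda>s. u (x + s *\<^sub>R b)" "\<lambda>s. g (x + s *\<^sub>R b) \<bullet> b"] D h by blast
    have "q n x = (u (h *\<^sub>R b + x) - u x) / h" unfolding q_def h_def ..
    also have "\<dots> = g (x + z *\<^sub>R b) \<bullet> b"
      using z h by (simp add: add.commute)
    also have "\<bar>\<dots>\<bar> \<le> norm (g (x + z *\<^sub>R b)) * norm b"
      by (rule Cauchy_Schwarz_ineq2)
    also have "\<dots> \<le> B" using B b by simp
    finally show ?thesis using True by simp
  next
    case False
    have "norm (inverse (real (Suc n)) *\<^sub>R b) \<le> 1" using b by (simp add: field_simps)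
    then have "R \<le> norm (inverse (real (Suc n)) *\<^sub>R b + x)"
      using False norm_triangle_ineq4[of "inverse (real (Suc n)) *\<^sub>R b + x" "inverse (real (Suc n)) *\<^sub>R b"] by simp
    then show ?thesis
      using supp False B by (simp add: q_def)
  qed
  have lim: "(\<lambda>n. q n x) \<longlonglongrightarrow> g x \<bullet> b" for x
  proof -
    have "((\<lambda>h. (u (x + (0 + h) *\<^sub>R b) - u (x + 0 *\<^sub>R b)) / h) \<longlongrightarrow> g (x + 0 *\<^sub>R b) \<bullet> b) (at 0)"
      using D[of x 0] unfolding DERIV_def by simp
    moreover have "filterlim (\<lambda>n. inverse (real (Suc n))) (at 0) sequentially"
      by (auto simp: filterlim_at simp del: of_nat_Suc intro!: LIMSEQ_inverse_real_of_nat)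
    ultimately show ?thesis
      by (auto simp: q_def add.commute dest: filterlim_compose)
  qed
  have "(\<lambda>n. \<integral>x. q n x \<partial>lborel) \<longlonglongrightarrow> (\<integral>x. g x \<bullet> b \<partial>lborel)"
  proof (rule integral_dominated_convergence)
    show "integrable lborel (\<lambda>x. B * indicator (cball 0 (R + 1)) (x::'a))"
      using emeasure_lborel_cball_finite[of "0::'a" "R + 1"] by (intro integrable_mult_right integrable_real_indicator) auto
  qed (use lim bound in auto)
  moreover have "(\<integral>x. q n x \<partial>lborel) = 0" for n
    unfolding q_def using transl intu by simp
  ultimately have "(\<integral>x. g x \<bullet> b \<partial>lborel) = 0"
    by (simp add: LIMSEQ_const_iff)
  then show "(\<integral>x. g x \<partial>lborel) \<bullet> b = 0 \<bullet> b"
    using intg by (simp add: integral_inner_left)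
qed

section \<open>Integration by parts against singular weights\<close>

lemma integrable_norm_powr_ball:
  fixes b R :: real
  assumes b: "- real DIM('a) < b"
  shows "integrable lborel (\<lambda>y::'a::euclidean_space. indicator (ball 0 R) y * norm y powr b)"
proof (rule integrableI_bounded)
  show "(\<lambda>y::'a. indicator (ball 0 R) y * norm y powr b) \<in> borel_measurable lborel"
  proof -
    have [measurable]: "ball (0::'a) R \<in> sets borel" by simp
    show ?thesis by measurable
  qed
  show "(\<integral>\<^sup>+y. ennreal (norm (indicator (ball 0 R) (y::'a) * norm y powr b)) \<partial>lborel) < \<infinity>"
    using nn_integral_norm_powr_ball_finite[where 'a='a, of "- b" R] b by simp
qed

lemma integrable_norm_powr_dominated:
  fixes u :: "'a::euclidean_space \<Rightarrow> real" and F :: "'a \<Rightarrow> 'b::euclidean_space"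
  assumes b: "- real DIM('a) < b" and [measurable]: "F \<in> borel_measurable borel"
    and supp: "\<And>x. R \<le> norm x \<Longrightarrow> F x = 0" and bd: "\<And>x. x \<noteq> 0 \<Longrightarrow> norm x < R \<Longrightarrow> norm (F x) \<le> C * norm x powr b"
  shows "integrable lborel F"
proof (rule Bochner_Integration.integrable_bound)
  show "integrable lborel (\<lambda>x::'a. C * (indicator (ball 0 R) x * norm x powr b))"
    by (intro integrable_mult_right integrable_norm_powr_ball b)
  have "AE x in lborel. x \<noteq> (0::'a)" by (rule AE_lborel_singleton)
  then show "AE x in lborel. norm (F x) \<le> norm (C * (indicator (ball 0 R) x * norm x powr b))"
  proof eventually_elim
    case (elim x)
    show ?case
      using supp[of x] order_trans[OF bd[OF elim] abs_ge_self] by (cases "norm x < R") (auto simp: indicator_def)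
  qed
qed measurable

lemma GDERIV_norm_square:
  "GDERIV (\<lambda>x::'a::euclidean_space. (norm x)\<^sup>2 + e) x :> 2 *\<^sub>R x"
  unfolding gderiv_def power2_norm_eq_inner
  by (auto intro!: derivative_eq_intros simp: inner_commute)

text \<open>Integration by parts against the field \<open>x / |x|\<^sup>2\<close>, whose divergence is \<open>(N - 2) / |x|\<^sup>2\<close>; the
  singularity is removed by replacing \<open>|x|\<^sup>2\<close> with \<open>|x|\<^sup>2 + \<epsilon>\<close>.\<close>

lemma C1c_integral_radial_div:
  fixes h :: "'a::euclidean_space \<Rightarrow> real"
  assumes N: "3 \<le> DIM('a)" and h: "C1c h h'"
  shows "integrable lborel (\<lambda>x. h x / (norm x)\<^sup>2)" "integrable lborel (\<lambda>x. (h' x \<bullet> x) / (norm x)\<^sup>2)"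
    "(\<integral>x. (h' x \<bullet> x) / (norm x)\<^sup>2 \<partial>lborel) = - (real DIM('a) - 2) * (\<integral>x. h x / (norm x)\<^sup>2 \<partial>lborel)"
proof -
  obtain B R where R: "0 < R" and B: "0 \<le> B" "\<And>x. \<bar>h x\<bar> \<le> B" "\<And>x. norm (h' x) \<le> B"
    and supp: "\<And>x. R \<le> norm x \<Longrightarrow> h x = 0" "\<And>x. R \<le> norm x \<Longrightarrow> h' x = 0"
    using C1c_bounded[OF h] by metis
  note [measurable] = C1c_measurable[OF h]
  show i1: "integrable lborel (\<lambda>x. h x / (norm x)\<^sup>2)"
  proof (rule integrable_norm_powr_dominated[where b="-2" and R=R and C=B])
    show "norm (h x / (norm x)\<^sup>2) \<le> B * norm x powr - 2" if "x \<noteq> 0" for x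
      using B(2)[of x] that by (simp add: powr_minus divide_inverse abs_mult mult_right_mono)
  qed (use N supp in auto)
  have n1: "\<bar>h' x \<bullet> x\<bar> \<le> B * norm x" for x
    using order_trans[OF Cauchy_Schwarz_ineq2 mult_right_mono[OF B(3) norm_ge_zero]] .
  show i2: "integrable lborel (\<lambda>x. (h' x \<bullet> x) / (norm x)\<^sup>2)"
  proof (rule integrable_norm_powr_dominated[where b="-1" and R=R and C=B])
    show "norm ((h' x \<bullet> x) / (norm x)\<^sup>2) \<le> B * norm x powr - 1" if "x \<noteq> 0" for x
      using n1[of x] that by (simp add: powr_minus field_simps power2_eq_square)
  qed (use N supp in auto)
  define N where "N = real DIM('a)"
  \<comment> \<open>The divergence of the regularised field h(x) x / (|x|^2 + e), written
    out.\<close>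
  define q where "q e x = (h' x \<bullet> x) / ((norm x)\<^sup>2 + e) + h x * (N / ((norm x)\<^sup>2 + e) - 2 * (norm x)\<^sup>2 / ((norm x)\<^sup>2 + e)\<^sup>2)" for e x
  have [measurable]: "q e \<in> borel_measurable borel" for e
    unfolding q_def by measurable
  have q0: "(\<integral>x. q e x \<partial>lborel) = 0" if e: "0 < e" for e
  proof -
    define s where "s x = (norm x)\<^sup>2 + e" for x :: 'a
    have s: "0 < s x" for x using e by (simp add: s_def add_nonneg_pos)
    have cs: "continuous_on UNIV s" unfolding s_def by (intro continuous_intros)
    \<comment> \<open>The gradient of (x . b) / s. The divergence is the sum over b of the
      b-components of the product gradients, each of which integrates to 0.\<close>
    define w' where "w' b x = (1 / s x) *\<^sub>R b - ((2 * (x \<bullet> b)) / (s x)\<^sup>2) *\<^sub>R x" for b x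
    have w: "C1c (\<lambda>x. ((x \<bullet> b) / s x) * h x) (\<lambda>x. ((x \<bullet> b) / s x) *\<^sub>R h' x + h x *\<^sub>R w' b x)" for b
    proof (rule C1c_mult[OF _ _ h])
      fix x
      have "(s has_derivative (\<lambda>v. 2 * (v \<bullet> x))) (at x)"
        using GDERIV_norm_square[of e x] unfolding gderiv_def s_def by simp
      then show "GDERIV (\<lambda>x. (x \<bullet> b) / s x) x :> w' b x"
        unfolding gderiv_def w'_def using s[of x]
        by (auto intro!: derivative_eq_intros simp: fun_eq_iff inner_diff_right field_simps power2_eq_square)
      show "continuous_on UNIV (w' b)"
        unfolding w'_def using s by (intro continuous_intros cs) (auto simp: less_imp_neq[symmetric])
    qed
    have "q e x = (\<Sum>b\<in>Basis. (((x \<bullet> b) / s x) *\<^sub>R h' x + h x *\<^sub>R w' b x) \<bullet> b)" for x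
    proof -
      have "(\<Sum>b\<in>Basis. (((x \<bullet> b) / s x) *\<^sub>R h' x + h x *\<^sub>R w' b x) \<bullet> b)
        = (\<Sum>b\<in>Basis. (h' x \<bullet> b) * (x \<bullet> b) / s x + h x * (1 / s x - 2 * ((x \<bullet> b) * (x \<bullet> b)) / (s x)\<^sup>2))"
        by (intro sum.cong) (auto simp: w'_def inner_add_left inner_diff_left mult_ac)
      also have "\<dots> = (h' x \<bullet> x) / s x + h x * (N / s x - 2 * (x \<bullet> x) / (s x)\<^sup>2)"
        by (simp add: sum.distrib sum_subtractf sum_divide_distrib[symmetric] sum_distrib_left[symmetric] N_def
            euclidean_inner[of "h' x" x] euclidean_inner[of x x])
      finally show ?thesis by (simp add: q_def s_def power2_norm_eq_inner)
    qed
    then have "(\<integral>x. q e x \<partial>lborel) = (\<Sum>b\<in>Basis. (\<integral>x. (((x \<bullet> b) / s x) *\<^sub>R h' x + h x *\<^sub>R w' b x) \<partial>lborel) \<bullet> b)"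
      using C1c_integrable(2)[OF w] by (simp add: integral_inner_left integral_sum integrable_inner_left)
    also have "\<dots> = 0"
      by (simp add: C1c_integral_grad[OF w])
    finally show ?thesis .
  qed
  let ?l = "\<lambda>x. (h' x \<bullet> x) / (norm x)\<^sup>2 + (N - 2) * (h x / (norm x)\<^sup>2)"
  have "(\<lambda>n. \<integral>x. q (inverse (real (Suc n))) x \<partial>lborel) \<longlonglongrightarrow> (\<integral>x. ?l x \<partial>lborel)"
  proof (rule integral_dominated_convergence)
    show "integrable lborel (\<lambda>x. \<bar>(h' x \<bullet> x) / (norm x)\<^sup>2\<bar> + (N + 2) * \<bar>h x / (norm x)\<^sup>2\<bar>)"
      using i1 i2 by (intro Bochner_Integration.integrable_add integrable_mult_right integrable_abs)
    have "AE x in lborel. x \<noteq> (0::'a)" by (rule AE_lborel_singleton)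
    then show "AE x in lborel. (\<lambda>n. q (inverse (real (Suc n))) x) \<longlonglongrightarrow> ?l x"
    proof eventually_elim
      case (elim x)
      have "(\<lambda>n. (norm x)\<^sup>2 + inverse (real (Suc n))) \<longlonglongrightarrow> (norm x)\<^sup>2 + 0"
        by (intro tendsto_intros LIMSEQ_inverse_real_of_nat)
      then have l: "(\<lambda>n. (norm x)\<^sup>2 + inverse (real (Suc n))) \<longlonglongrightarrow> (norm x)\<^sup>2" by simp
      have "(\<lambda>n. q (inverse (real (Suc n))) x) \<longlonglongrightarrow> (h' x \<bullet> x) / (norm x)\<^sup>2 + h x * (N / (norm x)\<^sup>2 - 2 * (norm x)\<^sup>2 / ((norm x)\<^sup>2)\<^sup>2)"
        unfolding q_def by (intro tendsto_intros l) (use elim in auto)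
      also have "(h' x \<bullet> x) / (norm x)\<^sup>2 + h x * (N / (norm x)\<^sup>2 - 2 * (norm x)\<^sup>2 / ((norm x)\<^sup>2)\<^sup>2) = ?l x"
        using elim by (simp add: power2_eq_square field_simps)
      finally show ?case .
    qed
    show "AE x in lborel. norm (q (inverse (real (Suc n))) x) \<le> \<bar>(h' x \<bullet> x) / (norm x)\<^sup>2\<bar> + (N + 2) * \<bar>h x / (norm x)\<^sup>2\<bar>" for n
      using \<open>AE x in lborel. x \<noteq> (0::'a)\<close>
    proof eventually_elim
      case (elim x)
      \<comment> \<open>Since p <= s, the two parts of the divergence factor are at most N / p and 2
        p / s^2 <= 2 / p; this is the source of N + 2 in the dominating function.\<close>
      define p where "p = (norm x)\<^sup>2"
      define s where "s = p + inverse (real (Suc n))"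
      have p: "0 < p" "p \<le> s" using elim by (auto simp: p_def s_def)
      have "\<bar>(h' x \<bullet> x) / s\<bar> \<le> \<bar>(h' x \<bullet> x) / p\<bar>"
        unfolding abs_divide using p by (intro divide_left_mono) auto
      moreover have "\<bar>h x * (N / s - 2 * p / s\<^sup>2)\<bar> \<le> (N + 2) * \<bar>h x / p\<bar>"
      proof -
        have "N / s \<le> N / p" "0 \<le> N / s" using p by (auto simp: N_def intro!: divide_left_mono)
        moreover have "p / s * (1 / s) \<le> 1 * (1 / p)"
          using p by (intro mult_mono divide_left_mono) (auto simp: divide_le_eq_1)
        then have "2 * p / s\<^sup>2 \<le> 2 / p" by (simp add: power2_eq_square)
        moreover have "0 \<le> 2 * p / s\<^sup>2" using p by simp
        ultimately have "\<bar>N / s - 2 * p / s\<^sup>2\<bar> \<le> N / p + 2 / p" by linarith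
        then have "\<bar>h x\<bar> * \<bar>N / s - 2 * p / s\<^sup>2\<bar> \<le> \<bar>h x\<bar> * (N / p + 2 / p)"
          by (intro mult_left_mono) auto
        also have "\<dots> = (N + 2) * \<bar>h x / p\<bar>"
          using p by (simp add: abs_divide field_simps)
        finally show ?thesis by (simp add: abs_mult)
      qed
      ultimately show ?case
        unfolding q_def p_def[symmetric] s_def[symmetric] real_norm_def by linarith
    qed
  qed auto
  moreover have "(\<integral>x. q (inverse (real (Suc n))) x \<partial>lborel) = 0" for n
    by (rule q0) simp
  ultimately have "(\<integral>x. ?l x \<partial>lborel) = 0"
    by (simp add: LIMSEQ_const_iff)
  then show "(\<integral>x. (h' x \<bullet> x) / (norm x)\<^sup>2 \<partial>lborel) = - (real DIM('a) - 2) * (\<integral>x. h x / (norm x)\<^sup>2 \<partial>lborel)"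
    unfolding Bochner_Integration.integral_add[OF i2 integrable_mult_right[OF i1]] integral_mult_right_zero
      minus_mult_left[symmetric] eq_neg_iff_add_eq_0 by (simp only: N_def)
qed

text \<open>The gradient of |x|^g is g |x|^(g - 2) x, which is unbounded at the origin for g < 1, as
  happens with g = 1/2 in dimension 3. The identity is therefore the limit of the one for (|x|^2 +
  1/(n+1))^(g/2).\<close>

lemma C1c_integral_norm_powr:
  fixes h :: "'a::euclidean_space \<Rightarrow> real"
  assumes g: "0 < g" and N: "2 \<le> DIM('a)" and h: "C1c h h'"
  shows "(\<integral>x. norm x powr g *\<^sub>R h' x \<partial>lborel) = - (\<integral>x. h x *\<^sub>R ((g * norm x powr (g - 2)) *\<^sub>R x) \<partial>lborel)"
proof -
  obtain B R where R: "0 < R" and B: "0 \<le> B" "\<And>x. \<bar>h x\<bar> \<le> B" "\<And>x. norm (h' x) \<le> B"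
    and supp: "\<And>x. R \<le> norm x \<Longrightarrow> h x = 0" "\<And>x. R \<le> norm x \<Longrightarrow> h' x = 0"
    using C1c_bounded[OF h] by metis
  note [measurable] = C1c_measurable[OF h]
  \<comment> \<open>An upper bound on the ball of radius R for all the regularised squares, whose
    shift is at most 1.\<close>
  define K where "K = R\<^sup>2 + 1"
  define D1 where "D1 x = B * K powr (g / 2) * (indicator (ball 0 R) x * norm x powr 0)" for x :: 'a
  \<comment> \<open>Two summands because the exponent (g - 1) / 2 changes sign at g = 1: below, the
    regularised power is bounded by its limit, above by its value at \<open>K\<close>. The factor
    \<open>norm x powr 0\<close> is 1 away from the origin, so that the same integrability lemma
    covers both.\<close>
  define D2 where "D2 x = B * g * (indicator (ball 0 R) x * norm x powr (g - 1) + K powr ((g - 1) / 2) * (indicator (ball 0 R) x * norm x powr 0))" for x :: 'a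
  have D: "integrable lborel D1" "integrable lborel D2"
    unfolding D1_def D2_def using g N
    by (intro integrable_mult_right Bochner_Integration.integrable_add integrable_norm_powr_ball; simp)+
  define s where "s n x = (norm x)\<^sup>2 + inverse (real (Suc n))" for n and x :: 'a
  have s: "0 < s n x" for n x by (simp add: s_def add_nonneg_pos)
  have cs: "continuous_on UNIV (s n)" for n unfolding s_def by (intro continuous_intros)
  have [measurable]: "s n \<in> borel_measurable borel" for n unfolding s_def by measurable
  have w: "C1c (\<lambda>x. s n x powr (g / 2) * h x) (\<lambda>x. s n x powr (g / 2) *\<^sub>R h' x + h x *\<^sub>R ((g * s n x powr (g / 2 - 1)) *\<^sub>R x))" for n
  proof (rule C1c_mult[OF _ _ h])
    fix x
    have "GDERIV (s n) x :> 2 *\<^sub>R x"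
      unfolding s_def by (rule GDERIV_norm_square)
    from GDERIV_DERIV_compose[OF this has_real_derivative_powr[OF s, where r="g / 2"]]
    show "GDERIV (\<lambda>x. s n x powr (g / 2)) x :> (g * s n x powr (g / 2 - 1)) *\<^sub>R x"
      by simp
    show "continuous_on UNIV (\<lambda>x. (g * s n x powr (g / 2 - 1)) *\<^sub>R x)"
      using s by (intro continuous_intros cs) (auto simp: less_imp_neq[symmetric])
  qed
  have AE0: "AE x in lborel. x \<noteq> (0::'a)" by (rule AE_lborel_singleton)
  have slim: "(\<lambda>n. s n x powr p) \<longlonglongrightarrow> norm x powr (2 * p)" if "x \<noteq> 0" for x and p :: real
  proof -
    have "(\<lambda>n. (norm x)\<^sup>2 + inverse (real (Suc n))) \<longlonglongrightarrow> (norm x)\<^sup>2 + 0"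
      by (intro tendsto_intros LIMSEQ_inverse_real_of_nat)
    then have "(\<lambda>n. s n x powr p) \<longlonglongrightarrow> ((norm x)\<^sup>2) powr p"
      unfolding s_def using that by (intro tendsto_intros) auto
    moreover have "((norm x)\<^sup>2) powr p = norm x powr (2 * p)"
      using powr_powr[of "norm x" 2 p] that by simp
    ultimately show ?thesis by simp
  qed
  have sK: "s n x \<le> K" if "norm x < R" for n x
  proof -
    have "inverse (real (Suc n)) \<le> 1" by (simp add: field_simps)
    moreover have "(norm x)\<^sup>2 \<le> R\<^sup>2" using that by (intro power_mono) auto
    ultimately show ?thesis by (simp add: s_def K_def)
  qed
  have b1: "norm (s n x powr (g / 2) *\<^sub>R h' x) \<le> D1 x" if "x \<noteq> 0" for n x
  proof (cases "norm x < R")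
    case True
    have "s n x powr (g / 2) * norm (h' x) \<le> K powr (g / 2) * B"
      using B s[of n x] sK[OF True] g by (intro mult_mono powr_mono2) (auto intro: less_imp_le)
    then show ?thesis using True that by (simp add: D1_def mult.commute)
  qed (use supp in \<open>simp add: D1_def\<close>)
  have b2: "norm (h x *\<^sub>R ((g * s n x powr (g / 2 - 1)) *\<^sub>R x)) \<le> D2 x" if "x \<noteq> 0" for n x
  proof (cases "norm x < R")
    case True
    have n: "norm x \<le> s n x powr (1 / 2)" "(norm x)\<^sup>2 \<le> s n x"
      using real_sqrt_le_mono[of "(norm x)\<^sup>2" "s n x"] s[of n x] by (auto simp: s_def powr_half_sqrt)
    have "s n x powr (g / 2 - 1) * norm x \<le> s n x powr (g / 2 - 1) * s n x powr (1 / 2)"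
      by (intro mult_left_mono n) simp
    also have "\<dots> = s n x powr ((g - 1) / 2)"
      unfolding powr_add[symmetric] by (rule arg_cong[where f="(powr) (s n x)"]) (simp add: field_simps)
    also have "\<dots> \<le> norm x powr (g - 1) + K powr ((g - 1) / 2)"
    proof (cases "g \<le> 1")
      case True
      have "s n x powr ((g - 1) / 2) \<le> ((norm x)\<^sup>2) powr ((g - 1) / 2)"
        using True n that by (intro powr_mono2') auto
      also have "\<dots> = norm x powr (g - 1)"
        using powr_powr[of "norm x" 2 "(g - 1) / 2"] that by (simp add: diff_divide_distrib)
      finally show ?thesis by (simp add: add_increasing2)
    next
      case False
      have "s n x powr ((g - 1) / 2) \<le> K powr ((g - 1) / 2)"
        using False sK[OF True] s[of n x] by (intro powr_mono2) (auto intro: less_imp_le)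
      then show ?thesis by (simp add: add_increasing)
    qed
    finally have "(\<bar>h x\<bar> * g) * (s n x powr (g / 2 - 1) * norm x) \<le> (B * g) * (norm x powr (g - 1) + K powr ((g - 1) / 2))"
      using B g by (intro mult_mono) (auto intro!: mult_nonneg_nonneg add_nonneg_nonneg)
    moreover have "norm (h x *\<^sub>R ((g * s n x powr (g / 2 - 1)) *\<^sub>R x)) = (\<bar>h x\<bar> * g) * (s n x powr (g / 2 - 1) * norm x)"
      using g by (simp add: abs_mult)
    moreover have "D2 x = (B * g) * (norm x powr (g - 1) + K powr ((g - 1) / 2))"
      using True that by (simp add: D2_def)
    ultimately show ?thesis by (simp only:)
  qed (use supp in \<open>simp add: D2_def\<close>)
  have "(\<lambda>n. \<integral>x. s n x powr (g / 2) *\<^sub>R h' x \<partial>lborel) \<longlonglongrightarrow> (\<integral>x. norm x powr g *\<^sub>R h' x \<partial>lborel)"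
  proof (rule integral_dominated_convergence[OF _ _ D(1)])
    show "AE x in lborel. (\<lambda>n. s n x powr (g / 2) *\<^sub>R h' x) \<longlonglongrightarrow> norm x powr g *\<^sub>R h' x"
      using AE0
    proof eventually_elim
      case (elim x)
      show ?case
        using tendsto_scaleR[OF slim[OF elim, of "g / 2"] tendsto_const[of "h' x"]] by simp
    qed
    show "AE x in lborel. norm (s n x powr (g / 2) *\<^sub>R h' x) \<le> D1 x" for n
      using AE0 by eventually_elim (rule b1)
  qed auto
  moreover have "(\<lambda>n. \<integral>x. h x *\<^sub>R ((g * s n x powr (g / 2 - 1)) *\<^sub>R x) \<partial>lborel) \<longlonglongrightarrow> (\<integral>x. h x *\<^sub>R ((g * norm x powr (g - 2)) *\<^sub>R x) \<partial>lborel)"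
  proof (rule integral_dominated_convergence[OF _ _ D(2)])
    show "AE x in lborel. (\<lambda>n. h x *\<^sub>R ((g * s n x powr (g / 2 - 1)) *\<^sub>R x)) \<longlonglongrightarrow> h x *\<^sub>R ((g * norm x powr (g - 2)) *\<^sub>R x)"
      using AE0
    proof eventually_elim
      case (elim x)
      have "(\<lambda>n. s n x powr (g / 2 - 1)) \<longlonglongrightarrow> norm x powr (g - 2)"
        using slim[OF elim, of "g / 2 - 1"] by (simp add: algebra_simps)
      then show ?case by (intro tendsto_scaleR tendsto_mult tendsto_const)
    qed
    show "AE x in lborel. norm (h x *\<^sub>R ((g * s n x powr (g / 2 - 1)) *\<^sub>R x)) \<le> D2 x" for n
      using AE0 by eventually_elim (rule b2)
  qed auto
  moreover have "(\<integral>x. s n x powr (g / 2) *\<^sub>R h' x \<partial>lborel) = - (\<integral>x. h x *\<^sub>R ((g * s n x powr (g / 2 - 1)) *\<^sub>R x) \<partial>lborel)" for n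
  proof -
    have "integrable lborel (\<lambda>x. s n x powr (g / 2) *\<^sub>R h' x)"
      by (rule Bochner_Integration.integrable_bound[OF D(1)])
         (use AE0 b1 in \<open>auto intro: order_trans[OF _ abs_ge_self]\<close>)
    moreover have "integrable lborel (\<lambda>x. h x *\<^sub>R ((g * s n x powr (g / 2 - 1)) *\<^sub>R x))"
      by (rule Bochner_Integration.integrable_bound[OF D(2)])
         (use AE0 b2 in \<open>auto intro: order_trans[OF _ abs_ge_self]\<close>)
    ultimately show ?thesis
      using C1c_integral_grad[OF w[of n]] by (simp add: eq_neg_iff_add_eq_0)
  qed
  ultimately have "(\<lambda>n. - (\<integral>x. h x *\<^sub>R ((g * s n x powr (g / 2 - 1)) *\<^sub>R x) \<partial>lborel)) \<longlonglongrightarrow> (\<integral>x. norm x powr g *\<^sub>R h' x \<partial>lborel)"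
    "(\<lambda>n. - (\<integral>x. h x *\<^sub>R ((g * s n x powr (g / 2 - 1)) *\<^sub>R x) \<partial>lborel)) \<longlonglongrightarrow> - (\<integral>x. h x *\<^sub>R ((g * norm x powr (g - 2)) *\<^sub>R x) \<partial>lborel)"
    by (simp, intro tendsto_minus)
  then show ?thesis by (rule LIMSEQ_unique)
qed

text \<open>The radial identity is applied to h = f^2, whose gradient is 2 f f'. It expresses the
  Hardy integral A as a pairing of f / |x| with the radial derivative; Cauchy-Schwarz on that
  pairing gives c^2 A^2 <= A times the Dirichlet integral, and A cancels unless it is 0.\<close>

lemma C1c_sq_integrable_hardy:
  fixes f :: "'a::euclidean_space \<Rightarrow> real"
  assumes N: "3 \<le> DIM('a)" and f: "C1c f f'"
  shows "sq_integrable lborel f'" "sq_integrable lborel (\<lambda>x. f x / norm x)"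
    "(\<integral>x. (f x / norm x) * (f' x \<bullet> (x /\<^sub>R norm x)) \<partial>lborel) = - ((real DIM('a) - 2) / 2) * (\<integral>x. (f x / norm x)\<^sup>2 \<partial>lborel)"
    "((real DIM('a) - 2) / 2)\<^sup>2 * (\<integral>x. (f x / norm x)\<^sup>2 \<partial>lborel) \<le> (\<integral>x. (norm (f' x))\<^sup>2 \<partial>lborel)"
proof -
  note [measurable] = C1c_measurable[OF f]
  have f2: "C1c (\<lambda>x. f x * f x) (\<lambda>x. f x *\<^sub>R f' x + f x *\<^sub>R f' x)"
    by (rule C1c_mult[OF _ _ f]) (use C1cD[OF f] in auto)
  note r = C1c_integral_radial_div[OF N f2]
  have "integrable lborel (\<lambda>x. (norm (f' x))\<^sup>2)"
  proof -
    obtain B R where "\<And>x. R \<le> norm x \<Longrightarrow> f' x = 0" using C1c_bounded[OF f] by metis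
    then show ?thesis
      by (intro integrable_compact_support[where R=R] continuous_intros C1cD(3)[OF f]) auto
  qed
  then show V: "sq_integrable lborel f'" by (simp add: sq_integrable_def)
  show U: "sq_integrable lborel (\<lambda>x. f x / norm x)"
    using r(1) by (simp add: sq_integrable_def power_divide power2_eq_square[of "f _"])
  have W: "sq_integrable lborel (\<lambda>x. f' x \<bullet> (x /\<^sub>R norm x))" and W2: "\<And>x. (f' x \<bullet> (x /\<^sub>R norm x))\<^sup>2 \<le> (norm (f' x))\<^sup>2"
  proof -
    have *: "\<bar>f' x \<bullet> (x /\<^sub>R norm x)\<bar> \<le> 1 * norm (f' x)" for x
      using Cauchy_Schwarz_ineq2[of "f' x" "x /\<^sub>R norm x"] by (cases "x = 0") auto
    then show "sq_integrable lborel (\<lambda>x. f' x \<bullet> (x /\<^sub>R norm x))"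
      by (intro sq_integrable_bound[OF V, where C=1]) auto
    show "(f' x \<bullet> (x /\<^sub>R norm x))\<^sup>2 \<le> (norm (f' x))\<^sup>2" for x
      using power_mono[OF *[of x], of 2] by simp
  qed
  have "(\<integral>x. (f x / norm x) * (f' x \<bullet> (x /\<^sub>R norm x)) \<partial>lborel) = (\<integral>x. (1 / 2) * (((f x *\<^sub>R f' x + f x *\<^sub>R f' x) \<bullet> x) / (norm x)\<^sup>2) \<partial>lborel)"
    by (intro Bochner_Integration.integral_cong) (auto simp: inner_add_left power2_eq_square field_simps)
  also have "\<dots> = (1 / 2) * (- (real DIM('a) - 2) * (\<integral>x. f x * f x / (norm x)\<^sup>2 \<partial>lborel))"
    unfolding integral_mult_right_zero r(3) ..
  finally show eq: "(\<integral>x. (f x / norm x) * (f' x \<bullet> (x /\<^sub>R norm x)) \<partial>lborel) = - ((real DIM('a) - 2) / 2) * (\<integral>x. (f x / norm x)\<^sup>2 \<partial>lborel)"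
    by (simp add: power_divide power2_eq_square[of "f _"] field_simps)
  let ?A = "\<integral>x. (f x / norm x)\<^sup>2 \<partial>lborel" and ?c = "(real DIM('a) - 2) / 2"
  have A: "0 \<le> ?A" by simp
  have "(\<integral>x. (f x / norm x) \<bullet> (f' x \<bullet> (x /\<^sub>R norm x)) \<partial>lborel)\<^sup>2 \<le> (\<integral>x. (norm (f x / norm x))\<^sup>2 \<partial>lborel) * (\<integral>x. (norm (f' x \<bullet> (x /\<^sub>R norm x)))\<^sup>2 \<partial>lborel)"
    by (rule L2_Cauchy_Schwarz[OF U W])
  then have "(- ?c * ?A)\<^sup>2 \<le> ?A * (\<integral>x. (f' x \<bullet> (x /\<^sub>R norm x))\<^sup>2 \<partial>lborel)"
    unfolding inner_real_def eq real_norm_def power2_abs .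
  also have "\<dots> \<le> ?A * (\<integral>x. (norm (f' x))\<^sup>2 \<partial>lborel)"
    using sq_integrableD[OF W] sq_integrableD[OF V] W2 by (intro mult_left_mono integral_mono A) auto
  finally have *: "?A * (?c\<^sup>2 * ?A) \<le> ?A * (\<integral>x. (norm (f' x))\<^sup>2 \<partial>lborel)"
    by (simp add: power2_eq_square mult_ac)
  show "?c\<^sup>2 * ?A \<le> (\<integral>x. (norm (f' x))\<^sup>2 \<partial>lborel)"
  proof (cases "?A = 0")
    case True then show ?thesis by (simp only: mult_zero_right) simp
  next
    case False then show ?thesis using * A by (simp only: mult_le_cancel_left)
  qed
qed

subsection \<open>Uniqueness of weak gradients\<close>

text \<open>A way to prove smoothness without computing iterated derivatives: membership in a family
  that is stable under partial derivatives is an invariant for the induction on k.\<close>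

lemma Ck_of_closed_family:
  fixes S :: "('a::euclidean_space \<Rightarrow> real) set"
  assumes S: "\<And>f. f \<in> S \<Longrightarrow> \<exists>D. (\<forall>x. (f has_derivative D x) (at x)) \<and> (\<forall>b\<in>Basis. (\<lambda>x. D x b) \<in> S)"
  shows "f \<in> S \<Longrightarrow> Ck k f"
proof (induction k arbitrary: f)
  case 0
  then obtain D where "\<forall>x. (f has_derivative D x) (at x)" using S by blast
  then show ?case
    by (auto intro!: has_derivative_continuous_on intro: has_derivative_at_withinI)
next
  case (Suc k)
  then obtain D where D: "\<And>x. (f has_derivative D x) (at x)" "\<And>b. b \<in> Basis \<Longrightarrow> (\<lambda>x. D x b) \<in> S" using S by blast
  have "frechet_derivative f (at x) = D x" for x
    using frechet_derivative_at[OF D(1)] by simp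
  then show ?case
    using D Suc.IH by (auto simp: differentiable_def)
qed

text \<open>A family of functions on the line, closed under differentiation, that contains the bumps
  \<open>exp (- m / ((t - a) * (c - t)))\<close> on \<open>{a<..<c}\<close>. As \<open>m\<close> tends to \<open>0\<close> these increase to the
  indicator of the interval.\<close>

definition bump_fun :: "real \<Rightarrow> real \<Rightarrow> real \<Rightarrow> real poly \<Rightarrow> nat \<Rightarrow> real \<Rightarrow> real" where
  "bump_fun a c m p k t = (if a < t \<and> t < c then poly p t * (inverse ((t - a) * (c - t)) ^ k * exp (- m * inverse ((t - a) * (c - t)))) else 0)"

text \<open>A single term of the exponential series already gives (m u)^k / k! <= exp (m u). So no
  power of the reciprocal can compete with the exponential at the ends of the interval.\<close>

lemma power_mult_exp_neg_bounded:
  fixes m :: real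
  assumes m: "0 < m"
  shows "\<exists>C\<ge>0. \<forall>u\<ge>0. u ^ k * exp (- m * u) \<le> C"
proof -
  have "u ^ k * exp (- m * u) \<le> fact k / m ^ k" if "u \<ge> 0" for u
  proof -
    have "(m * u) ^ k / fact k \<le> exp (m * u)"
      using sum_le_suminf[OF summable_exp_generic[of "m * u"], of "{k}"] that m
      by (simp add: exp_def divide_inverse mult.commute)
    then show ?thesis using m by (simp add: exp_minus field_simps power_mult_distrib)
  qed
  then show ?thesis using m by (intro exI[of _ "fact k / m ^ k"]) auto
qed

text \<open>With w = (t - a) (c - t), differentiating 1 / w costs two powers of the reciprocal,
  hence \<open>k + 2\<close>. At points outside the open interval the function is quadratically
  small, so the derivative exists and is 0, in agreement with the same formula.\<close>

lemma bump_fun_has_derivative: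
  assumes m: "0 < m"
  shows "\<exists>q. \<forall>t. (bump_fun a c m p k has_real_derivative bump_fun a c m q (k + 2) t) (at t)"
proof -
  define w where "w = [:-a, 1:] * [:c, -1:]"
  have w: "poly w t = (t - a) * (c - t)" for t by (simp add: w_def algebra_simps)
  \<comment> \<open>The derivative of p w^(-k) exp (-m / w) multiplied by w^(k + 2) exp (m / w), so
    that all terms share one denominator.\<close>
  define q where "q = pderiv p * w ^ 2 - smult (of_nat k) (p * w * pderiv w) + smult m (p * pderiv w)"
  have inside: "(bump_fun a c m p k has_real_derivative bump_fun a c m q (k + 2) t) (at t)" if t: "a < t" "t < c" for t
  proof -
    have wt: "poly w t > 0" using t by (simp add: w)
    define i where "i = inverse (poly w t)"
    have iw: "poly w t * i = 1" using wt by (simp add: i_def)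
    have "((\<lambda>t. poly p t * (inverse (poly w t) ^ k * exp (- m * inverse (poly w t)))) has_real_derivative
      poly (pderiv p) t * (i ^ k * exp (- m * i)) + poly p t *
       (real k * i ^ (k - 1) * (- (i * poly (pderiv w) t * i)) * exp (- m * i) + i ^ k * (exp (- m * i) * (m * (i * poly (pderiv w) t * i))))) (at t)"
      unfolding i_def using wt
      by (auto intro!: derivative_eq_intros simp: algebra_simps)
    also have "poly (pderiv p) t * (i ^ k * exp (- m * i)) + poly p t *
       (real k * i ^ (k - 1) * (- (i * poly (pderiv w) t * i)) * exp (- m * i) + i ^ k * (exp (- m * i) * (m * (i * poly (pderiv w) t * i))))
      = poly q t * (i ^ (k + 2) * exp (- m * i))"
    proof -
      have k: "real k * i ^ (k - 1) * i = real k * i ^ k" by (cases k) auto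
      have "poly q t * i ^ (k + 2) = poly (pderiv p) t * (poly w t * i)\<^sup>2 * i ^ k - (real k * i ^ k) * poly p t * (poly w t * i) * poly (pderiv w) t * i
         + m * poly p t * poly (pderiv w) t * i * i * i ^ k"
        by (simp add: q_def power2_eq_square algebra_simps)
      then have "poly q t * i ^ (k + 2) = poly (pderiv p) t * i ^ k - (real k * i ^ (k - 1) * i) * poly p t * poly (pderiv w) t * i
         + m * poly p t * poly (pderiv w) t * i * i * i ^ k"
        unfolding iw k by simp
      then have "(poly q t * i ^ (k + 2)) * exp (- m * i) = (poly (pderiv p) t * i ^ k - (real k * i ^ (k - 1) * i) * poly p t * poly (pderiv w) t * i
         + m * poly p t * poly (pderiv w) t * i * i * i ^ k) * exp (- m * i)" by simp
      then show ?thesis by (simp add: algebra_simps)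
    qed
    also have "poly q t * (i ^ (k + 2) * exp (- m * i)) = bump_fun a c m q (k + 2) t"
      using t by (simp add: bump_fun_def i_def w)
    finally have "((\<lambda>t. poly p t * (inverse (poly w t) ^ k * exp (- m * inverse (poly w t)))) has_real_derivative bump_fun a c m q (k + 2) t) (at t)" .
    then show ?thesis
      by (rule has_field_derivative_transform_within_open[where S="{a<..<c}"]) (use t in \<open>auto simp: bump_fun_def w\<close>)
  qed
  have outside: "(bump_fun a c m p k has_real_derivative bump_fun a c m q (k + 2) t) (at t)" if t: "\<not> (a < t \<and> t < c)" for t
  proof -
    obtain C where C: "0 \<le> C" "\<And>u. u \<ge> 0 \<Longrightarrow> u ^ (k + 2) * exp (- m * u) \<le> C"
      using power_mult_exp_neg_bounded[OF m] by metis
    have "bounded (poly p ` {a..c})"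
      by (intro compact_imp_bounded compact_continuous_image continuous_intros) auto
    then obtain P where "\<forall>y\<in>poly p ` {a..c}. norm y \<le> P"
      unfolding bounded_iff by blast
    then have P: "\<bar>poly p s\<bar> \<le> P" if "s \<in> {a..c}" for s
      using that by simp
    \<comment> \<open>The constant in the quadratic bound: w^(-k) exp (-m / w) <= C w^2, and w <= |s
      - t| (c - a).\<close>
    define L where "L = \<bar>P\<bar> * C * (c - a)\<^sup>2"
    have quad: "\<bar>bump_fun a c m p k s\<bar> \<le> L * \<bar>s - t\<bar>\<^sup>2" for s
    proof (cases "a < s \<and> s < c")
      case True
      define v where "v = (s - a) * (c - s)"
      have v: "0 < v" using True by (simp add: v_def)
      \<comment> \<open>The point t lies at or beyond one end, so the factor of \<open>v\<close>
        vanishing at that end is at most |s - t|; the other factor is at most c - a.\<close>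
      have "v \<le> \<bar>s - t\<bar> * (c - a)"
      proof (cases "t \<le> a")
        case True
        then show ?thesis unfolding v_def using \<open>a < s \<and> s < c\<close> by (intro mult_mono) auto
      next
        case False
        then have "v \<le> (c - a) * \<bar>s - t\<bar>"
          unfolding v_def using t \<open>a < s \<and> s < c\<close> by (intro mult_mono) auto
        then show ?thesis by (simp add: mult.commute)
      qed
      then have v2: "v\<^sup>2 \<le> (\<bar>s - t\<bar> * (c - a))\<^sup>2" using v by (intro power_mono) auto
      have "inverse v ^ k * exp (- m * inverse v) = v\<^sup>2 * (inverse v ^ (k + 2) * exp (- m * inverse v))"
        using v by (simp add: power_add power2_eq_square field_simps)
      also have "\<dots> \<le> (\<bar>s - t\<bar> * (c - a))\<^sup>2 * C"
        using v by (intro mult_mono v2 C) auto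
      finally have le: "inverse v ^ k * exp (- m * inverse v) \<le> (\<bar>s - t\<bar> * (c - a))\<^sup>2 * C" .
      have "\<bar>poly p s\<bar> * (inverse v ^ k * exp (- m * inverse v)) \<le> \<bar>P\<bar> * ((\<bar>s - t\<bar> * (c - a))\<^sup>2 * C)"
        by (rule mult_mono[OF _ le]) (use P[of s] True v in auto)
      moreover have "\<bar>bump_fun a c m p k s\<bar> = \<bar>poly p s\<bar> * (inverse v ^ k * exp (- m * inverse v))"
        using True v unfolding bump_fun_def v_def[symmetric] by (simp add: abs_mult)
      ultimately show ?thesis
        by (simp add: L_def power_mult_distrib mult_ac)
    next
      case False
      then have "bump_fun a c m p k s = 0" by (simp only: bump_fun_def if_False)
      then show ?thesis using C(1) by (simp add: L_def)
    qed
    have "((\<lambda>h. (bump_fun a c m p k (t + h) - bump_fun a c m p k t) / h) \<longlongrightarrow> 0) (at 0)"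
    proof (rule tendsto_0_le[where K=L])
      show "((\<lambda>h. h) \<longlongrightarrow> 0) (at (0::real))" by (rule tendsto_ident_at)
      show "\<forall>\<^sub>F h in at 0. norm ((bump_fun a c m p k (t + h) - bump_fun a c m p k t) / h) \<le> norm h * L"
      proof (rule eventually_at_filter[THEN iffD2], intro always_eventually allI impI)
        fix h :: real assume "h \<noteq> 0"
        have "bump_fun a c m p k t = 0" using t by (auto simp: bump_fun_def)
        then show "norm ((bump_fun a c m p k (t + h) - bump_fun a c m p k t) / h) \<le> norm h * L"
          using quad[of "t + h"] \<open>h \<noteq> 0\<close> by (simp add: abs_divide divide_le_eq power2_eq_square abs_mult[symmetric] mult_ac)
      qed
    qed
    moreover have "bump_fun a c m q (k + 2) t = 0" using t by (auto simp: bump_fun_def)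
    ultimately show ?thesis by (simp add: DERIV_def)
  qed
  show ?thesis using inside outside by blast
qed

text \<open>Polynomials and exponents range freely over the coordinates so that the set is stable
  under partial derivatives: each variable occurs in one factor only, and a partial derivative is
  again a single product.\<close>

definition box_bumps :: "'a::euclidean_space \<Rightarrow> 'a \<Rightarrow> real \<Rightarrow> ('a \<Rightarrow> real) set" where
  "box_bumps l u m = {f. \<exists>P K. f = (\<lambda>x. \<Prod>b\<in>Basis. bump_fun (l \<bullet> b) (u \<bullet> b) m (P b) (K b) (x \<bullet> b))}"

lemma Ck_box_bumps:
  fixes l u :: "'a::euclidean_space"
  assumes m: "0 < m"
  shows "f \<in> box_bumps l u m \<Longrightarrow> Ck k f"
proof (rule Ck_of_closed_family[where S="box_bumps l u m"])
  fix f assume "f \<in> box_bumps l u m"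
  then obtain P K where f: "f = (\<lambda>x. \<Prod>b\<in>Basis. bump_fun (l \<bullet> b) (u \<bullet> b) m (P b) (K b) (x \<bullet> b))"
    unfolding box_bumps_def by blast
  let ?\<beta> = "\<lambda>P K b. bump_fun (l \<bullet> b) (u \<bullet> b) m (P b) (K b)"
  obtain Q where Q: "\<And>b t. (?\<beta> P K b has_real_derivative bump_fun (l \<bullet> b) (u \<bullet> b) m (Q b) (K b + 2) t) (at t)"
  proof -
    have "\<forall>b. \<exists>q. \<forall>t. (?\<beta> P K b has_real_derivative bump_fun (l \<bullet> b) (u \<bullet> b) m q (K b + 2) t) (at t)"
      using bump_fun_has_derivative[OF m] by blast
    from choice[OF this] show thesis using that by blast
  qed
  let ?D = "\<lambda>x h. \<Sum>b\<in>Basis. (h \<bullet> b) * bump_fun (l \<bullet> b) (u \<bullet> b) m (Q b) (K b + 2) (x \<bullet> b) * (\<Prod>j\<in>Basis - {b}. ?\<beta> P K j (x \<bullet> j))"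
  have "(f has_derivative ?D x) (at x)" for x
  proof -
    have "((\<lambda>x. ?\<beta> P K b (x \<bullet> b)) has_derivative (\<lambda>h. (h \<bullet> b) * bump_fun (l \<bullet> b) (u \<bullet> b) m (Q b) (K b + 2) (x \<bullet> b))) (at x)" for b
      by (rule DERIV_compose_FDERIV[OF Q]) (auto intro!: derivative_eq_intros)
    then show ?thesis
      unfolding f by (rule has_derivative_prod)
  qed
  moreover have "(\<lambda>x. ?D x b) \<in> box_bumps l u m" if b: "b \<in> Basis" for b
  proof -
    \<comment> \<open>Along the basis vector b all summands but one vanish, and only the factor with
      index b changes its polynomial and its exponent.\<close>
    have "?D x b = (\<Prod>j\<in>Basis. ?\<beta> (P(b := Q b)) (K(b := K b + 2)) j (x \<bullet> j))" for x
    proof -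
      have "?D x b = (\<Sum>j\<in>Basis. if j = b then bump_fun (l \<bullet> b) (u \<bullet> b) m (Q b) (K b + 2) (x \<bullet> b) * (\<Prod>j\<in>Basis - {b}. ?\<beta> P K j (x \<bullet> j)) else 0)"
        using b by (intro sum.cong) (auto simp: inner_Basis)
      also have "\<dots> = bump_fun (l \<bullet> b) (u \<bullet> b) m (Q b) (K b + 2) (x \<bullet> b) * (\<Prod>j\<in>Basis - {b}. ?\<beta> P K j (x \<bullet> j))"
        using b by simp
      also have "(\<Prod>j\<in>Basis - {b}. ?\<beta> P K j (x \<bullet> j)) = (\<Prod>j\<in>Basis - {b}. ?\<beta> (P(b := Q b)) (K(b := K b + 2)) j (x \<bullet> j))"
        by (intro prod.cong) auto
      also have "bump_fun (l \<bullet> b) (u \<bullet> b) m (Q b) (K b + 2) (x \<bullet> b) * \<dots> = (\<Prod>j\<in>Basis. ?\<beta> (P(b := Q b)) (K(b := K b + 2)) j (x \<bullet> j))"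
        using b by (subst (2) prod.remove[of _ b]) auto
      finally show ?thesis .
    qed
    then show ?thesis unfolding box_bumps_def by blast
  qed
  ultimately show "\<exists>D. (\<forall>x. (f has_derivative D x) (at x)) \<and> (\<forall>b\<in>Basis. (\<lambda>x. D x b) \<in> box_bumps l u m)"
    by (intro exI[of _ ?D]) blast
qed

definition box_bump :: "'a::euclidean_space \<Rightarrow> 'a \<Rightarrow> real \<Rightarrow> 'a \<Rightarrow> real" where
  "box_bump l u m x = (\<Prod>b\<in>Basis. bump_fun (l \<bullet> b) (u \<bullet> b) m 1 0 (x \<bullet> b))"

lemma box_bump_outside: "x \<notin> box l u \<Longrightarrow> box_bump l u m x = 0"
  by (auto simp: box_bump_def mem_box bump_fun_def)

lemma box_bump_inside:
  "x \<in> box l u \<Longrightarrow> box_bump l u m x = (\<Prod>b\<in>Basis. exp (- m * inverse ((x \<bullet> b - l \<bullet> b) * (u \<bullet> b - x \<bullet> b))))"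
  unfolding box_bump_def by (rule prod.cong) (auto simp: mem_box bump_fun_def)

lemma box_bump_bounds:
  assumes "0 < m"
  shows "0 \<le> box_bump l u m x" "box_bump l u m x \<le> indicator (box l u) x"
proof -
  have "x \<in> box l u \<Longrightarrow> box_bump l u m x \<le> 1"
    unfolding box_bump_inside using assms
    by (intro prod_le_1) (auto simp: mem_box less_imp_le)
  then show "box_bump l u m x \<le> indicator (box l u) x"
    using box_bump_outside[of x l u m] by (cases "x \<in> box l u") auto
  show "0 \<le> box_bump l u m x"
    unfolding box_bump_def by (intro prod_nonneg) (auto simp: bump_fun_def)
qed

lemma test_fun_box_bump:
  assumes "0 < m"
  shows "test_fun (box_bump l u m)"
  unfolding test_fun_def
proof
  have "box_bump l u m \<in> box_bumps l u m"
    unfolding box_bumps_def box_bump_def[abs_def] by (intro CollectI exI[of _ "\<lambda>_. 1"] exI[of _ "\<lambda>_. 0"]) simp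
  then show "\<forall>k. Ck k (box_bump l u m)"
    using Ck_box_bumps[OF assms] by blast
  have "{x. box_bump l u m x \<noteq> 0} \<subseteq> box l u"
    using box_bump_outside by blast
  then have "bounded {x. box_bump l u m x \<noteq> 0}"
    using bounded_box bounded_subset by blast
  then show "compact (closure {x. box_bump l u m x \<noteq> 0})"
    by (simp add: compact_closure)
qed

lemma box_bump_tendsto:
  "(\<lambda>n. box_bump l u (inverse (real (Suc n))) x) \<longlonglongrightarrow> indicator (box l u) x"
proof (cases "x \<in> box l u")
  case True
  have "(\<lambda>n. \<Prod>b\<in>Basis. exp (- inverse (real (Suc n)) * inverse ((x \<bullet> b - l \<bullet> b) * (u \<bullet> b - x \<bullet> b)))) \<longlonglongrightarrow>
    (\<Prod>b\<in>(Basis::'a set). exp (- 0 * inverse ((x \<bullet> b - l \<bullet> b) * (u \<bullet> b - x \<bullet> b))))"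
    by (intro tendsto_prod tendsto_exp tendsto_mult_right tendsto_minus LIMSEQ_inverse_real_of_nat)
  then show ?thesis using True by (simp add: box_bump_inside)
qed (simp add: box_bump_outside)

section \<open>The fundamental lemma of the calculus of variations\<close>

lemma loc_integrable_measurable:
  fixes u :: "'a::euclidean_space \<Rightarrow> 'b::euclidean_space"
  assumes "loc_integrable u"
  shows "u \<in> borel_measurable borel"
proof (rule borel_measurable_LIMSEQ_metric)
  show "(\<lambda>x. indicator (cball 0 (real n)) x *\<^sub>R u x) \<in> borel_measurable borel" for n
  proof -
    have "integrable lborel (\<lambda>x. indicator (cball 0 (real n)) x *\<^sub>R u x)"
      using assms unfolding loc_integrable_def set_integrable_def by simp
    from borel_measurable_integrable[OF this] show ?thesis by simp
  qed
  show "(\<lambda>n. indicator (cball 0 (real n)) x *\<^sub>R u x) \<longlonglongrightarrow> u x" for x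
  proof (rule tendsto_eventually)
    obtain m where "norm x \<le> real m" using real_arch_simple by blast
    then show "\<forall>\<^sub>F n in sequentially. indicator (cball 0 (real n)) x *\<^sub>R u x = u x"
      by (intro eventually_sequentiallyI[of m]) (auto simp: indicator_def)
  qed
qed

lemma loc_integrable_box:
  assumes "loc_integrable u"
  shows "integrable lborel (\<lambda>x. indicator (box l r) x *\<^sub>R u x)"
proof -
  have "set_integrable lborel (cbox l r) u"
    using assms unfolding loc_integrable_def by simp
  then have "set_integrable lborel (box l r) u"
    by (rule set_integrable_subset) (auto simp: box_subset_cbox)
  then show ?thesis by (simp add: set_integrable_def)
qed

text \<open>The positive and negative parts of w, cut off to a large box, are densities of two
  measures that agree on all boxes. Boxes are stable under intersection and generate the Borel sets,
  so the measures coincide and with them, almost everywhere, the densities.\<close>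

lemma AE_zero_if_box_integrals_zero:
  fixes w :: "'a::euclidean_space \<Rightarrow> real"
  assumes [measurable]: "w \<in> borel_measurable borel"
    and int: "\<And>l r. integrable lborel (\<lambda>x. indicator (box l r) x * w x)"
    and zero: "\<And>l r. (\<integral>x. indicator (box l r) x * w x \<partial>lborel) = 0"
  shows "AE x in lborel. w x = 0"
proof -
  define A where "A n = box (- (real n *\<^sub>R One)) (real n *\<^sub>R One :: 'a)" for n
  have [measurable]: "A n \<in> sets borel" for n by (simp add: A_def)
  have "AE x in lborel. x \<in> A n \<longrightarrow> w x = 0" for n
  proof -
    let ?P = "\<lambda>x. ennreal (indicator (A n) x * max (w x) 0)" and ?M = "\<lambda>x. ennreal (indicator (A n) x * max (- w x) 0)"
    have "density lborel ?P = density lborel ?M"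
    proof (rule measure_eqI_generator_eq)
      let ?E = "range (\<lambda>(a, b). box a b::'a set)"
      show "Int_stable ?E"
        by (auto simp: Int_stable_def box_Int_box)
      show "?E \<subseteq> Pow UNIV" "sets (density lborel ?P) = sigma_sets UNIV ?E" "sets (density lborel ?M) = sigma_sets UNIV ?E"
        by (simp_all add: borel_eq_box)
      let ?A = "\<lambda>n::nat. box (- (real n *\<^sub>R One)) (real n *\<^sub>R One) :: 'a set"
      show "range ?A \<subseteq> ?E" "(\<Union>i. ?A i) = UNIV"
        unfolding UN_box_eq_UNIV by auto
      have eq: "emeasure (density lborel ?P) (box a b) = emeasure (density lborel ?M) (box a b) \<and> emeasure (density lborel ?P) (box a b) \<noteq> \<infinity>" for a b
      proof -
        \<comment> \<open>The cut-off and a generating box meet in a box, to which the hypotheses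
          apply.\<close>
        obtain l r where lr: "A n \<inter> box a b = box l r" unfolding A_def box_Int_box by blast
        have i: "integrable lborel (\<lambda>x. max (indicator (box l r) x * w x) 0)" "integrable lborel (\<lambda>x. max (- (indicator (box l r) x * w x)) 0)"
          by (intro integrable_max int Bochner_Integration.integrable_minus integrable_zero)+
        have "emeasure (density lborel ?P) (box a b) = (\<integral>\<^sup>+x. ennreal (max (indicator (box l r) x * w x) 0) \<partial>lborel)"
          by (subst emeasure_density) (auto intro!: nn_integral_cong simp: lr[symmetric] indicator_def)
        also have "\<dots> = ennreal (\<integral>x. max (indicator (box l r) x * w x) 0 \<partial>lborel)"
          by (intro nn_integral_eq_integral i) auto
        finally have 1: "emeasure (density lborel ?P) (box a b) = ennreal (\<integral>x. max (indicator (box l r) x * w x) 0 \<partial>lborel)" .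
        have "emeasure (density lborel ?M) (box a b) = (\<integral>\<^sup>+x. ennreal (max (- (indicator (box l r) x * w x)) 0) \<partial>lborel)"
          by (subst emeasure_density) (auto intro!: nn_integral_cong simp: lr[symmetric] indicator_def)
        also have "\<dots> = ennreal (\<integral>x. max (- (indicator (box l r) x * w x)) 0 \<partial>lborel)"
          by (intro nn_integral_eq_integral i) auto
        finally have 2: "emeasure (density lborel ?M) (box a b) = ennreal (\<integral>x. max (- (indicator (box l r) x * w x)) 0 \<partial>lborel)" .
        have "(\<integral>x. max (indicator (box l r) x * w x) 0 \<partial>lborel) - (\<integral>x. max (- (indicator (box l r) x * w x)) 0 \<partial>lborel)
          = (\<integral>x. max (indicator (box l r) x * w x) 0 - max (- (indicator (box l r) x * w x)) 0 \<partial>lborel)"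
          by (rule Bochner_Integration.integral_diff[symmetric]) (rule i)+
        also have "\<dots> = (\<integral>x. indicator (box l r) x * w x \<partial>lborel)"
          by (intro Bochner_Integration.integral_cong) (auto simp: max_def)
        finally show ?thesis unfolding 1 2 zero by simp
      qed
      show "emeasure (density lborel ?P) (?A i) \<noteq> \<infinity>" for i using eq by blast
      show "emeasure (density lborel ?P) X = emeasure (density lborel ?M) X" if "X \<in> ?E" for X
        using that eq by auto
    qed
    then have "AE x in lborel. ?P x = ?M x"
      by (intro sigma_finite_measure.density_unique[OF sigma_finite_lborel]) auto
    then show ?thesis
    proof eventually_elim
      case (elim x)
      show ?case
      proof
        assume "x \<in> A n"
        with elim have "max (w x) 0 = max (- w x) 0" by simp
        then show "w x = 0" by (simp add: max_def split: if_splits)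
      qed
    qed
  qed
  then have "AE x in lborel. \<forall>n. x \<in> A n \<longrightarrow> w x = 0"
    unfolding AE_all_countable by blast
  moreover have "\<exists>n. x \<in> A n" for x
    using UN_box_eq_UNIV[where 'a='a] unfolding A_def by blast
  ultimately show ?thesis by (auto elim: eventually_mono)
qed

lemma integrable_test_fun_scaleR:
  fixes v :: "'a::euclidean_space \<Rightarrow> 'b::euclidean_space"
  assumes \<psi>: "test_fun \<psi>" and v: "loc_integrable v"
  shows "integrable lborel (\<lambda>x. \<psi> x *\<^sub>R v x)"
proof -
  note [measurable] = loc_integrable_measurable[OF v] C1c_measurable(1)[OF test_fun_C1c[OF \<psi>]]
  obtain B R where B: "0 \<le> B" "\<And>x. \<bar>\<psi> x\<bar> \<le> B" and R: "\<And>x. R \<le> norm x \<Longrightarrow> \<psi> x = 0"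
    using C1c_bounded[OF test_fun_C1c[OF \<psi>]] by metis
  have "integrable lborel (\<lambda>x. indicator (cball 0 R) x *\<^sub>R v x)"
    using v unfolding loc_integrable_def set_integrable_def by simp
  then have "integrable lborel (\<lambda>x. B *\<^sub>R (indicator (cball 0 R) x *\<^sub>R v x))"
    by (rule integrable_scaleR_right)
  then show ?thesis
  proof (rule Bochner_Integration.integrable_bound)
    show "AE x in lborel. norm (\<psi> x *\<^sub>R v x) \<le> norm (B *\<^sub>R (indicator (cball 0 R) x *\<^sub>R v x))"
      using B R by (intro always_eventually allI) (auto simp: indicator_def intro!: mult_right_mono)
  qed measurable
qed

text \<open>Box bumps with parameter 1/(n+1) are dominated by the indicator of the box and converge
  to it, so the integral of v over every box vanishes; the coordinates of v are then treated one by
  one.\<close>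

lemma fundamental_lemma_calculus_of_variations:
  fixes v :: "'a::euclidean_space \<Rightarrow> 'b::euclidean_space"
  assumes v: "loc_integrable v" and zero: "\<And>\<psi>. test_fun \<psi> \<Longrightarrow> (\<integral>x. \<psi> x *\<^sub>R v x \<partial>lborel) = 0"
  shows "AE x in lborel. v x = 0"
proof -
  note [measurable] = loc_integrable_measurable[OF v]
  have box0: "(\<integral>x. indicator (box l r) x *\<^sub>R v x \<partial>lborel) = 0" for l r
  proof -
    have t: "test_fun (box_bump l r (inverse (real (Suc n))))" for n
      by (rule test_fun_box_bump) simp
    note [measurable] = C1c_measurable(1)[OF test_fun_C1c[OF t]]
    have "(\<lambda>n. \<integral>x. box_bump l r (inverse (real (Suc n))) x *\<^sub>R v x \<partial>lborel) \<longlonglongrightarrow> (\<integral>x. indicator (box l r) x *\<^sub>R v x \<partial>lborel)"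
    proof (rule integral_dominated_convergence)
      show "integrable lborel (\<lambda>x. norm (indicator (box l r) x *\<^sub>R v x))"
        by (intro integrable_norm loc_integrable_box v)
      show "AE x in lborel. (\<lambda>n. box_bump l r (inverse (real (Suc n))) x *\<^sub>R v x) \<longlonglongrightarrow> indicator (box l r) x *\<^sub>R v x"
        by (intro always_eventually allI tendsto_scaleR tendsto_const box_bump_tendsto)
      show "AE x in lborel. norm (box_bump l r (inverse (real (Suc n))) x *\<^sub>R v x) \<le> norm (indicator (box l r) x *\<^sub>R v x)" for n
        using box_bump_bounds[of "inverse (real (Suc n))" l r]
        by (intro always_eventually allI) (simp del: of_nat_Suc add: mult_right_mono)
      show "(\<lambda>x. box_bump l r (inverse (real (Suc n))) x *\<^sub>R v x) \<in> borel_measurable lborel" for n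
        by measurable
    qed auto
    then show ?thesis unfolding zero[OF t] by (simp add: LIMSEQ_const_iff)
  qed
  have "AE x in lborel. v x \<bullet> b = 0" for b
  proof (rule AE_zero_if_box_integrals_zero)
    show "integrable lborel (\<lambda>x. indicator (box l r) x * (v x \<bullet> b))" for l r
      using integrable_inner_left[OF loc_integrable_box[OF v, of l r], of b] by simp
    have "(\<integral>x. (indicator (box l r) x *\<^sub>R v x) \<bullet> b \<partial>lborel) = (\<integral>x. indicator (box l r) x *\<^sub>R v x \<partial>lborel) \<bullet> b" for l r
      by (intro integral_inner_left loc_integrable_box v)
    then show "(\<integral>x. indicator (box l r) x * (v x \<bullet> b) \<partial>lborel) = 0" for l r
      by (simp add: box0)
  qed measurable
  then have "AE x in lborel. \<forall>b\<in>Basis. v x \<bullet> b = 0"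
    by (intro AE_finite_allI) auto
  then show ?thesis
    by eventually_elim (rule euclidean_eqI, simp)
qed

lemma has_weak_grad_unique:
  assumes g: "has_weak_grad u g" and h: "has_weak_grad u h"
  shows "AE x in lborel. g x = h x"
proof -
  have l: "loc_integrable g" "loc_integrable h"
    using g h by (auto simp: has_weak_grad_def)
  have "AE x in lborel. g x - h x = 0"
  proof (rule fundamental_lemma_calculus_of_variations)
    show "loc_integrable (\<lambda>x. g x - h x)"
      using l unfolding loc_integrable_def by (auto intro: set_integral_diff(1))
    fix \<psi> :: "'a \<Rightarrow> real" assume \<psi>: "test_fun \<psi>"
    have "(\<integral>x. \<psi> x *\<^sub>R g x \<partial>lborel) = (\<integral>x. \<psi> x *\<^sub>R h x \<partial>lborel)"
      using g h \<psi> unfolding has_weak_grad_def by (metis neg_equal_iff_equal)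
    then show "(\<integral>x. \<psi> x *\<^sub>R (g x - h x) \<partial>lborel) = 0"
      using integrable_test_fun_scaleR[OF \<psi> l(1)] integrable_test_fun_scaleR[OF \<psi> l(2)]
      by (simp add: scaleR_diff_right)
  qed
  then show ?thesis by simp
qed

text \<open>All that can be known of the chosen representative: any explicit weak gradient may
  replace it under an integral.\<close>

lemma weak_grad_AE:
  assumes "has_weak_grad u g"
  shows "AE x in lborel. weak_grad u x = g x" "weak_grad u \<in> borel_measurable borel"
proof -
  have w: "has_weak_grad u (weak_grad u)"
    unfolding weak_grad_def by (rule someI[where P="has_weak_grad u"]) (rule assms)
  then show "AE x in lborel. weak_grad u x = g x"
    using assms by (rule has_weak_grad_unique)
  show "weak_grad u \<in> borel_measurable borel"
    using w by (intro loc_integrable_measurable) (simp add: has_weak_grad_def)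
qed

subsection \<open>The ground state representation\<close>

text \<open>The data through which all limits are taken: an approximating sequence whose gradients converge
  in \<open>L\<^sup>2\<close> to \<open>g\<close> and which, by Hardy's inequality, converges to \<open>\<phi>\<close> in \<open>L\<^sup>2\<close> with weight \<open>1 / |x|\<^sup>2\<close>.\<close>

definition hdot1_approx :: "('a::euclidean_space \<Rightarrow> real) \<Rightarrow> ('a \<Rightarrow> 'a) \<Rightarrow> (nat \<Rightarrow> 'a \<Rightarrow> real) \<Rightarrow> (nat \<Rightarrow> 'a \<Rightarrow> 'a) \<Rightarrow> bool" where
  "hdot1_approx \<phi> g f f' \<longleftrightarrow> (\<forall>n. C1c (f n) (f' n)) \<and> \<phi> \<in> borel_measurable borel \<and>
     sq_integrable lborel g \<and> sq_integrable lborel (\<lambda>x. \<phi> x / norm x) \<and>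
     (\<lambda>n. \<integral>x. (norm (f' n x - g x))\<^sup>2 \<partial>lborel) \<longlonglongrightarrow> 0 \<and>
     (\<lambda>n. \<integral>x. (norm (f n x / norm x - \<phi> x / norm x))\<^sup>2 \<partial>lborel) \<longlonglongrightarrow> 0"

text \<open>Hardy's inequality for the differences \<open>f m - f n\<close> turns the Cauchy
  property of the gradients into one for the quotients by |x|, and completeness supplies limits of
  both. What remains is to recognise the second limit as \<phi> / |x|.\<close>

lemma hdot1_approx_exists:
  fixes \<phi> :: "'a::euclidean_space \<Rightarrow> real"
  assumes N: "3 \<le> DIM('a)" and \<phi>: "\<phi> \<in> hdot1"
  obtains g f f' where "hdot1_approx \<phi> g f f'"
proof -
  obtain f where \<phi>m[measurable]: "\<phi> \<in> borel_measurable borel" and tf: "\<And>n. test_fun (f n)"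
    and cauchy: "\<And>e. 0 < e \<Longrightarrow> \<exists>M. \<forall>m\<ge>M. \<forall>n\<ge>M. hdot1_norm (\<lambda>x. f m x - f n x) < e"
    and loc: "\<And>K. compact K \<Longrightarrow> (\<lambda>n. \<integral>\<^sup>+x\<in>K. ennreal \<bar>f n x - \<phi> x\<bar> \<partial>lborel) \<longlonglongrightarrow> 0"
    using \<phi> unfolding hdot1_def by auto
  define f' where "f' n = grad (f n)" for n
  have C: "C1c (f n) (f' n)" for n unfolding f'_def by (rule test_fun_C1c[OF tf])
  note [measurable] = C1c_measurable[OF C]
  have Cd: "C1c (\<lambda>x. f m x - f n x) (\<lambda>x. f' m x - f' n x)" for m n
    by (rule C1c_diff[OF C C])
  note H = C1c_sq_integrable_hardy[OF N C] and Hd = C1c_sq_integrable_hardy[OF N Cd]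
  have gd: "grad (\<lambda>x. f m x - f n x) x = f' m x - f' n x" for m n x
    by (rule grad_unique[OF C1cD(1)[OF Cd]])
  have cauchy2: "\<exists>K. \<forall>m\<ge>K. \<forall>n\<ge>K. (\<integral>x. (norm (f' m x - f' n x))\<^sup>2 \<partial>lborel) < e" if "0 < e" for e
  proof -
    obtain K where "\<forall>m\<ge>K. \<forall>n\<ge>K. hdot1_norm (\<lambda>x. f m x - f n x) < sqrt e"
      using cauchy[of "sqrt e"] \<open>0 < e\<close> by auto
    then show ?thesis
      unfolding hdot1_norm_def gd by auto
  qed
  let ?c = "((real DIM('a) - 2) / 2)\<^sup>2"
  have c: "0 < ?c" using N by simp
  have cauchy3: "\<exists>K. \<forall>m\<ge>K. \<forall>n\<ge>K. (\<integral>x. (norm (f m x / norm x - f n x / norm x))\<^sup>2 \<partial>lborel) < e" if "0 < e" for e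
  proof -
    obtain K where K: "\<And>m n. m\<ge>K \<Longrightarrow> n\<ge>K \<Longrightarrow> (\<integral>x. (norm (f' m x - f' n x))\<^sup>2 \<partial>lborel) < ?c * e"
      using cauchy2[of "?c * e"] \<open>0 < e\<close> c by (meson mult_pos_pos)
    have "(\<integral>x. (norm (f m x / norm x - f n x / norm x))\<^sup>2 \<partial>lborel) < e" if "m \<ge> K" "n \<ge> K" for m n
    proof -
      have "?c * (\<integral>x. ((f m x - f n x) / norm x)\<^sup>2 \<partial>lborel) < ?c * e"
        using Hd(4)[of m n] K[OF that] by linarith
      then have "(\<integral>x. ((f m x - f n x) / norm x)\<^sup>2 \<partial>lborel) < e"
        by (rule mult_left_less_imp_less) (use c in simp)
      then show ?thesis by (simp add: diff_divide_distrib)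
    qed
    then show ?thesis by blast
  qed
  have nn: "(\<integral>\<^sup>+x. ennreal ((norm (w x))\<^sup>2) \<partial>lborel) = ennreal (\<integral>x. (norm (w x))\<^sup>2 \<partial>lborel)" if "sq_integrable lborel w" for w :: "'a \<Rightarrow> 'c::euclidean_space"
    by (intro nn_integral_eq_integral sq_integrableD that) auto
  have "\<exists>g r. g \<in> borel_measurable lborel \<and> strict_mono (r :: nat \<Rightarrow> nat) \<and> (AE x in lborel. (\<lambda>k. f' (r k) x) \<longlonglongrightarrow> g x) \<and>
     (\<lambda>n. \<integral>\<^sup>+x. ennreal ((norm (f' n x - g x))\<^sup>2) \<partial>lborel) \<longlonglongrightarrow> 0"
  proof (rule L2_complete)
    show "\<exists>K. \<forall>m\<ge>K. \<forall>n\<ge>K. (\<integral>\<^sup>+x. ennreal ((norm (f' m x - f' n x))\<^sup>2) \<partial>lborel) < ennreal e" if "0 < e" for e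
      unfolding nn[OF Hd(1)] using cauchy2[OF that] that by (auto simp: ennreal_less_iff)
  qed simp
  then obtain g where g: "g \<in> borel_measurable lborel" "(\<lambda>n. \<integral>\<^sup>+x. ennreal ((norm (f' n x - g x))\<^sup>2) \<partial>lborel) \<longlonglongrightarrow> 0"
    by blast
  have "\<exists>U r. U \<in> borel_measurable lborel \<and> strict_mono (r :: nat \<Rightarrow> nat) \<and> (AE x in lborel. (\<lambda>k. f (r k) x / norm x) \<longlonglongrightarrow> U x) \<and>
     (\<lambda>n. \<integral>\<^sup>+x. ennreal ((norm (f n x / norm x - U x))\<^sup>2) \<partial>lborel) \<longlonglongrightarrow> 0"
  proof (rule L2_complete)
    show "\<exists>K. \<forall>m\<ge>K. \<forall>n\<ge>K. (\<integral>\<^sup>+x. ennreal ((norm (f m x / norm x - f n x / norm x))\<^sup>2) \<partial>lborel) < ennreal e" if "0 < e" for e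
      unfolding nn[OF sq_integrable_diff[OF H(2) H(2)]] using cauchy3[OF that] that by (auto simp: ennreal_less_iff)
  qed simp
  then obtain U and r :: "nat \<Rightarrow> nat" where U[measurable]: "U \<in> borel_measurable lborel" and r: "strict_mono r"
    and Ur: "AE x in lborel. (\<lambda>k. f (r k) x / norm x) \<longlonglongrightarrow> U x"
    and Ul: "(\<lambda>n. \<integral>\<^sup>+x. ennreal ((norm (f n x / norm x - U x))\<^sup>2) \<partial>lborel) \<longlonglongrightarrow> 0"
    by blast
  \<comment> \<open>The weighted limit \<open>U\<close> and the local L^1 limit \<phi> are compared
    on each ball: a further subsequence of \<open>r\<close> converges almost everywhere in both
    senses.\<close>
  have "AE x in lborel. norm x \<le> real m \<longrightarrow> U x = \<phi> x / norm x" for m :: nat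
  proof -
    let ?d = "\<lambda>n x. indicator (cball 0 (real m)) x * (f n x - \<phi> x)"
    let ?I = "\<lambda>n. \<integral>\<^sup>+x. ennreal (norm (?d n x)) \<partial>lborel"
    have [measurable]: "cball (0::'a) (real m) \<in> sets borel" by simp
    have "(\<integral>\<^sup>+x\<in>cball 0 (real m). ennreal \<bar>f n x - \<phi> x\<bar> \<partial>lborel) = ?I n" for n
      by (intro nn_integral_cong) (auto simp: indicator_def)
    with loc[of "cball 0 (real m)"] have I0: "?I \<longlonglongrightarrow> 0" by simp
    then have "\<forall>\<^sub>F n in sequentially. ?I n < 1" by (rule order_tendstoD) simp
    then obtain n0 where "?I n0 < 1" by (auto simp: eventually_sequentially)
    \<comment> \<open>One index at finite distance suffices: the others differ from it by an
      integrable function.\<close>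
    then have i0: "integrable lborel (?d n0)"
      by (intro integrableI_bounded) (auto intro: less_trans)
    have i: "integrable lborel (?d n)" for n
    proof -
      have "integrable lborel (\<lambda>x. indicator (cball 0 (real m)) x *\<^sub>R (f n x - f n0 x))"
        using C1c_integrable(1)[OF Cd] by (intro integrable_mult_indicator) auto
      from Bochner_Integration.integrable_add[OF this i0] show ?thesis
        by (simp add: algebra_simps)
    qed
    have "?I n = ennreal (\<integral>x. norm (?d n x) \<partial>lborel)" for n
      by (intro nn_integral_eq_integral integrable_norm i) auto
    with I0 have "(\<lambda>n. ennreal (\<integral>x. norm (?d n x) \<partial>lborel)) \<longlonglongrightarrow> ennreal 0" by simp
    then have "(\<lambda>n. \<integral>x. norm (?d n x) \<partial>lborel) \<longlonglongrightarrow> 0"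
      by (subst (asm) tendsto_ennreal_iff) (auto intro!: always_eventually)
    then have "(\<lambda>k. \<integral>x. norm (?d (r k) x) \<partial>lborel) \<longlonglongrightarrow> 0"
      using LIMSEQ_subseq_LIMSEQ[OF _ r] by (simp add: o_def)
    then obtain s :: "nat \<Rightarrow> nat" where s: "strict_mono s" "AE x in lborel. (\<lambda>k. ?d (r (s k)) x) \<longlonglongrightarrow> 0"
      using tendsto_L1_AE_subseq[of lborel "\<lambda>k. ?d (r k)"] i by blast
    from s(2) Ur show ?thesis
    proof eventually_elim
      case (elim x)
      show ?case
      proof
        assume "norm x \<le> real m"
        with elim(1) have "(\<lambda>k. f (r (s k)) x - \<phi> x) \<longlonglongrightarrow> 0" by simp
        then have "(\<lambda>k. f (r (s k)) x) \<longlonglongrightarrow> \<phi> x" by (simp add: LIM_zero_iff)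
        then have "(\<lambda>k. f (r (s k)) x * inverse (norm x)) \<longlonglongrightarrow> \<phi> x * inverse (norm x)"
          by (intro tendsto_mult tendsto_const)
        moreover have "(\<lambda>k. f (r (s k)) x * inverse (norm x)) \<longlonglongrightarrow> U x"
          using LIMSEQ_subseq_LIMSEQ[OF elim(2) s(1)] by (simp add: o_def divide_inverse)
        ultimately show "U x = \<phi> x / norm x"
          by (simp add: LIMSEQ_unique divide_inverse)
      qed
    qed
  qed
  then have "AE x in lborel. \<forall>m::nat. norm x \<le> real m \<longrightarrow> U x = \<phi> x / norm x"
    unfolding AE_all_countable by blast
  then have Ueq: "AE x in lborel. U x = \<phi> x / norm x"
    by eventually_elim (use real_arch_simple in blast)
  have "(\<integral>\<^sup>+x. ennreal ((norm (f n x / norm x - U x))\<^sup>2) \<partial>lborel) = (\<integral>\<^sup>+x. ennreal ((norm (f n x / norm x - \<phi> x / norm x))\<^sup>2) \<partial>lborel)" for n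
    by (rule nn_integral_cong_AE) (use Ueq in eventually_elim, simp)
  with Ul have Ul': "(\<lambda>n. \<integral>\<^sup>+x. ennreal ((norm (f n x / norm x - \<phi> x / norm x))\<^sup>2) \<partial>lborel) \<longlonglongrightarrow> 0" by simp
  have "hdot1_approx \<phi> g f f'"
    unfolding hdot1_approx_def
    using L2_tendsto_sq_integrable[OF H(1) g] L2_tendsto_sq_integrable[OF H(2) _ Ul'] C by simp
  then show thesis by (rule that)
qed

text \<open>Both sides are L^2 pairings built from \<phi> / |x| and the radial part of g. Taking the
  radial part does not increase the norm, so the identity for the approximants passes to the
  limit.\<close>

lemma hdot1_approx_pairing:
  fixes \<phi> :: "'a::euclidean_space \<Rightarrow> real"
  assumes N: "3 \<le> DIM('a)" and a: "hdot1_approx \<phi> g f f'"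
  shows "(\<integral>x. (\<phi> x / norm x) * (g x \<bullet> (x /\<^sub>R norm x)) \<partial>lborel) = - ((real DIM('a) - 2) / 2) * (\<integral>x. (\<phi> x / norm x)\<^sup>2 \<partial>lborel)"
    and "sq_integrable lborel (\<lambda>x. g x \<bullet> (x /\<^sub>R norm x))"
proof -
  have C: "\<And>n. C1c (f n) (f' n)" and g: "sq_integrable lborel g" and U: "sq_integrable lborel (\<lambda>x. \<phi> x / norm x)"
    and lg: "(\<lambda>n. \<integral>x. (norm (f' n x - g x))\<^sup>2 \<partial>lborel) \<longlonglongrightarrow> 0"
    and lU: "(\<lambda>n. \<integral>x. (norm (f n x / norm x - \<phi> x / norm x))\<^sup>2 \<partial>lborel) \<longlonglongrightarrow> 0"
    using a unfolding hdot1_approx_def by auto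
  note H = C1c_sq_integrable_hardy[OF N C]
  have rad: "\<bar>v \<bullet> (x /\<^sub>R norm x)\<bar> \<le> 1 * norm v" for v x :: 'a
    using Cauchy_Schwarz_ineq2[of v "x /\<^sub>R norm x"] by (cases "x = 0") auto
  have comp: "sq_integrable lborel (\<lambda>x. w x \<bullet> (x /\<^sub>R norm x))" if "sq_integrable lborel w" for w :: "'a \<Rightarrow> 'a"
  proof -
    have [measurable]: "w \<in> borel_measurable borel" using sq_integrable_meas[OF that] by simp
    show ?thesis by (rule sq_integrable_bound[OF that, where C=1]) (use rad in auto)
  qed
  show "sq_integrable lborel (\<lambda>x. g x \<bullet> (x /\<^sub>R norm x))" by (rule comp[OF g])
  have lV: "(\<lambda>n. \<integral>x. (norm (f' n x \<bullet> (x /\<^sub>R norm x) - g x \<bullet> (x /\<^sub>R norm x)))\<^sup>2 \<partial>lborel) \<longlonglongrightarrow> 0"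
  proof (rule tendsto_sandwich[OF _ _ tendsto_const lg])
    show "\<forall>\<^sub>F n in sequentially. (\<integral>x. (norm (f' n x \<bullet> (x /\<^sub>R norm x) - g x \<bullet> (x /\<^sub>R norm x)))\<^sup>2 \<partial>lborel) \<le> (\<integral>x. (norm (f' n x - g x))\<^sup>2 \<partial>lborel)"
    proof (intro always_eventually allI integral_mono)
      fix n x
      show "integrable lborel (\<lambda>x. (norm (f' n x \<bullet> (x /\<^sub>R norm x) - g x \<bullet> (x /\<^sub>R norm x)))\<^sup>2)"
        by (intro sq_integrableD sq_integrable_diff comp H g)
      show "integrable lborel (\<lambda>x. (norm (f' n x - g x))\<^sup>2)"
        by (intro sq_integrableD sq_integrable_diff H g)
      show "(norm (f' n x \<bullet> (x /\<^sub>R norm x) - g x \<bullet> (x /\<^sub>R norm x)))\<^sup>2 \<le> (norm (f' n x - g x))\<^sup>2"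
        using rad[of "f' n x - g x" x] by (intro power_mono) (auto simp: inner_diff_left right_diff_distrib)
    qed
  qed simp
  have "(\<lambda>n. \<integral>x. (f n x / norm x) \<bullet> (f' n x \<bullet> (x /\<^sub>R norm x)) \<partial>lborel) \<longlonglongrightarrow> (\<integral>x. (\<phi> x / norm x) \<bullet> (g x \<bullet> (x /\<^sub>R norm x)) \<partial>lborel)"
    by (rule L2_inner_tendsto[OF H(2) U comp[OF H(1)] comp[OF g] lU lV])
  then have 1: "(\<lambda>n. - ((real DIM('a) - 2) / 2) * (\<integral>x. (f n x / norm x)\<^sup>2 \<partial>lborel)) \<longlonglongrightarrow> (\<integral>x. (\<phi> x / norm x) * (g x \<bullet> (x /\<^sub>R norm x)) \<partial>lborel)"
    unfolding inner_real_def H(3) .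
  have "(\<lambda>n. \<integral>x. (f n x / norm x) \<bullet> (f n x / norm x) \<partial>lborel) \<longlonglongrightarrow> (\<integral>x. (\<phi> x / norm x) \<bullet> (\<phi> x / norm x) \<partial>lborel)"
    by (rule L2_inner_tendsto[OF H(2) U H(2) U lU lU])
  then have "(\<lambda>n. \<integral>x. (f n x / norm x)\<^sup>2 \<partial>lborel) \<longlonglongrightarrow> (\<integral>x. (\<phi> x / norm x)\<^sup>2 \<partial>lborel)"
    unfolding inner_real_def power2_eq_square .
  then have "(\<lambda>n. - ((real DIM('a) - 2) / 2) * (\<integral>x. (f n x / norm x)\<^sup>2 \<partial>lborel)) \<longlonglongrightarrow> - ((real DIM('a) - 2) / 2) * (\<integral>x. (\<phi> x / norm x)\<^sup>2 \<partial>lborel)"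
    by (rule tendsto_mult_left)
  with 1 show "(\<integral>x. (\<phi> x / norm x) * (g x \<bullet> (x /\<^sub>R norm x)) \<partial>lborel) = - ((real DIM('a) - 2) / 2) * (\<integral>x. (\<phi> x / norm x)\<^sup>2 \<partial>lborel)"
    by (rule LIMSEQ_unique)
qed

text \<open>The product rule for w \<phi>, used with w = 1 and w = |x|^\<gamma>. The bounds on w and
  on |x| |w'| are the ones that survive a gradient singularity of order 1 / |x| at the origin, which
  the factor \<phi> / |x| absorbs.\<close>

lemma hdot1_approx_has_weak_grad:
  fixes \<phi> :: "'a::euclidean_space \<Rightarrow> real" and w :: "'a \<Rightarrow> real" and w' :: "'a \<Rightarrow> 'a"
  assumes N: "3 \<le> DIM('a)" and a: "hdot1_approx \<phi> g f f'"
    and [measurable]: "w \<in> borel_measurable borel" "w' \<in> borel_measurable borel"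
    and bd: "\<And>R. \<exists>C. \<forall>x. norm x \<le> R \<longrightarrow> \<bar>w x\<bar> \<le> C \<and> norm x * norm (w' x) \<le> C"
    and ibp: "\<And>h h'. C1c h h' \<Longrightarrow> (\<integral>x. w x *\<^sub>R h' x \<partial>lborel) = - (\<integral>x. h x *\<^sub>R w' x \<partial>lborel)"
  shows "has_weak_grad (\<lambda>x. w x * \<phi> x) (\<lambda>x. w x *\<^sub>R g x + \<phi> x *\<^sub>R w' x)"
proof -
  have C: "\<And>n. C1c (f n) (f' n)" and \<phi>m[measurable]: "\<phi> \<in> borel_measurable borel"
    and g: "sq_integrable lborel g" and U: "sq_integrable lborel (\<lambda>x. \<phi> x / norm x)"
    and lg: "(\<lambda>n. \<integral>x. (norm (f' n x - g x))\<^sup>2 \<partial>lborel) \<longlonglongrightarrow> 0"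
    and lU: "(\<lambda>n. \<integral>x. (norm (f n x / norm x - \<phi> x / norm x))\<^sup>2 \<partial>lborel) \<longlonglongrightarrow> 0"
    using a unfolding hdot1_approx_def by auto
  note H = C1c_sq_integrable_hardy[OF N C]
  have gm[measurable]: "g \<in> borel_measurable borel" using sq_integrable_meas[OF g] by simp
  have AE0: "AE x in lborel. x \<noteq> (0::'a)" by (rule AE_lborel_singleton)
  \<comment> \<open>These are the fixed factors of the pairings below: bounded, with bounded
    support, and therefore in L^2.\<close>
  have weight: "sq_integrable lborel (\<lambda>x. \<rho> x * (norm x * w x))" "sq_integrable lborel (\<lambda>x. \<rho> x * w x)"
      "sq_integrable lborel (\<lambda>x. (w x * norm x) *\<^sub>R v x)" "sq_integrable lborel (\<lambda>x. (\<rho> x * norm x) *\<^sub>R w' x)"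
    if [measurable]: "\<rho> \<in> borel_measurable borel" "v \<in> borel_measurable borel"
      and B: "\<And>x. \<bar>\<rho> x\<bar> \<le> B" "\<And>x. norm (v x) \<le> B"
      and R: "\<And>x. R \<le> norm x \<Longrightarrow> \<rho> x = 0" "\<And>x. R \<le> norm x \<Longrightarrow> v x = 0" for \<rho> :: "'a \<Rightarrow> real" and v :: "'a \<Rightarrow> 'a" and B R
  proof -
    obtain K where K: "\<And>x. norm x \<le> R \<Longrightarrow> \<bar>w x\<bar> \<le> K" "\<And>x. norm x \<le> R \<Longrightarrow> norm x * norm (w' x) \<le> K"
      using bd[of R] by blast
    have B0: "0 \<le> B" using B(1)[of 0] by linarith
    show "sq_integrable lborel (\<lambda>x. \<rho> x * (norm x * w x))"
    proof (rule sq_integrable_bounded_support[where R=R and C="B * (R * K)"])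
      show "norm (\<rho> x * (norm x * w x)) \<le> B * (R * K)" if "norm x \<le> R" for x
        using B(1)[of x] K(1)[OF that] that B0 order_trans[OF norm_ge_zero that]
        by (auto simp: abs_mult intro!: mult_mono)
    qed (use R in auto)
    show "sq_integrable lborel (\<lambda>x. \<rho> x * w x)"
    proof (rule sq_integrable_bounded_support[where R=R and C="B * K"])
      show "norm (\<rho> x * w x) \<le> B * K" if "norm x \<le> R" for x
        using B(1)[of x] K(1)[OF that] B0 by (auto simp: abs_mult intro!: mult_mono)
    qed (use R in auto)
    show "sq_integrable lborel (\<lambda>x. (w x * norm x) *\<^sub>R v x)"
    proof (rule sq_integrable_bounded_support[where R=R and C="K * R * B"])
      show "norm ((w x * norm x) *\<^sub>R v x) \<le> K * R * B" if "norm x \<le> R" for x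
        using B(2)[of x] K(1)[OF that] that B0 order_trans[OF norm_ge_zero that]
        by (auto simp: abs_mult intro!: mult_mono)
    qed (use R in auto)
    show "sq_integrable lborel (\<lambda>x. (\<rho> x * norm x) *\<^sub>R w' x)"
    proof (rule sq_integrable_bounded_support[where R=R and C="B * K"])
      show "norm ((\<rho> x * norm x) *\<^sub>R w' x) \<le> B * K" if "norm x \<le> R" for x
        using B(1)[of x] K(2)[OF that] B0 by (auto simp: abs_mult mult.assoc intro!: mult_mono)
    qed (use R in auto)
  qed
  have loc: "set_integrable lborel K (\<lambda>x. w x * \<phi> x) \<and> set_integrable lborel K (\<lambda>x. w x *\<^sub>R g x + \<phi> x *\<^sub>R w' x)"
    if K: "compact K" for K
  proof -
    have [measurable]: "K \<in> sets borel" using K by (simp add: compact_imp_closed)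
    obtain R where "\<And>x. x \<in> K \<Longrightarrow> norm x \<le> R"
      using compact_imp_bounded[OF K] unfolding bounded_iff by blast
    \<comment> \<open>The radius is raised by 1 because \<open>weight\<close> wants vanishing from
      the radius on.\<close>
    then have R: "indicator K x = (0::real)" if "R + 1 \<le> norm x" for x
      using that by (force simp: indicator_def)
    have ws: "sq_integrable lborel (\<lambda>x. indicator K x * (norm x * w x))" "sq_integrable lborel (\<lambda>x. indicator K x * w x)"
      "sq_integrable lborel (\<lambda>x. (indicator K x * norm x) *\<^sub>R w' x)"
      using weight[of "indicator K" "\<lambda>_. 0" 1 "R + 1"] R by (auto simp: indicator_le_1)
    have "integrable lborel (\<lambda>x. (\<phi> x / norm x) *\<^sub>R (indicator K x * (norm x * w x)))"
      by (rule sq_integrable_scaleR[OF U ws(1)])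
    then have 1: "integrable lborel (\<lambda>x. indicator K x *\<^sub>R (w x * \<phi> x))"
    proof (rule integrable_cong_AE_imp)
      show "AE x in lborel. (\<phi> x / norm x) *\<^sub>R (indicator K x * (norm x * w x)) = indicator K x *\<^sub>R (w x * \<phi> x)"
        using AE0 by eventually_elim simp
    qed measurable
    have "integrable lborel (\<lambda>x. (indicator K x * w x) *\<^sub>R g x + (\<phi> x / norm x) *\<^sub>R ((indicator K x * norm x) *\<^sub>R w' x))"
      by (intro Bochner_Integration.integrable_add sq_integrable_scaleR U ws g)
    then have "integrable lborel (\<lambda>x. indicator K x *\<^sub>R (w x *\<^sub>R g x + \<phi> x *\<^sub>R w' x))"
    proof (rule integrable_cong_AE_imp)
      show "AE x in lborel. (indicator K x * w x) *\<^sub>R g x + (\<phi> x / norm x) *\<^sub>R ((indicator K x * norm x) *\<^sub>R w' x) = indicator K x *\<^sub>R (w x *\<^sub>R g x + \<phi> x *\<^sub>R w' x)"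
        using AE0 by eventually_elim (simp add: scaleR_add_right)
    qed measurable
    with 1 show ?thesis by (simp add: set_integrable_def)
  qed
  have "(\<integral>x. (w x * \<phi> x) *\<^sub>R grad \<psi> x \<partial>lborel) = - (\<integral>x. \<psi> x *\<^sub>R (w x *\<^sub>R g x + \<phi> x *\<^sub>R w' x) \<partial>lborel)"
    if \<psi>: "test_fun \<psi>" for \<psi>
  proof -
    define \<psi>' where "\<psi>' = grad \<psi>"
    have \<psi>C: "C1c \<psi> \<psi>'" unfolding \<psi>'_def by (rule test_fun_C1c[OF \<psi>])
    note [measurable] = C1c_measurable[OF \<psi>C] C1c_measurable[OF C]
    obtain B R where B: "\<And>x. \<bar>\<psi> x\<bar> \<le> B" "\<And>x. norm (\<psi>' x) \<le> B" "\<And>x. R \<le> norm x \<Longrightarrow> \<psi> x = 0" "\<And>x. R \<le> norm x \<Longrightarrow> \<psi>' x = 0"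
      using C1c_bounded[OF \<psi>C] by metis
    note ws = weight[OF C1c_measurable[OF \<psi>C] B]
    \<comment> \<open>A factor |x| / |x| is inserted where \<phi> or its approximants occur, so that
      every integrand becomes a product of a fixed L^2 function with one that converges in
      L^2.\<close>
    let ?P = "\<lambda>u. \<integral>x. (u x / norm x) *\<^sub>R ((w x * norm x) *\<^sub>R \<psi>' x) \<partial>lborel"
    let ?Q = "\<lambda>v. \<integral>x. (\<psi> x * w x) *\<^sub>R v x \<partial>lborel"
    let ?S = "\<lambda>u. \<integral>x. (u x / norm x) *\<^sub>R ((\<psi> x * norm x) *\<^sub>R w' x) \<partial>lborel"
    have eq: "?P (f n) + ?Q (f' n) = - ?S (f n)" for n
    proof -
      have "C1c (\<lambda>x. \<psi> x * f n x) (\<lambda>x. \<psi> x *\<^sub>R f' n x + f n x *\<^sub>R \<psi>' x)"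
        by (rule C1c_mult[OF _ _ C]) (use C1cD[OF \<psi>C] in auto)
      note ib = ibp[OF this]
      have "?P (f n) + ?Q (f' n) = (\<integral>x. (f n x / norm x) *\<^sub>R ((w x * norm x) *\<^sub>R \<psi>' x) + (\<psi> x * w x) *\<^sub>R f' n x \<partial>lborel)"
        by (intro Bochner_Integration.integral_add[symmetric] sq_integrable_scaleR H ws)
      also have "\<dots> = (\<integral>x. w x *\<^sub>R (\<psi> x *\<^sub>R f' n x + f n x *\<^sub>R \<psi>' x) \<partial>lborel)"
        by (rule integral_cong_AE) (measurable, use AE0 in eventually_elim, simp add: scaleR_add_right mult_ac)
      also have "\<dots> = - (\<integral>x. (\<psi> x * f n x) *\<^sub>R w' x \<partial>lborel)" by (rule ib)
      also have "(\<integral>x. (\<psi> x * f n x) *\<^sub>R w' x \<partial>lborel) = ?S (f n)"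
        by (rule integral_cong_AE) (measurable, use AE0 in eventually_elim, simp add: mult_ac)
      finally show ?thesis .
    qed
    have const: "(\<lambda>n::nat. \<integral>x. (norm (v x - v x))\<^sup>2 \<partial>lborel) \<longlonglongrightarrow> 0" for v :: "'a \<Rightarrow> 'c::euclidean_space"
      by simp
    have "(\<lambda>n. ?P (f n) + ?Q (f' n)) \<longlonglongrightarrow> ?P \<phi> + ?Q g"
      by (intro tendsto_add L2_scaleR_tendsto H U ws g lU lg const)
    moreover have "(\<lambda>n. - ?S (f n)) \<longlonglongrightarrow> - ?S \<phi>"
      by (intro tendsto_minus L2_scaleR_tendsto H U ws lU const)
    ultimately have lim: "?P \<phi> + ?Q g = - ?S \<phi>"
      unfolding eq by (rule LIMSEQ_unique)
    have "(\<integral>x. (w x * \<phi> x) *\<^sub>R \<psi>' x \<partial>lborel) = ?P \<phi>"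
      by (rule integral_cong_AE) (measurable, use AE0 in eventually_elim, simp add: mult_ac)
    also have "\<dots> = - (?Q g + ?S \<phi>)" using lim by (simp only: eq_neg_iff_add_eq_0 add.assoc)
    also have "?Q g + ?S \<phi> = (\<integral>x. (\<psi> x * w x) *\<^sub>R g x + (\<phi> x / norm x) *\<^sub>R ((\<psi> x * norm x) *\<^sub>R w' x) \<partial>lborel)"
      by (intro Bochner_Integration.integral_add[symmetric] sq_integrable_scaleR U g ws)
    also have "\<dots> = (\<integral>x. \<psi> x *\<^sub>R (w x *\<^sub>R g x + \<phi> x *\<^sub>R w' x) \<partial>lborel)"
      by (rule integral_cong_AE) (measurable, use AE0 in eventually_elim, simp add: scaleR_add_right mult_ac)
    finally show ?thesis unfolding \<psi>'_def .
  qed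
  with loc show ?thesis
    unfolding has_weak_grad_def loc_integrable_def by blast
qed

text \<open>The ground state representation; \<open>hdot1_approx_pairing\<close> turns the cross term of the expanded
  square into a multiple of the Hardy term.\<close>

lemma hdot1_ground_state:
  fixes \<phi> :: "'a::euclidean_space \<Rightarrow> real"
  defines "\<gamma> \<equiv> (real DIM('a) - 2) / 2"
  assumes N: "3 \<le> DIM('a)" and \<phi>: "\<phi> \<in> hdot1"
  shows "integrable lborel (\<lambda>x. (\<phi> x / norm x)\<^sup>2)"
    and "integrable lborel (\<lambda>x. (norm (weak_grad \<phi> x))\<^sup>2)"
    and "integrable lborel (\<lambda>x. (norm (weak_grad (\<lambda>z. norm z powr \<gamma> * \<phi> z) x))\<^sup>2 / norm x powr (2 * \<gamma>))"
    and "(\<integral>x. (norm (weak_grad \<phi> x))\<^sup>2 \<partial>lborel) -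
         (\<integral>x. (norm (weak_grad (\<lambda>z. norm z powr \<gamma> * \<phi> z) x))\<^sup>2 / norm x powr (2 * \<gamma>) \<partial>lborel)
         = \<gamma>\<^sup>2 * (\<integral>x. (\<phi> x / norm x)\<^sup>2 \<partial>lborel)"
proof -
  obtain g f f' where a: "hdot1_approx \<phi> g f f'"
    using hdot1_approx_exists[OF N \<phi>] .
  have \<phi>m[measurable]: "\<phi> \<in> borel_measurable borel" and g: "sq_integrable lborel g"
    and U: "sq_integrable lborel (\<lambda>x. \<phi> x / norm x)"
    using a unfolding hdot1_approx_def by auto
  have gm[measurable]: "g \<in> borel_measurable borel" using sq_integrable_meas[OF g] by simp
  have \<gamma>: "0 < \<gamma>" using N by (simp add: \<gamma>_def)
  have AE0: "AE x in lborel. x \<noteq> (0::'a)" by (rule AE_lborel_singleton)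
  \<comment> \<open>The constant weight 1 with gradient 0 identifies g as a weak gradient of \<phi>
    itself.\<close>
  have "has_weak_grad (\<lambda>x. 1 * \<phi> x) (\<lambda>x. 1 *\<^sub>R g x + \<phi> x *\<^sub>R 0)"
    by (rule hdot1_approx_has_weak_grad[OF N a]) (use C1c_integral_grad in auto)
  then have w1: "has_weak_grad \<phi> g" by simp
  define G where "G x = norm x powr \<gamma> *\<^sub>R g x + \<phi> x *\<^sub>R ((\<gamma> * norm x powr (\<gamma> - 2)) *\<^sub>R x)" for x
  have w2: "has_weak_grad (\<lambda>x. norm x powr \<gamma> * \<phi> x) G"
    unfolding G_def
  proof (rule hdot1_approx_has_weak_grad[OF N a])
    fix R :: real
    have "norm x powr \<gamma> \<le> \<bar>R\<bar> powr \<gamma> \<and> norm x * (\<gamma> * norm x powr (\<gamma> - 2) * norm x) \<le> \<gamma> * \<bar>R\<bar> powr \<gamma>"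
      if "norm x \<le> R" for x :: 'a
    proof
      show le: "norm x powr \<gamma> \<le> \<bar>R\<bar> powr \<gamma>" using that \<gamma> by (intro powr_mono2) auto
      have "norm x * (\<gamma> * norm x powr (\<gamma> - 2) * norm x) = \<gamma> * norm x powr \<gamma>"
        by (cases "x = 0") (auto simp: powr_diff power2_eq_square)
      then show "norm x * (\<gamma> * norm x powr (\<gamma> - 2) * norm x) \<le> \<gamma> * \<bar>R\<bar> powr \<gamma>"
        using le \<gamma> by simp
    qed
    then show "\<exists>C. \<forall>x::'a. norm x \<le> R \<longrightarrow> \<bar>norm x powr \<gamma>\<bar> \<le> C \<and> norm x * norm ((\<gamma> * norm x powr (\<gamma> - 2)) *\<^sub>R x) \<le> C"
      using \<gamma> by (intro exI[of _ "max (\<bar>R\<bar> powr \<gamma>) (\<gamma> * \<bar>R\<bar> powr \<gamma>)"]) (auto simp: le_max_iff_disj)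
  next
    show "(\<integral>x. norm x powr \<gamma> *\<^sub>R h' x \<partial>lborel) = - (\<integral>x. h x *\<^sub>R ((\<gamma> * norm x powr (\<gamma> - 2)) *\<^sub>R x) \<partial>lborel)"
      if "C1c h h'" for h and h' :: "'a \<Rightarrow> 'a"
      by (rule C1c_integral_norm_powr[OF \<gamma> _ that]) (use N in simp)
  qed measurable
  show iU: "integrable lborel (\<lambda>x. (\<phi> x / norm x)\<^sup>2)"
    using sq_integrableD[OF U] by (simp only: real_norm_def power2_abs)
  note ig = sq_integrableD[OF g]
  note W = weak_grad_AE[OF w1] weak_grad_AE[OF w2]
  note [measurable] = W(2,4)
  have AE1: "AE x in lborel. (norm (g x))\<^sup>2 = (norm (weak_grad \<phi> x))\<^sup>2"
    using W(1) by eventually_elim simp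
  show "integrable lborel (\<lambda>x. (norm (weak_grad \<phi> x))\<^sup>2)"
    by (rule integrable_cong_AE_imp[OF ig _ AE1]) measurable
  have I1: "(\<integral>x. (norm (weak_grad \<phi> x))\<^sup>2 \<partial>lborel) = (\<integral>x. (norm (g x))\<^sup>2 \<partial>lborel)"
    by (rule integral_cong_AE[symmetric, OF _ _ AE1]) measurable
  note P = hdot1_approx_pairing[OF N a]
  have iP: "integrable lborel (\<lambda>x. (\<phi> x / norm x) * (g x \<bullet> (x /\<^sub>R norm x)))"
    using sq_integrable_inner[OF U P(2)] by simp
  \<comment> \<open>The expanded square of g + \<gamma> (\<phi> / |x|) e with e = x / |x|: what is
    left of the weighted gradient once |x|^\<gamma> has been factored out.\<close>
  define E where "E x = (norm (g x))\<^sup>2 + 2 * \<gamma> * ((\<phi> x / norm x) * (g x \<bullet> (x /\<^sub>R norm x))) + \<gamma>\<^sup>2 * (\<phi> x / norm x)\<^sup>2" for x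
  have E: "integrable lborel E"
    unfolding E_def[abs_def] by (intro Bochner_Integration.integrable_add integrable_mult_right ig iP iU)
  have "(\<integral>x. E x \<partial>lborel) = (\<integral>x. (norm (g x))\<^sup>2 \<partial>lborel) + 2 * \<gamma> * (\<integral>x. (\<phi> x / norm x) * (g x \<bullet> (x /\<^sub>R norm x)) \<partial>lborel) + \<gamma>\<^sup>2 * (\<integral>x. (\<phi> x / norm x)\<^sup>2 \<partial>lborel)"
    unfolding E_def integral_mult_right_zero Bochner_Integration.integral_add[OF ig integrable_mult_right[OF iP]]
      Bochner_Integration.integral_add[OF Bochner_Integration.integrable_add[OF ig integrable_mult_right[OF iP]] integrable_mult_right[OF iU]] ..
  \<comment> \<open>The pairing equals -\<gamma> times the Hardy integral, so the cross term
    contributes -2 \<gamma>^2 and, together with the last square, -\<gamma>^2 remains.\<close>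
  also have "\<dots> = (\<integral>x. (norm (g x))\<^sup>2 \<partial>lborel) - \<gamma>\<^sup>2 * (\<integral>x. (\<phi> x / norm x)\<^sup>2 \<partial>lborel)"
    unfolding P(1) \<gamma>_def[symmetric] by (simp add: power2_eq_square)
  finally have intE: "(\<integral>x. E x \<partial>lborel) = (\<integral>x. (norm (g x))\<^sup>2 \<partial>lborel) - \<gamma>\<^sup>2 * (\<integral>x. (\<phi> x / norm x)\<^sup>2 \<partial>lborel)" .
  have AE2: "AE x in lborel. E x = (norm (weak_grad (\<lambda>z. norm z powr \<gamma> * \<phi> z) x))\<^sup>2 / norm x powr (2 * \<gamma>)"
    using W(3) AE0
  proof eventually_elim
    case (elim x)
    have n: "0 < norm x" using elim by simp
    have "norm x powr (\<gamma> - 2) = norm x powr \<gamma> / (norm x * norm x)"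
      using n by (simp add: powr_diff power2_eq_square)
    then have "G x = norm x powr \<gamma> *\<^sub>R (g x + (\<gamma> * (\<phi> x / norm x)) *\<^sub>R (x /\<^sub>R norm x))"
      unfolding G_def using n by (simp add: scaleR_add_right field_simps)
    then have "(norm (G x))\<^sup>2 = norm x powr (2 * \<gamma>) * (norm (g x + (\<gamma> * (\<phi> x / norm x)) *\<^sub>R (x /\<^sub>R norm x)))\<^sup>2"
      by (simp add: power_mult_distrib power2_eq_square[of "norm x powr \<gamma>"] powr_add[symmetric])
    moreover have "(norm (g x + (\<gamma> * (\<phi> x / norm x)) *\<^sub>R (x /\<^sub>R norm x)))\<^sup>2 = E x"
    proof -
      define e where "e = x /\<^sub>R norm x"
      define s where "s = \<phi> x / norm x"
      have "e \<bullet> e = 1" using n unfolding power2_norm_eq_inner[symmetric] e_def by simp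
      then have "(norm (g x + (\<gamma> * s) *\<^sub>R e))\<^sup>2 = (norm (g x))\<^sup>2 + 2 * \<gamma> * (s * (g x \<bullet> e)) + \<gamma>\<^sup>2 * s\<^sup>2"
        unfolding power2_norm_eq_inner
        by (simp add: inner_add inner_commute[of e "g x"] power2_eq_square algebra_simps)
      then show ?thesis unfolding E_def e_def s_def .
    qed
    ultimately have "(norm (G x))\<^sup>2 = norm x powr (2 * \<gamma>) * E x" by (simp only:)
    then show ?case unfolding elim(1) using n by simp
  qed
  show "integrable lborel (\<lambda>x. (norm (weak_grad (\<lambda>z. norm z powr \<gamma> * \<phi> z) x))\<^sup>2 / norm x powr (2 * \<gamma>))"
    by (rule integrable_cong_AE_imp[OF E _ AE2]) measurable
  have [measurable]: "E \<in> borel_measurable borel" using E by (auto dest: borel_measurable_integrable)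
  have "(\<integral>x. (norm (weak_grad (\<lambda>z. norm z powr \<gamma> * \<phi> z) x))\<^sup>2 / norm x powr (2 * \<gamma>) \<partial>lborel) = (\<integral>x. E x \<partial>lborel)"
    by (rule integral_cong_AE[symmetric, OF _ _ AE2]) measurable
  then show "(\<integral>x. (norm (weak_grad \<phi> x))\<^sup>2 \<partial>lborel) -
         (\<integral>x. (norm (weak_grad (\<lambda>z. norm z powr \<gamma> * \<phi> z) x))\<^sup>2 / norm x powr (2 * \<gamma>) \<partial>lborel)
         = \<gamma>\<^sup>2 * (\<integral>x. (\<phi> x / norm x)\<^sup>2 \<partial>lborel)"
    unfolding I1 intE by simp
qed

subsection \<open>The double integrals\<close>

text \<open>The kernel suited to p(x) = \<phi>(x) |x|^((N - 2) / 2): both double integrals are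
  integrals of it, against p(x) p(y) and against |p(x) - p(y)|^2.\<close>

definition riesz_kernel :: "real \<Rightarrow> 'a::euclidean_space \<Rightarrow> 'a \<Rightarrow> real" where
  "riesz_kernel \<alpha> x y = riesz \<alpha> (x - y) / (norm x powr ((real DIM('a) + \<alpha>) / 2) * norm y powr ((real DIM('a) + \<alpha>) / 2))"

lemma riesz_kernel_sym: "riesz_kernel \<alpha> x y = riesz_kernel \<alpha> y x"
  by (simp add: riesz_kernel_def riesz_def norm_minus_commute mult.commute)

lemma riesz_kernel_nonneg:
  assumes "0 < \<alpha>" "\<alpha> < real DIM('a)"
  shows "0 \<le> riesz_kernel \<alpha> x (y :: 'a::euclidean_space)"
  using assms unfolding riesz_kernel_def riesz_def riesz_const_def
  by (intro divide_nonneg_nonneg mult_nonneg_nonneg Gamma_real_nonneg) auto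

lemma riesz_kernel_measurable[measurable]:
  "(\<lambda>(x, y). riesz_kernel \<alpha> x (y :: 'a::euclidean_space)) \<in> borel_measurable (borel \<Otimes>\<^sub>M borel)"
  unfolding riesz_kernel_def riesz_def by measurable

text \<open>The composition formula with a = N - \<alpha> and b = (N + \<alpha>) / 2; here a + b
  exceeds N by (N - \<alpha>) / 2. The convolution decays like |x|^(b - N), and the weight |x|^(-b)
  in the kernel completes it to |x|^(-N).\<close>

lemma nn_integral_riesz_kernel:
  fixes x :: "'a::euclidean_space" and \<alpha> :: real
  defines "N \<equiv> real DIM('a)"
  assumes N: "3 \<le> DIM('a)" and \<alpha>: "0 < \<alpha>" "\<alpha> < N" and x: "x \<noteq> 0"
  shows "(\<integral>\<^sup>+y. ennreal (riesz_kernel \<alpha> x y) \<partial>lborel) = ennreal (const_C N \<alpha> * ((N - 2) / 2)\<^sup>2 * norm x powr (- N))"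
proof -
  define b where "b = (N + \<alpha>) / 2"
  define c where "c = riesz_const N \<alpha>"
  let ?K = "pi powr (N / 2) * Gamma ((N - \<alpha>) / 4) * Gamma (\<alpha> / 2) * Gamma ((N - \<alpha>) / 4) /
        (Gamma ((N - \<alpha>) / 2) * Gamma ((N + \<alpha>) / 4) * Gamma ((N + \<alpha>) / 4))"
  have c0: "0 \<le> c"
    using \<alpha> unfolding c_def riesz_const_def by (intro divide_nonneg_nonneg mult_nonneg_nonneg Gamma_real_nonneg) auto
  have "(\<integral>\<^sup>+y. ennreal (riesz_kernel \<alpha> x y) \<partial>lborel) = (\<integral>\<^sup>+y. ennreal (c * norm x powr (- b)) * ennreal (norm (x - y) powr (- (N - \<alpha>)) * norm y powr (- b)) \<partial>lborel)"
  proof (rule nn_integral_cong)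
    fix y
    have "riesz_kernel \<alpha> x y = (c * norm x powr (- b)) * (norm (x - y) powr (- (N - \<alpha>)) * norm y powr (- b))"
      unfolding riesz_kernel_def riesz_def N_def[symmetric] b_def[symmetric] c_def[symmetric]
      by (simp only: powr_minus divide_inverse inverse_mult_distrib mult_ac)
    then show "ennreal (riesz_kernel \<alpha> x y) = ennreal (c * norm x powr (- b)) * ennreal (norm (x - y) powr (- (N - \<alpha>)) * norm y powr (- b))"
      using c0 by (simp add: ennreal_mult')
  qed
  also have "\<dots> = ennreal (c * norm x powr (- b)) * (\<integral>\<^sup>+y. ennreal (norm (x - y) powr (- (N - \<alpha>)) * norm y powr (- b)) \<partial>lborel)"
    by (rule nn_integral_cmult) measurable
  also have "(\<integral>\<^sup>+y. ennreal (norm (x - y) powr (- (N - \<alpha>)) * norm y powr (- b)) \<partial>lborel) =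
     ennreal (pi powr (N / 2) * Gamma (((N - \<alpha>) + b - N) / 2) * Gamma ((N - (N - \<alpha>)) / 2) * Gamma ((N - b) / 2) /
        (Gamma ((N - \<alpha>) / 2) * Gamma (b / 2) * Gamma ((2 * N - (N - \<alpha>) - b) / 2)) * norm x powr (N - (N - \<alpha>) - b))"
    unfolding N_def by (rule nn_integral_riesz_composition) (use \<alpha> x in \<open>auto simp: b_def N_def\<close>)
  also have "((N - \<alpha>) + b - N) / 2 = (N - \<alpha>) / 4" by (simp add: b_def field_simps)
  also have "(N - (N - \<alpha>)) / 2 = \<alpha> / 2" by simp
  also have "(N - b) / 2 = (N - \<alpha>) / 4" by (simp add: b_def field_simps)
  also have "b / 2 = (N + \<alpha>) / 4" by (simp add: b_def)
  also have "(2 * N - (N - \<alpha>) - b) / 2 = (N + \<alpha>) / 4" by (simp add: b_def field_simps)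
  also have "N - (N - \<alpha>) - b = - N + b" by (simp add: b_def field_simps)
  also have "ennreal (c * norm x powr (- b)) * ennreal (?K * norm x powr (- N + b)) = ennreal ((c * norm x powr (- b)) * (?K * norm x powr (- N + b)))"
    by (rule ennreal_mult'[symmetric]) (use c0 in simp)
  also have "(c * norm x powr (- b)) * (?K * norm x powr (- N + b)) = (c * ?K) * (norm x powr (- b) * norm x powr (- N + b))"
    by (simp only: mult_ac)
  also have "norm x powr (- b) * norm x powr (- N + b) = norm x powr (- N)"
    unfolding powr_add[symmetric] by simp
  also have "c * ?K = const_C N \<alpha> * ((N - 2) / 2)\<^sup>2"
  proof -
    have G: "Gamma ((N - \<alpha>) / 2) \<noteq> 0" "Gamma ((N + \<alpha>) / 4) \<noteq> 0" "Gamma (\<alpha> / 2) \<noteq> 0"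
      using \<alpha> by (auto intro!: less_imp_neq[symmetric] Gamma_real_pos)
    have p: "pi powr (N / 2) \<noteq> 0" "(2::real) powr \<alpha> \<noteq> 0" by auto
    have t: "(2::real) powr (\<alpha> - 2) = 2 powr \<alpha> / 4" by (simp add: powr_diff)
    have N2: "N - 2 \<noteq> 0" using N by (simp add: N_def)
    define G1 where "G1 = Gamma ((N - \<alpha>) / 2)"
    define G2 where "G2 = Gamma ((N + \<alpha>) / 4)"
    define G3 where "G3 = Gamma (\<alpha> / 2)"
    define G4 where "G4 = Gamma ((N - \<alpha>) / 4)"
    define P where "P = pi powr (N / 2)"
    define T where "T = (2::real) powr \<alpha>"
    define M where "M = N - 2"
    have nz: "G1 \<noteq> 0" "G2 \<noteq> 0" "G3 \<noteq> 0" "P \<noteq> 0" "T \<noteq> 0" "M \<noteq> 0"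
      using G p N2 by (auto simp: G1_def G2_def G3_def P_def T_def M_def)
    \<comment> \<open>The power of pi and the Gamma values at (N - \<alpha>) / 2 and \<alpha> / 2
      cancel between the Riesz constant and the composition constant, which leaves the squared
      quotient.\<close>
    have "G1 / (T * P * G3) * (P * G4 * G3 * G4 / (G1 * G2 * G2)) = 1 / (T / 4) * (G4 / (M * G2))\<^sup>2 * (M / 2)\<^sup>2"
      using nz by (simp add: field_simps power2_eq_square)
    then show ?thesis
      unfolding c_def riesz_const_def const_C_def t G1_def G2_def G3_def G4_def P_def T_def M_def .
  qed
  finally show ?thesis .
qed

text \<open>The kernel is nonnegative, so Tonelli's theorem allows the y-integral first; it gives a
  multiple of |x|^(-N), and p(x)^2 |x|^(-N) = \<phi>(x)^2 / |x|^2.\<close>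

lemma integral_riesz_kernel_square:
  fixes \<phi> :: "'a::euclidean_space \<Rightarrow> real" and \<alpha> :: real
  defines "N \<equiv> real DIM('a)"
  defines "p \<equiv> \<lambda>x. \<phi> x * norm x powr ((N - 2) / 2)"
  assumes N: "3 \<le> DIM('a)" and \<alpha>: "0 < \<alpha>" "\<alpha> < N" and [measurable]: "\<phi> \<in> borel_measurable borel"
    and int: "integrable lborel (\<lambda>x. (\<phi> x / norm x)\<^sup>2)"
  shows "integrable (lborel \<Otimes>\<^sub>M lborel) (\<lambda>(x, y). riesz_kernel \<alpha> x y * (p x)\<^sup>2)"
    and "integral\<^sup>L (lborel \<Otimes>\<^sub>M lborel) (\<lambda>(x, y). riesz_kernel \<alpha> x y * (p x)\<^sup>2) = const_C N \<alpha> * ((N - 2) / 2)\<^sup>2 * (\<integral>x. (\<phi> x / norm x)\<^sup>2 \<partial>lborel)"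
proof -
  let ?C = "const_C N \<alpha> * ((N - 2) / 2)\<^sup>2"
  let ?f = "\<lambda>(x, y). riesz_kernel \<alpha> x y * (p x)\<^sup>2"
  have k0: "0 \<le> riesz_kernel \<alpha> x y" for x y :: 'a
    using riesz_kernel_nonneg \<alpha> unfolding N_def by blast
  have C0: "0 \<le> ?C" unfolding const_C_def by simp
  have [measurable]: "p \<in> borel_measurable borel" unfolding p_def by measurable
  have f0: "0 \<le> ?f z" for z using k0 by (cases z) simp
  have fm[measurable]: "?f \<in> borel_measurable (lborel \<Otimes>\<^sub>M lborel)" by measurable
  have "(\<integral>\<^sup>+z. ennreal (?f z) \<partial>(lborel \<Otimes>\<^sub>M lborel)) = (\<integral>\<^sup>+x. \<integral>\<^sup>+y. ennreal (?f (x, y)) \<partial>lborel \<partial>lborel)"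
    by (rule lborel.nn_integral_fst[symmetric]) measurable
  also have "\<dots> = (\<integral>\<^sup>+x. ennreal (?C * (\<phi> x / norm x)\<^sup>2) \<partial>lborel)"
  proof (rule nn_integral_cong_AE)
    have "AE x in lborel. x \<noteq> (0::'a)" by (rule AE_lborel_singleton)
    then show "AE x in lborel. (\<integral>\<^sup>+y. ennreal (?f (x, y)) \<partial>lborel) = ennreal (?C * (\<phi> x / norm x)\<^sup>2)"
    proof eventually_elim
      case (elim x)
      have "(\<integral>\<^sup>+y. ennreal (?f (x, y)) \<partial>lborel) = (\<integral>\<^sup>+y. ennreal ((p x)\<^sup>2) * ennreal (riesz_kernel \<alpha> x y) \<partial>lborel)"
        by (intro nn_integral_cong) (simp add: ennreal_mult'' mult.commute)
      also have "\<dots> = ennreal ((p x)\<^sup>2) * (\<integral>\<^sup>+y. ennreal (riesz_kernel \<alpha> x y) \<partial>lborel)"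
        by (rule nn_integral_cmult) measurable
      also have "\<dots> = ennreal ((p x)\<^sup>2) * ennreal (?C * norm x powr (- N))"
        using nn_integral_riesz_kernel[OF N, of \<alpha> x] \<alpha> elim unfolding N_def by simp
      also have "\<dots> = ennreal ((p x)\<^sup>2 * (?C * norm x powr (- N)))"
        by (simp add: ennreal_mult')
      also have "(p x)\<^sup>2 * (?C * norm x powr (- N)) = ?C * (\<phi> x / norm x)\<^sup>2"
      proof -
        have "(norm x powr ((N - 2) / 2))\<^sup>2 * norm x powr (- N) = norm x powr (N - 2) * norm x powr (- N)"
          unfolding power2_eq_square powr_add[symmetric] by (simp only: field_sum_of_halves)
        also have "\<dots> = norm x powr (-2)" unfolding powr_add[symmetric] by simp
        also have "\<dots> = inverse ((norm x)\<^sup>2)" using elim by (simp add: powr_minus)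
        finally have "(norm x powr ((N - 2) / 2))\<^sup>2 * norm x powr (- N) = inverse ((norm x)\<^sup>2)" .
        moreover have "(p x)\<^sup>2 * (?C * norm x powr (- N)) = ?C * (\<phi> x)\<^sup>2 * ((norm x powr ((N - 2) / 2))\<^sup>2 * norm x powr (- N))"
          by (simp only: p_def power_mult_distrib mult_ac)
        ultimately have "(p x)\<^sup>2 * (?C * norm x powr (- N)) = ?C * (\<phi> x)\<^sup>2 * inverse ((norm x)\<^sup>2)" by (simp only:)
        then show ?thesis
          unfolding power_divide[of "\<phi> x"] divide_inverse[of "(\<phi> x)\<^sup>2"] by (simp only: mult.assoc)
      qed
      finally show ?case .
    qed
  qed
  also have "\<dots> = ennreal (\<integral>x. ?C * (\<phi> x / norm x)\<^sup>2 \<partial>lborel)"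
    using C0 int by (intro nn_integral_eq_integral) auto
  also have "(\<integral>x. ?C * (\<phi> x / norm x)\<^sup>2 \<partial>lborel) = ?C * (\<integral>x. (\<phi> x / norm x)\<^sup>2 \<partial>lborel)"
    by (rule integral_mult_right_zero)
  finally have nn: "(\<integral>\<^sup>+z. ennreal (?f z) \<partial>(lborel \<Otimes>\<^sub>M lborel)) = ennreal (?C * (\<integral>x. (\<phi> x / norm x)\<^sup>2 \<partial>lborel))" .
  have nonneg: "0 \<le> ?C * (\<integral>x. (\<phi> x / norm x)\<^sup>2 \<partial>lborel)"
    by (rule mult_nonneg_nonneg[OF C0]) simp
  have "has_bochner_integral (lborel \<Otimes>\<^sub>M lborel) ?f (?C * (\<integral>x. (\<phi> x / norm x)\<^sup>2 \<partial>lborel))"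
    by (rule has_bochner_integral_nn_integral[OF fm _ nonneg nn]) (use f0 in auto)
  then show "integrable (lborel \<Otimes>\<^sub>M lborel) ?f" "integral\<^sup>L (lborel \<Otimes>\<^sub>M lborel) ?f = ?C * (\<integral>x. (\<phi> x / norm x)\<^sup>2 \<partial>lborel)"
    by (auto simp: has_bochner_integral_iff)
qed

text \<open>Expanding the square in the last double integral: its cross term cancels the first double
  integral, and by symmetry of the kernel the two remaining terms are equal.\<close>

lemma integral_riesz_kernel_expand:
  fixes \<phi> :: "'a::euclidean_space \<Rightarrow> real" and \<alpha> :: real
  defines "N \<equiv> real DIM('a)"
  defines "p \<equiv> \<lambda>x. \<phi> x * norm x powr ((N - 2) / 2)"
  assumes N: "3 \<le> DIM('a)" and \<alpha>: "0 < \<alpha>" "\<alpha> < N" and \<phi>m[measurable]: "\<phi> \<in> borel_measurable borel"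
    and int: "integrable lborel (\<lambda>x. (\<phi> x / norm x)\<^sup>2)"
  shows "integrable (lborel \<Otimes>\<^sub>M lborel) (\<lambda>(x, y). riesz_kernel \<alpha> x y * (p x * p y))"
    and "integrable (lborel \<Otimes>\<^sub>M lborel) (\<lambda>(x, y). riesz_kernel \<alpha> x y * \<bar>p x - p y\<bar>\<^sup>2)"
    and "const_C N \<alpha> * (((N - 2) / 2)\<^sup>2 * (\<integral>x. (\<phi> x / norm x)\<^sup>2 \<partial>lborel)) =
      integral\<^sup>L (lborel \<Otimes>\<^sub>M lborel) (\<lambda>(x, y). riesz_kernel \<alpha> x y * (p x * p y)) +
      1 / 2 * integral\<^sup>L (lborel \<Otimes>\<^sub>M lborel) (\<lambda>(x, y). riesz_kernel \<alpha> x y * \<bar>p x - p y\<bar>\<^sup>2)"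
proof -
  let ?M = "lborel \<Otimes>\<^sub>M lborel :: ('a \<times> 'a) measure"
  let ?T1 = "\<lambda>(x, y). riesz_kernel \<alpha> x y * (p x)\<^sup>2"
  let ?T2 = "\<lambda>(x, y). riesz_kernel \<alpha> x y * (p y)\<^sup>2"
  let ?T3 = "\<lambda>(x, y). riesz_kernel \<alpha> x y * (p x * p y)"
  let ?D = "\<lambda>(x, y). riesz_kernel \<alpha> x y * \<bar>p x - p y\<bar>\<^sup>2"
  have k0: "0 \<le> riesz_kernel \<alpha> x y" for x y :: 'a
    using riesz_kernel_nonneg \<alpha> unfolding N_def by blast
  have [measurable]: "p \<in> borel_measurable borel" unfolding p_def by measurable
  have T1: "integrable ?M ?T1"
    and I1: "integral\<^sup>L ?M ?T1 = const_C N \<alpha> * ((N - 2) / 2)\<^sup>2 * (\<integral>x. (\<phi> x / norm x)\<^sup>2 \<partial>lborel)"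
    using integral_riesz_kernel_square[OF N _ _ \<phi>m int, of \<alpha>] \<alpha> unfolding p_def N_def by auto
  have swap: "(\<lambda>(x, y). ?T1 (y, x)) = ?T2"
    by (auto simp: fun_eq_iff riesz_kernel_sym)
  have T2: "integrable ?M ?T2"
    using lborel_pair.integrable_product_swap[OF T1] unfolding swap .
  have I2: "integral\<^sup>L ?M ?T2 = integral\<^sup>L ?M ?T1"
    using lborel_pair.integral_product_swap[of ?T1] T1 unfolding swap by (auto dest: borel_measurable_integrable)
  show T3: "integrable ?M ?T3"
  \<comment> \<open>The cross term is dominated by the two square terms; its integrability is what
    permits splitting the integral of the expanded square.\<close>
  proof (rule Bochner_Integration.integrable_bound)
    show "integrable ?M (\<lambda>z. ?T1 z + ?T2 z)"
      using T1 T2 by (rule Bochner_Integration.integrable_add)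
    show "AE z in ?M. norm (?T3 z) \<le> norm (?T1 z + ?T2 z)"
    proof (intro always_eventually allI)
      fix z :: "'a \<times> 'a"
      obtain x y where z: "z = (x, y)" by (cases z)
      have "\<bar>p x * p y\<bar> \<le> (p x)\<^sup>2 + (p y)\<^sup>2"
        using sum_squares_bound[of "\<bar>p x\<bar>" "\<bar>p y\<bar>"] mult_nonneg_nonneg[OF abs_ge_zero[of "p x"] abs_ge_zero[of "p y"]]
        unfolding abs_mult power2_abs mult.assoc by linarith
      then have "riesz_kernel \<alpha> x y * \<bar>p x * p y\<bar> \<le> riesz_kernel \<alpha> x y * ((p x)\<^sup>2 + (p y)\<^sup>2)"
        by (rule mult_left_mono[OF _ k0])
      then show "norm (?T3 z) \<le> norm (?T1 z + ?T2 z)"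
        using k0[of x y] unfolding z by (simp add: abs_mult distrib_left)
    qed
  qed measurable
  have D: "?D = (\<lambda>z. ?T1 z + ?T2 z - 2 * ?T3 z)"
    by (auto simp: fun_eq_iff power2_diff algebra_simps)
  show "integrable ?M ?D"
    unfolding D by (intro Bochner_Integration.integrable_diff Bochner_Integration.integrable_add integrable_mult_right T1 T2 T3)
  have "integral\<^sup>L ?M ?D = integral\<^sup>L ?M ?T1 + integral\<^sup>L ?M ?T2 - 2 * integral\<^sup>L ?M ?T3"
    unfolding D Bochner_Integration.integral_diff[OF Bochner_Integration.integrable_add[OF T1 T2] integrable_mult_right[OF T3]]
      Bochner_Integration.integral_add[OF T1 T2] integral_mult_right_zero ..
  then show "const_C N \<alpha> * (((N - 2) / 2)\<^sup>2 * (\<integral>x. (\<phi> x / norm x)\<^sup>2 \<partial>lborel)) = integral\<^sup>L ?M ?T3 + 1 / 2 * integral\<^sup>L ?M ?D"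
    using I1 I2 unfolding mult.assoc by linarith
qed

theorem theoremB:
  fixes \<phi> :: "real ^ 'n \<Rightarrow> real" and N \<alpha> :: real
  defines "N \<equiv> real CARD('n)"
  assumes "CARD('n) \<ge> 3" and "0 < \<alpha>" and "\<alpha> < N" and "\<phi> \<in> hdot1"
  shows
    "integrable lborel (\<lambda>x. (norm (weak_grad \<phi> x))\<^sup>2)
     \<and> integrable lborel
       (\<lambda>x. (norm (weak_grad (\<lambda>z. norm z powr ((N - 2) / 2) * \<phi> z) x))\<^sup>2 / norm x powr (N - 2))
     \<and> integrable (lborel \<Otimes>\<^sub>M lborel)
       (\<lambda>(x, y). \<phi> x / norm x powr ((\<alpha> + 2) / 2) * riesz \<alpha> (x - y) *
                 (\<phi> y / norm y powr ((\<alpha> + 2) / 2)))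
     \<and> integrable (lborel \<Otimes>\<^sub>M lborel)
       (\<lambda>(x, y). riesz \<alpha> (x - y) / (norm x powr ((N + \<alpha>) / 2) * norm y powr ((N + \<alpha>) / 2)) *
                 \<bar>\<phi> x * norm x powr ((N - 2) / 2) - \<phi> y * norm y powr ((N - 2) / 2)\<bar>\<^sup>2)
     \<and> (const_C N \<alpha> *
       ((LINT x|lborel. (norm (weak_grad \<phi> x))\<^sup>2) -
        (LINT x|lborel.
           (norm (weak_grad (\<lambda>z. norm z powr ((N - 2) / 2) * \<phi> z) x))\<^sup>2 / norm x powr (N - 2)))
     = (LINT y|lborel. LINT x|lborel.
          \<phi> x / norm x powr ((\<alpha> + 2) / 2) * riesz \<alpha> (x - y) *
          (\<phi> y / norm y powr ((\<alpha> + 2) / 2)))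
       + 1 / 2 * (LINT y|lborel. LINT x|lborel.
          riesz \<alpha> (x - y) / (norm x powr ((N + \<alpha>) / 2) * norm y powr ((N + \<alpha>) / 2)) *
          \<bar>\<phi> x * norm x powr ((N - 2) / 2) - \<phi> y * norm y powr ((N - 2) / 2)\<bar>\<^sup>2))"
proof -
  have N: "N = real DIM(real ^ 'n)" and N3: "3 \<le> DIM(real ^ 'n)"
    using assms by (auto simp: N_def)
  have \<phi>m: "\<phi> \<in> borel_measurable borel"
    using \<open>\<phi> \<in> hdot1\<close> by (simp add: hdot1_def)
  note H = hdot1_ground_state[OF N3 \<open>\<phi> \<in> hdot1\<close>, folded N]
  note R = integral_riesz_kernel_expand[OF N3 \<open>0 < \<alpha>\<close> _ \<phi>m H(1), folded N, OF \<open>\<alpha> < N\<close>]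
  have t: "2 * ((N - 2) / 2) = N - 2" by simp
  \<comment> \<open>The exponents satisfy (N + \<alpha>) / 2 = (\<alpha> + 2) / 2 + (N - 2) / 2. At
    the origin both sides are 0, by \<open>0 powr r = 0\<close> and division by 0.\<close>
  have quot: "\<phi> x / norm x powr ((\<alpha> + 2) / 2) = \<phi> x * norm x powr ((N - 2) / 2) / norm x powr ((N + \<alpha>) / 2)" for x
  proof (cases "x = 0")
    case False
    have "norm x powr ((N + \<alpha>) / 2) = norm x powr ((\<alpha> + 2) / 2) * norm x powr ((N - 2) / 2)"
      unfolding powr_add[symmetric] by (rule arg_cong[where f="(powr) (norm x)"]) (simp add: field_simps)
    then show ?thesis using False by simp
  qed simp
  have k1: "\<phi> x / norm x powr ((\<alpha> + 2) / 2) * riesz \<alpha> (x - y) * (\<phi> y / norm y powr ((\<alpha> + 2) / 2)) =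
      riesz_kernel \<alpha> x y * ((\<phi> x * norm x powr ((N - 2) / 2)) * (\<phi> y * norm y powr ((N - 2) / 2)))" for x y
    unfolding quot riesz_kernel_def N[symmetric] by (simp only: divide_inverse inverse_mult_distrib mult_ac)
  have k2: "riesz \<alpha> (x - y) / (norm x powr ((N + \<alpha>) / 2) * norm y powr ((N + \<alpha>) / 2)) = riesz_kernel \<alpha> x y" for x y :: "real ^ 'n"
    unfolding riesz_kernel_def N[symmetric] ..
  \<comment> \<open>Integrability on the product space turns the iterated integrals into product
    integrals, by Fubini's theorem with the inner integral over x.\<close>
  show ?thesis
    unfolding k1 k2 lborel_pair.integral_snd[OF R(1)] lborel_pair.integral_snd[OF R(2)]
    using H(2) H(3)[unfolded t] H(4)[unfolded t] R by (simp only: simp_thms)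
qed

end
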